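(* Let $q\in\mathbb{C}$ with $0<|q|<1$ and let $\theta=\frac{1}{\pi}\arg(q)$. Let $\pi$ be the representation of the $C^*$-algebra $C(U_q(2))$ on the Hilbert space $\ell^2(\mathbb{N})\otimes\ell^2(\mathbb{Z})\otimes\ell^2(\mathbb{Z})$ given on the generators $a,b,D$ by $$\pi(a)=\sqrt{1-|q|^{2N}}\,V\otimes I\otimes I,\qquad \pi(b)=q^N\otimes U\otimes I,\qquad \pi(D)=I\otimes e^{-2\pi\sqrt{-1}\,\theta N}\otimes U .$$ Then $\pi$ is faithful.
   Context: $\mathbb{N}=\{0,1,2,\dots\}$. For $q\in\mathbb{C}\setminus\{0\}$, $C(U_q(2))$ is the universal unital $C^*$-algebra generated by $a,b,D$ subject to $$ba=qab,\quad a^*b=qba^*,\quad bb^*=b^*b,\quad aa^*+bb^*=1,\quad aD=Da,\quad bD=q^2|q|^{-2}Db,\quad DD^*=D^*D=1,\quad a^*a+|q|^2b^*b=1.$$ $\{e_n\}$ denotes the standard orthonormal basis of $\ell^2(\mathbb{N})$ or $\ell^2(\mathbb{Z})$; $N$ is the number operator $e_n\mapsto ne_n$ (on $\ell^2(\mathbb{N})$ or $\ell^2(\mathbb{Z})$ according to the tensor factor), so that functions of $N$ are the corresponding diagonal operators; $V:e_n\mapsto e_{n+1}$ is the right shift on $\ell^2(\mathbb{N})$; $U:e_n\mapsto e_{n+1}$ is the bilateral shift on $\ell^2(\mathbb{Z})$. Thus $\sqrt{1-|q|^{2N}}\,V e_n=\sqrt{1-|q|^{2(n+1)}}\,e_{n+1}$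 and $q^Ne_n=q^ne_n$. *)

theory Defs
  imports "HOL-Analysis.Analysis" "HOL-Library.Poly_Mapping" "HOL-Algebra.Module"
begin

text \<open>A word in the generators and their formal adjoints; the letter \<open>(g, True)\<close> stands for
  the adjoint of \<open>g\<close>.  Words form a type of their own so that concatenation can be the addition
  of the class \<^class>\<open>monoid_add\<close>, which makes \<open>'g star_word \<Rightarrow>\<^sub>0 complex\<close>, with the convolution product
  of \<^theory>\<open>HOL-Library.Poly_Mapping\<close>, the free algebra of noncommutative polynomials.\<close>

datatype 'g star_word = Word (letters: "('g \<times> bool) list")

instantiation star_word :: (type) monoid_add
begin

definition zero_star_word :: "'a star_word"
  where "0 = Word []"

definition plus_star_word :: "'a star_word \<Rightarrow> 'a star_word \<Rightarrow> 'a star_word"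
  where "v + w = Word (letters v @ letters w)"

instance
  by standard (simp_all add: zero_star_word_def plus_star_word_def)

end

type_synonym 'g star_poly = "'g star_word \<Rightarrow>\<^sub>0 complex"

definition gen :: "'g \<Rightarrow> 'g star_poly"
  where "gen g = Poly_Mapping.single (Word [(g, False)]) 1"

definition scale_poly :: "complex \<Rightarrow> 'g star_poly \<Rightarrow> 'g star_poly"
  where "scale_poly c x = Poly_Mapping.single 0 c * x"

definition star_of_word :: "'g star_word \<Rightarrow> 'g star_word"
  where "star_of_word w = Word (rev (map (\<lambda>(g, s). (g, \<not> s)) (letters w)))"

definition star_poly :: "'g star_poly \<Rightarrow> 'g star_poly"
  where "star_poly x =
    (\<Sum>w \<in> Poly_Mapping.keys x.
       Poly_Mapping.single (star_of_word w) (cnj (Poly_Mapping.lookup x w)))"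

text \<open>Unital C*-algebras generated by a family indexed by \<open>'g\<close> correspond to C*-seminorms on the
  free *-algebra (complete the quotient by the kernel of the seminorm; pull the norm back in the
  other direction), and the family satisfies a set \<open>R\<close> of relations \<open>r = 0\<close> precisely when the
  seminorm vanishes on \<open>R\<close>.  The universal C*-algebra is the Hausdorff completion of the free
  *-algebra in the largest of these seminorms.\<close>

definition cstar_seminorm :: "('g star_poly \<Rightarrow> real) \<Rightarrow> bool"
  where "cstar_seminorm p \<longleftrightarrow>
    (\<forall>x. 0 \<le> p x) \<and>
    (\<forall>x y. p (x + y) \<le> p x + p y) \<and>
    (\<forall>c x. p (scale_poly c x) = cmod c * p x) \<and>
    (\<forall>x y. p (x * y) \<le> p x * p y) \<and>
    (\<forall>x. p (star_poly x * x) = (p x)\<^sup>2)"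

text \<open>The supremum is meaningful when the relations bound every generator; otherwise no universal
  C*-algebra exists.\<close>

definition univ_norm :: "'g star_poly set \<Rightarrow> 'g star_poly \<Rightarrow> real"
  where "univ_norm R x = (SUP p \<in> {p. cstar_seminorm p \<and> (\<forall>r\<in>R. p r = 0)}. p x)"

definition cauchy_wrt :: "('a::minus \<Rightarrow> real) \<Rightarrow> (nat \<Rightarrow> 'a) \<Rightarrow> bool"
  where "cauchy_wrt p X \<longleftrightarrow> (\<forall>e>0. \<exists>M. \<forall>m\<ge>M. \<forall>n\<ge>M. p (X m - X n) < e)"

definition cauchy_class :: "('a::minus \<Rightarrow> real) \<Rightarrow> (nat \<Rightarrow> 'a) \<Rightarrow> (nat \<Rightarrow> 'a) set"
  where "cauchy_class p X = {Y. cauchy_wrt p Y \<and> (\<lambda>n. p (X n - Y n)) \<longlonglongrightarrow> 0}"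

record 'a star_algebra = "(complex, 'a) module" +
  star :: "'a \<Rightarrow> 'a"
  anorm :: "'a \<Rightarrow> real"

type_synonym 'g universal = "(nat \<Rightarrow> 'g star_poly) set"

definition universal_cstar_algebra :: "'g star_poly set \<Rightarrow> 'g universal star_algebra"
  where "universal_cstar_algebra R =
    (let p = univ_norm R; cl = cauchy_class p in
     \<lparr> carrier = {cl X | X. cauchy_wrt p X},
       mult = (\<lambda>S T. \<Union>X\<in>S. \<Union>Y\<in>T. cl (\<lambda>n. X n * Y n)),
       one = cl (\<lambda>n. 1),
       zero = cl (\<lambda>n. 0),
       add = (\<lambda>S T. \<Union>X\<in>S. \<Union>Y\<in>T. cl (\<lambda>n. X n + Y n)),
       smult = (\<lambda>c S. \<Union>X\<in>S. cl (\<lambda>n. scale_poly c (X n))),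
       star = (\<lambda>S. \<Union>X\<in>S. cl (\<lambda>n. star_poly (X n))),
       anorm = (\<lambda>S. THE r. \<forall>X\<in>S. (\<lambda>n. p (X n)) \<longlonglongrightarrow> r) \<rparr>)"

definition univ_gen :: "'g star_poly set \<Rightarrow> 'g \<Rightarrow> 'g universal"
  where "univ_gen R g = cauchy_class (univ_norm R) (\<lambda>n. gen g)"

datatype uq2_gen = GenA | GenB | GenD

definition uq2_relations :: "complex \<Rightarrow> uq2_gen star_poly set"
  where "uq2_relations q =
    (let a = gen GenA; b = gen GenB; D = gen GenD;
         a' = star_poly a; b' = star_poly b; D' = star_poly D in
     { b * a - scale_poly q (a * b),
       a' * b - scale_poly q (b * a'),
       b * b' - b' * b,
       a * a' + b * b' - 1,
       a * D - D * a,
       b * D - scale_poly (q\<^sup>2 / of_real ((cmod q)\<^sup>2)) (D * b),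
       D * D' - 1,
       D' * D - 1,
       a' * a + scale_poly (of_real ((cmod q)\<^sup>2)) (b' * b) - 1 })"

definition C_Uq2 :: "complex \<Rightarrow> uq2_gen universal star_algebra"
  where "C_Uq2 q = universal_cstar_algebra (uq2_relations q)"

definition uq2_a :: "complex \<Rightarrow> uq2_gen universal"
  where "uq2_a q = univ_gen (uq2_relations q) GenA"

definition uq2_b :: "complex \<Rightarrow> uq2_gen universal"
  where "uq2_b q = univ_gen (uq2_relations q) GenB"

definition uq2_D :: "complex \<Rightarrow> uq2_gen universal"
  where "uq2_D q = univ_gen (uq2_relations q) GenD"

typedef 'i ell2 = "{x :: 'i \<Rightarrow> complex. (\<lambda>i. (cmod (x i))\<^sup>2) summable_on UNIV}"
  by (rule exI[of _ "\<lambda>_. 0"]) simp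

setup_lifting type_definition_ell2

lemma sq_summable_add:
  fixes x y :: "'i \<Rightarrow> complex"
  assumes "(\<lambda>i. (cmod (x i))\<^sup>2) summable_on UNIV" "(\<lambda>i. (cmod (y i))\<^sup>2) summable_on UNIV"
  shows "(\<lambda>i. (cmod (x i + y i))\<^sup>2) summable_on UNIV"
proof (rule summable_on_comparison_test)
  show "(\<lambda>i. 2 * (cmod (x i))\<^sup>2 + 2 * (cmod (y i))\<^sup>2) summable_on UNIV"
    by (intro summable_on_add summable_on_cmult_right assms)
  show "(cmod (x i + y i))\<^sup>2 \<le> 2 * (cmod (x i))\<^sup>2 + 2 * (cmod (y i))\<^sup>2" for i
  proof -
    have "(cmod (x i + y i))\<^sup>2 \<le> (cmod (x i) + cmod (y i))\<^sup>2"
      by (simp add: norm_triangle_ineq power_mono)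
    also have "\<dots> \<le> 2 * (cmod (x i))\<^sup>2 + 2 * (cmod (y i))\<^sup>2"
      using sum_squares_bound[of "cmod (x i)" "cmod (y i)"] by (simp add: power2_sum)
    finally show ?thesis .
  qed
qed auto

lemma sq_summable_scale:
  fixes x :: "'i \<Rightarrow> complex"
  assumes "(\<lambda>i. (cmod (x i))\<^sup>2) summable_on UNIV"
  shows "(\<lambda>i. (cmod (c * x i))\<^sup>2) summable_on UNIV"
  using summable_on_cmult_right[OF assms, of "(cmod c)\<^sup>2"]
  by (simp add: norm_mult power_mult_distrib)

lemma sq_summable_cnj_mult:
  fixes x y :: "'i \<Rightarrow> complex"
  assumes "(\<lambda>i. (cmod (x i))\<^sup>2) summable_on UNIV" "(\<lambda>i. (cmod (y i))\<^sup>2) summable_on UNIV"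
  shows "(\<lambda>i. cnj (x i) * y i) summable_on UNIV"
proof -
  have "(\<lambda>i. norm (cnj (x i) * y i)) summable_on UNIV"
  proof (rule summable_on_comparison_test)
    show "(\<lambda>i. (cmod (x i))\<^sup>2 + (cmod (y i))\<^sup>2) summable_on UNIV"
      by (intro summable_on_add assms)
    show "norm (cnj (x i) * y i) \<le> (cmod (x i))\<^sup>2 + (cmod (y i))\<^sup>2" for i
    proof -
      have "0 \<le> cmod (x i) * cmod (y i)" by simp
      then show ?thesis
        using sum_squares_bound[of "cmod (x i)" "cmod (y i)"] unfolding norm_mult complex_mod_cnj by linarith
    qed
  qed auto
  then show ?thesis by (simp add: abs_summable_summable)
qed

lift_definition scaleC_ell2 :: "complex \<Rightarrow> 'i ell2 \<Rightarrow> 'i ell2"  (infixr \<open>*\<^sub>C\<close> 75)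
  is "\<lambda>c x i. c * x i"
  by (rule sq_summable_scale)

lift_definition cinner_ell2 :: "'i ell2 \<Rightarrow> 'i ell2 \<Rightarrow> complex"
  is "\<lambda>x y. \<Sum>\<^sub>\<infinity>i. cnj (x i) * y i" .

instantiation ell2 :: (type) real_inner
begin

lift_definition zero_ell2 :: "'a ell2" is "\<lambda>_. 0" by simp

lift_definition plus_ell2 :: "'a ell2 \<Rightarrow> 'a ell2 \<Rightarrow> 'a ell2" is "\<lambda>x y i. x i + y i"
  by (rule sq_summable_add)

lift_definition uminus_ell2 :: "'a ell2 \<Rightarrow> 'a ell2" is "\<lambda>x i. - x i" by simp

lift_definition minus_ell2 :: "'a ell2 \<Rightarrow> 'a ell2 \<Rightarrow> 'a ell2" is "\<lambda>x y i. x i - y i"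
  using sq_summable_add[of _ "\<lambda>i. - _ i"] by simp

definition scaleR_ell2 :: "real \<Rightarrow> 'a ell2 \<Rightarrow> 'a ell2"
  where "r *\<^sub>R x = complex_of_real r *\<^sub>C x"

definition inner_ell2 :: "'a ell2 \<Rightarrow> 'a ell2 \<Rightarrow> real"
  where "inner x y = Re (cinner_ell2 x y)"

definition norm_ell2 :: "'a ell2 \<Rightarrow> real"
  where "norm x = sqrt (Re (cinner_ell2 x x))"

definition dist_ell2 :: "'a ell2 \<Rightarrow> 'a ell2 \<Rightarrow> real"
  where "dist_ell2 x y = norm (x - y)"

definition sgn_ell2 :: "'a ell2 \<Rightarrow> 'a ell2"
  where "sgn_ell2 x = inverse (norm x) *\<^sub>R x"

definition uniformity_ell2 :: "('a ell2 \<times> 'a ell2) filter"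
  where "uniformity_ell2 = (INF e\<in>{0<..}. principal {(x, y). dist x y < e})"

definition open_ell2 :: "'a ell2 set \<Rightarrow> bool"
  where "open_ell2 U = (\<forall>x\<in>U. eventually (\<lambda>(x', y). x' = x \<longrightarrow> y \<in> U) uniformity)"

instance
proof
  fix x y z :: "'a ell2" and r s :: real
  show "x + y + z = x + (y + z)" by transfer (simp add: add.assoc)
  show "x + y = y + x" by transfer (simp add: add.commute)
  show "0 + x = x" by transfer simp
  show "- x + x = 0" by transfer simp
  show "x - y = x + - y" by transfer simp
  show "r *\<^sub>R (x + y) = r *\<^sub>R x + r *\<^sub>R y"
    unfolding scaleR_ell2_def by transfer (simp add: algebra_simps)
  show "(r + s) *\<^sub>R x = r *\<^sub>R x + s *\<^sub>R x"
    unfolding scaleR_ell2_def by transfer (simp add: algebra_simps)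
  show "r *\<^sub>R s *\<^sub>R x = (r * s) *\<^sub>R x"
    unfolding scaleR_ell2_def by transfer (simp add: algebra_simps)
  show "1 *\<^sub>R x = x"
    unfolding scaleR_ell2_def by transfer simp
  show "sgn x = inverse (norm x) *\<^sub>R x" by (rule sgn_ell2_def)
  show "dist x y = norm (x - y)" by (rule dist_ell2_def)
  show "(uniformity :: ('a ell2 \<times> 'a ell2) filter)
      = (INF e\<in>{0<..}. principal {(x, y). dist x y < e})"
    by (rule uniformity_ell2_def)
  show "open U = (\<forall>x\<in>U. eventually (\<lambda>(x', y). x' = x \<longrightarrow> y \<in> U) uniformity)"
    for U :: "'a ell2 set"
    by (rule open_ell2_def)
  have "cinner_ell2 x y = cnj (cinner_ell2 y x)"
    by transfer (simp flip: infsum_cnj add: mult.commute)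
  then show "inner x y = inner y x" by (simp add: inner_ell2_def)
  have "cinner_ell2 (x + y) z = cinner_ell2 x z + cinner_ell2 y z"
    by transfer (simp add: distrib_right infsum_add sq_summable_cnj_mult)
  then show "inner (x + y) z = inner x z + inner y z" by (simp add: inner_ell2_def)
  have "cinner_ell2 (r *\<^sub>R x) y = of_real r * cinner_ell2 x y"
    unfolding scaleR_ell2_def
    by transfer (simp add: mult.assoc infsum_cmult_right')
  then show "inner (r *\<^sub>R x) y = r * inner x y" by (simp add: inner_ell2_def)
  have sq: "cinner_ell2 x x = of_real (\<Sum>\<^sub>\<infinity>i. (cmod (Rep_ell2 x i))\<^sup>2)"
  proof -
    have "((\<lambda>i. complex_of_real ((cmod (Rep_ell2 x i))\<^sup>2)) has_sum
        of_real (\<Sum>\<^sub>\<infinity>i. (cmod (Rep_ell2 x i))\<^sup>2)) UNIV"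
      using Rep_ell2[of x] by (intro has_sum_of_real has_sum_infsum) simp
    then show ?thesis
      unfolding cinner_ell2.rep_eq complex_norm_square
      by (simp add: infsumI mult.commute)
  qed
  then show "0 \<le> inner x x" by (simp add: inner_ell2_def infsum_nonneg)
  have "inner x x = 0 \<longleftrightarrow> (\<Sum>\<^sub>\<infinity>i. (cmod (Rep_ell2 x i))\<^sup>2) = 0"
    using sq by (simp add: inner_ell2_def)
  also have "\<dots> \<longleftrightarrow> (\<forall>i. Rep_ell2 x i = 0)"
  proof
    assume "(\<Sum>\<^sub>\<infinity>i. (cmod (Rep_ell2 x i))\<^sup>2) = 0"
    then have "(cmod (Rep_ell2 x i))\<^sup>2 = 0" for i
      by (rule nonneg_infsum_le_0D[OF eq_refl]) (use Rep_ell2[of x] in auto)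
    then show "\<forall>i. Rep_ell2 x i = 0" by simp
  qed simp
  also have "\<dots> \<longleftrightarrow> x = 0" by transfer auto
  finally show "inner x x = 0 \<longleftrightarrow> x = 0" .
  show "norm x = sqrt (inner x x)" by (simp add: norm_ell2_def inner_ell2_def)
qed

end

lift_definition ket :: "'i \<Rightarrow> 'i ell2" is "\<lambda>i j. if j = i then 1 else 0"
proof -
  fix i :: 'i
  show "(\<lambda>j. (cmod (if j = i then 1 else 0))\<^sup>2) summable_on UNIV"
    by (rule finite_nonzero_values_imp_summable_on) (auto intro: finite_subset[of _ "{i}"])
qed

definition bounded_op :: "('i ell2 \<Rightarrow> 'j ell2) \<Rightarrow> bool"
  where "bounded_op T \<longleftrightarrow> bounded_linear T \<and> (\<forall>c x. T (c *\<^sub>C x) = c *\<^sub>C T x)"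

text \<open>The diagonal operator \<open>f(N)\<close>; only meaningful for bounded \<open>f\<close>.\<close>

definition diag_op :: "('i \<Rightarrow> complex) \<Rightarrow> 'i ell2 \<Rightarrow> 'i ell2"
  where "diag_op f x = Abs_ell2 (\<lambda>i. f i * Rep_ell2 x i)"

lift_definition right_shift :: "nat ell2 \<Rightarrow> nat ell2"
  is "\<lambda>x n. case n of 0 \<Rightarrow> 0 | Suc m \<Rightarrow> x m"
proof -
  fix x :: "nat \<Rightarrow> complex"
  assume "(\<lambda>i. (cmod (x i))\<^sup>2) summable_on UNIV"
  then have "(\<lambda>n. (cmod (case n of 0 \<Rightarrow> 0 | Suc m \<Rightarrow> x m))\<^sup>2) summable_on range Suc"
    by (subst summable_on_reindex) (auto simp: o_def)
  then show "(\<lambda>n. (cmod (case n of 0 \<Rightarrow> 0 | Suc m \<Rightarrow> x m))\<^sup>2) summable_on UNIV"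
    by (subst summable_on_cong_neutral[where T = "range Suc"])
       (auto simp: image_iff split: nat.splits)
qed

lift_definition bilateral_shift :: "int ell2 \<Rightarrow> int ell2"
  is "\<lambda>x k. x (k - 1)"
proof -
  fix x :: "int \<Rightarrow> complex"
  assume "(\<lambda>i. (cmod (x i))\<^sup>2) summable_on UNIV"
  moreover have "bij (\<lambda>k::int. k - 1)"
    by (rule bij_betw_byWitness[where f' = "\<lambda>k. k + 1"]) auto
  ultimately show "(\<lambda>k. (cmod (x (k - 1)))\<^sup>2) summable_on UNIV"
    using summable_on_reindex_bij_betw[of "\<lambda>k::int. k - 1" UNIV UNIV "\<lambda>i. (cmod (x i))\<^sup>2"] by simp
qed

lemma diag_op_ket: "diag_op f (ket i) = f i *\<^sub>C ket i"
proof -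
  have "(\<lambda>j. f j * Rep_ell2 (ket i) j) = (\<lambda>j. f i * Rep_ell2 (ket i) j)"
    by (auto simp: ket.rep_eq)
  then show ?thesis
    by (simp add: diag_op_def scaleC_ell2_def)
qed

lemma right_shift_ket: "right_shift (ket n) = ket (Suc n)"
  by transfer (auto split: nat.splits)

lemma bilateral_shift_ket: "bilateral_shift (ket k) = ket (k + 1)"
  by transfer auto

text \<open>The Hilbert space tensor product of \<open>'i ell2\<close> and \<open>'j ell2\<close> is realised as
  \<open>('i \<times> 'j) ell2\<close>, through the following elementary tensors.\<close>

lift_definition tensor_vec :: "'i ell2 \<Rightarrow> 'j ell2 \<Rightarrow> ('i \<times> 'j) ell2"  (infixr \<open>\<otimes>\<^sub>v\<close> 71)
  is "\<lambda>x y (i, j). x i * y j"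
proof -
  fix x :: "'i \<Rightarrow> complex" and y :: "'j \<Rightarrow> complex"
  assume x: "(\<lambda>i. (cmod (x i))\<^sup>2) summable_on UNIV" and y: "(\<lambda>j. (cmod (y j))\<^sup>2) summable_on UNIV"
  have "(\<lambda>(i, j). (cmod (x i))\<^sup>2 * (cmod (y j))\<^sup>2) summable_on (UNIV \<times> UNIV)"
    by (rule summable_on_SigmaI[where g = "\<lambda>i. (cmod (x i))\<^sup>2 * (\<Sum>\<^sub>\<infinity>j. (cmod (y j))\<^sup>2)"])
       (auto intro!: has_sum_cmult_right summable_on_cmult_left has_sum_infsum x y)
  then show "(\<lambda>k. (cmod (case k of (i, j) \<Rightarrow> x i * y j))\<^sup>2) summable_on UNIV"
    by (simp add: case_prod_unfold norm_mult power_mult_distrib)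
qed

lemma tensor_vec_ket: "ket i \<otimes>\<^sub>v ket j = ket (i, j)"
  by transfer auto

text \<open>Elementary tensors span a dense subspace, so for bounded \<open>T\<close> and \<open>S\<close> the description
  below determines a unique operator.\<close>

definition tensor_op ::
    "('i ell2 \<Rightarrow> 'k ell2) \<Rightarrow> ('j ell2 \<Rightarrow> 'l ell2) \<Rightarrow> ('i \<times> 'j) ell2 \<Rightarrow> ('k \<times> 'l) ell2"
    (infixr \<open>\<otimes>\<^sub>o\<close> 71)
  where "T \<otimes>\<^sub>o S = (THE R. bounded_op R \<and> (\<forall>x y. R (x \<otimes>\<^sub>v y) = T x \<otimes>\<^sub>v S y))"

definition representation ::
    "('x, 'm) star_algebra_scheme \<Rightarrow> ('x \<Rightarrow> 'i ell2 \<Rightarrow> 'i ell2) \<Rightarrow> bool"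
  where "representation A \<pi> \<longleftrightarrow>
    (\<forall>x\<in>carrier A. bounded_op (\<pi> x)) \<and>
    (\<forall>x\<in>carrier A. \<forall>y\<in>carrier A. \<pi> (x \<oplus>\<^bsub>A\<^esub> y) = (\<lambda>u. \<pi> x u + \<pi> y u)) \<and>
    (\<forall>c. \<forall>x\<in>carrier A. \<pi> (c \<odot>\<^bsub>A\<^esub> x) = (\<lambda>u. c *\<^sub>C \<pi> x u)) \<and>
    (\<forall>x\<in>carrier A. \<forall>y\<in>carrier A. \<pi> (x \<otimes>\<^bsub>A\<^esub> y) = \<pi> x \<circ> \<pi> y) \<and>
    \<pi> \<one>\<^bsub>A\<^esub> = id \<and>
    (\<forall>x\<in>carrier A. \<forall>u v. cinner_ell2 (\<pi> (star A x) u) v = cinner_ell2 u (\<pi> x v))"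

definition faithful :: "('x, 'm) star_algebra_scheme \<Rightarrow> ('x \<Rightarrow> 'i ell2 \<Rightarrow> 'i ell2) \<Rightarrow> bool"
  where "faithful A \<pi> \<longleftrightarrow> inj_on \<pi> (carrier A)"

definition uq2_rep ::
    "complex \<Rightarrow> real \<Rightarrow> (uq2_gen universal \<Rightarrow> (nat \<times> int \<times> int) ell2 \<Rightarrow> (nat \<times> int \<times> int) ell2) \<Rightarrow> bool"
  where "uq2_rep q \<theta> \<pi> \<longleftrightarrow>
    representation (C_Uq2 q) \<pi> \<and>
    \<pi> (uq2_a q) = (diag_op (\<lambda>n. of_real (sqrt (1 - cmod q ^ (2 * n)))) \<circ> right_shift) \<otimes>\<^sub>o id \<otimes>\<^sub>o id \<and>
    \<pi> (uq2_b q) = diag_op (\<lambda>n. q ^ n) \<otimes>\<^sub>o bilateral_shift \<otimes>\<^sub>o id \<and>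
    \<pi> (uq2_D q) = id \<otimes>\<^sub>o diag_op (\<lambda>k. exp (- 2 * of_real pi * \<i> * of_real \<theta> * of_int k)) \<otimes>\<^sub>o bilateral_shift"

end

theory Submission
  imports Defs "HOL-Computational_Algebra.Polynomial" "HOL-Real_Asymp.Real_Asymp"
begin

text \<open>Let \<open>\<rho>\<close> be the concrete representation of the free *-algebra and \<open>p\<close> any C*-seminorm killing
  the relations; the point is that \<open>p x \<le> \<parallel>\<rho>(x)\<parallel>\<close>, so that the universal norm is \<open>\<parallel>\<rho>(\<cdot>)\<parallel>\<close>.
  The relations are homogeneous for the grading by the degrees in \<open>a\<close>, \<open>b\<close>, \<open>D\<close>, and elements of degree
  zero are polynomials in \<open>\<eta> = b\<^sup>* b\<close>.  With \<open>r = \<bar>q\<bar>\<^sup>2\<close> one has \<open>f(\<eta>) a\<^sup>m = a\<^sup>m f(r\<^sup>m \<eta>)\<close> and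
  \<open>a\<^sup>m a\<^sup>*\<^sup>m = \<Prod>\<^sub>i\<^sub><\<^sub>m (1 - \<eta> / r\<^sup>i)\<close>, which forces \<open>p (f(\<eta>)) \<le> sup\<^sub>n \<bar>f(r\<^sup>n)\<bar>\<close>.  A homogeneous component
  \<open>y\<^sub>d\<close> of \<open>y\<close> therefore satisfies \<open>p(y\<^sub>d)\<^sup>2 = p(y\<^sub>d\<^sup>* y\<^sub>d) \<le> sup\<^sub>n \<parallel>\<rho>(y\<^sub>d) e\<^sub>n\<^sub>0\<^sub>0\<parallel>\<^sup>2 \<le> \<parallel>\<rho>(y)\<parallel>\<^sup>2\<close>, the
  components having orthogonal images.  For \<open>y = (x\<^sup>* x)\<^sup>N\<close>, \<open>N = 2\<^sup>k\<close>, only polynomially many degrees occur,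
  whence \<open>p(x)\<^sup>2\<^sup>N \<le> poly(N) \<parallel>\<rho>(x)\<parallel>\<^sup>2\<^sup>N\<close>; taking roots gives the claim.
  Finally, every representation of the completed algebra is contractive by a Neumann series argument,
  so one that is isometric on the dense image of the free *-algebra is injective.\<close>

notation scale_poly (infixr \<open>*\<^sub>P\<close> 75)

section \<open>The free *-algebra\<close>

lemma star_poly_expand:
  fixes x :: "'g star_poly"
  shows "x = (\<Sum>w\<in>Poly_Mapping.keys x. Poly_Mapping.single w (Poly_Mapping.lookup x w))"
  by (rule poly_mapping_eqI)
     (auto simp: lookup_sum lookup_single when_def in_keys_iff sum.delta' cong: if_cong)

lemma star_poly_induct [case_names zero single add]:
  fixes x :: "'g star_poly"
  assumes "P 0" "\<And>w c. P (Poly_Mapping.single w c)" "\<And>x y. P x \<Longrightarrow> P y \<Longrightarrow> P (x + y)"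
  shows "P x"
proof -
  have "P (\<Sum>w\<in>A. Poly_Mapping.single w (Poly_Mapping.lookup x w))" if "finite A" for A
    using that by induction (auto intro: assms)
  then show ?thesis
    using star_poly_expand[of x] finite_keys by metis
qed

lemma lookup_scale_poly [simp]:
  "Poly_Mapping.lookup (c *\<^sub>P x) w = c * Poly_Mapping.lookup x w"
  unfolding scale_poly_def mult_map_scale_conv_mult[symmetric]
  by (transfer, simp add: when_def)

lemma scale_poly_single [simp]: "c *\<^sub>P Poly_Mapping.single w d = Poly_Mapping.single w (c * d)"
  by (simp add: scale_poly_def mult_single)

lemma scale_poly_mult_left [simp]: "(c *\<^sub>P x) * y = c *\<^sub>P (x * y)"
  by (simp add: scale_poly_def mult.assoc)

lemma scale_poly_add_right: "c *\<^sub>P (x + y) = c *\<^sub>P x + c *\<^sub>P y"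
  by (simp add: scale_poly_def distrib_left)

lemma scale_poly_diff_right: "c *\<^sub>P (x - y) = c *\<^sub>P x - c *\<^sub>P y"
  by (simp add: scale_poly_def right_diff_distrib)

lemma scale_poly_add_left: "(c + d) *\<^sub>P x = c *\<^sub>P x + d *\<^sub>P x"
  by (simp add: scale_poly_def distrib_right single_add)

lemma scale_poly_scale_poly [simp]: "c *\<^sub>P d *\<^sub>P x = (c * d) *\<^sub>P x"
  by (simp add: scale_poly_def mult.assoc[symmetric] mult_single)

lemma scale_poly_one [simp]: "1 *\<^sub>P x = x"
  by (simp add: scale_poly_def)

lemma scale_poly_zero [simp]: "0 *\<^sub>P x = 0" "c *\<^sub>P 0 = 0"
  by (simp_all add: scale_poly_def)

lemma scale_poly_minus_left: "(- c) *\<^sub>P x = - (c *\<^sub>P x)"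
  by (simp add: scale_poly_def single_uminus)

lemma scale_poly_minus_one: "(-1) *\<^sub>P x = - x"
  by (simp add: scale_poly_def single_uminus)

text \<open>Scalars are central because they sit on the empty word, the unit of concatenation; the
  convolution product itself does not commute, hence the induction on \<open>x\<close>.\<close>

lemma scale_poly_mult_right [simp]: "x * (c *\<^sub>P y) = c *\<^sub>P (x * y)"
proof (induction x rule: star_poly_induct)
  case (single w d)
  then show ?case
    by (simp add: scale_poly_def mult.assoc[symmetric] mult_single mult.commute)
qed (simp_all add: distrib_right scale_poly_add_right)

lemma star_of_word_simps [simp]:
  "star_of_word (star_of_word w) = w" "star_of_word (v + w) = star_of_word w + star_of_word v"
  "star_of_word 0 = 0" "star_of_word (Word []) = Word []"
  by (simp_all add: star_of_word_def plus_star_word_def zero_star_word_def rev_map o_def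
      case_prod_unfold)

lemma star_of_word_eq_iff: "star_of_word v = w \<longleftrightarrow> v = star_of_word w"
  by auto

lemma lookup_star_poly [simp]:
  "Poly_Mapping.lookup (star_poly x) w = cnj (Poly_Mapping.lookup x (star_of_word w))"
  unfolding star_poly_def
  by (auto simp: lookup_sum lookup_single when_def star_of_word_eq_iff in_keys_iff sum.delta'
      cong: if_cong)

lemma star_poly_add [simp]: "star_poly (x + y) = star_poly x + star_poly y"
  by (rule poly_mapping_eqI) (simp add: lookup_add)

lemma star_poly_diff [simp]: "star_poly (x - y) = star_poly x - star_poly y"
  by (rule poly_mapping_eqI) (simp add: lookup_minus)

lemma star_poly_star_poly [simp]: "star_poly (star_poly x) = x"
  by (rule poly_mapping_eqI) simp

lemma star_poly_scale_poly [simp]: "star_poly (c *\<^sub>P x) = cnj c *\<^sub>P star_poly x"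
  by (rule poly_mapping_eqI) simp

lemma star_poly_zero [simp]: "star_poly 0 = 0"
  by (rule poly_mapping_eqI) simp

lemma star_poly_sum: "star_poly (\<Sum>i\<in>A. f i) = (\<Sum>i\<in>A. star_poly (f i))"
  by (induction A rule: infinite_finite_induct) simp_all

lemma star_poly_single [simp]:
  "star_poly (Poly_Mapping.single w c) = Poly_Mapping.single (star_of_word w) (cnj c)"
  by (rule poly_mapping_eqI) (auto simp: lookup_single when_def)

lemma star_poly_one [simp]: "star_poly 1 = 1"
  by (simp flip: single_one)

lemma star_poly_mult [simp]: "star_poly (x * y) = star_poly y * star_poly x"
proof (induction x rule: star_poly_induct)
  case (single w c)
  show ?case
    by (induction y rule: star_poly_induct) (simp_all add: mult_single distrib_left distrib_right mult.commute)
qed (simp_all add: distrib_left distrib_right)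

lemma star_poly_power [simp]: "star_poly (x ^ n) = star_poly x ^ n"
  by (induction n) (simp_all add: power_commutes)

text \<open>Indexing monomials by bare lists lets list induction and splitting act on the letters
  without unwrapping \<open>Word\<close>.\<close>

definition word_poly :: "('g \<times> bool) list \<Rightarrow> 'g star_poly"
  where "word_poly l = Poly_Mapping.single (Word l) 1"

lemma word_poly_Nil [simp]: "word_poly [] = 1"
  by (simp add: word_poly_def flip: zero_star_word_def)

lemma word_poly_append: "word_poly (l @ m) = word_poly l * word_poly m"
  by (simp add: word_poly_def mult_single plus_star_word_def)

lemma word_poly_Cons: "word_poly (s # l) = word_poly [s] * word_poly l"
  using word_poly_append[of "[s]" l] by simp

lemma gen_eq_word_poly: "gen g = word_poly [(g, False)]"
  by (simp add: gen_def word_poly_def)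

lemma star_poly_gen: "star_poly (gen g) = word_poly [(g, True)]"
  by (simp add: gen_def word_poly_def star_of_word_def)

lemma single_eq_word_poly: "Poly_Mapping.single w c = c *\<^sub>P word_poly (letters w)"
  by (simp add: word_poly_def)

lemma star_poly_word_poly: "star_poly (word_poly l) = word_poly (rev (map (\<lambda>(g, s). (g, \<not> s)) l))"
  by (simp add: word_poly_def star_of_word_def)

section \<open>C*-seminorms\<close>

locale cstar_seminormed =
  fixes p :: "'g star_poly \<Rightarrow> real"
  assumes is_cstar_seminorm: "cstar_seminorm p"
begin

lemma nonneg [simp]: "0 \<le> p x"
  and triangle: "p (x + y) \<le> p x + p y"
  and scale [simp]: "p (c *\<^sub>P x) = cmod c * p x"
  and submult: "p (x * y) \<le> p x * p y"
  and cstar: "p (star_poly x * x) = (p x)\<^sup>2"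
  using is_cstar_seminorm unfolding cstar_seminorm_def by blast+

lemma zero [simp]: "p 0 = 0"
  using scale[of 0 0] by simp

lemma minus [simp]: "p (- x) = p x"
  using scale[of "-1" x] by (simp only: scale_poly_minus_one) simp

lemma triangle_diff: "p (x - y) \<le> p x + p y"
  using triangle[of x "- y"] by simp

lemma diff_commute: "p (x - y) = p (y - x)"
  using minus[of "x - y"] by simp

lemma triangle3: "p (x - z) \<le> p (x - y) + p (y - z)"
  using triangle[of "x - y" "y - z"] by simp

lemma reverse_triangle: "\<bar>p x - p y\<bar> \<le> p (x - y)"
  using triangle[of "x - y" y] triangle[of "y - x" x] diff_commute[of x y] by simp

lemma sum_le: "p (\<Sum>i\<in>A. f i) \<le> (\<Sum>i\<in>A. p (f i))"
proof (induction A rule: infinite_finite_induct)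
  case (insert i A)
  then show ?case using triangle[of "f i" "sum f A"] by simp
qed simp_all

lemma star [simp]: "p (star_poly x) = p x"
proof -
  \<comment> \<open>The C*-identity and submultiplicativity bound \<open>p y * p y\<close> by
    \<open>p (star_poly y) * p y\<close>; one factor cancels. Replacing \<open>y\<close> by its
    adjoint gives the equality.\<close>
  have le: "p y \<le> p (star_poly y)" for y
    using cstar[of y] submult[of "star_poly y" y] mult_right_le_imp_le[of "p y" "p y" "p (star_poly y)"]
    by (cases "p y = 0") (auto simp: power2_eq_square less_le)
  show ?thesis using le[of x] le[of "star_poly x"] by simp
qed

text \<open>The C*-identity makes \<open>p 1\<close> idempotent, so it is 0 or 1; the value 0
  belongs to the zero seminorm.\<close>

lemma one_le: "p 1 \<le> 1"
  using cstar[of 1] by (auto simp: power2_eq_square)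

lemma power_le: "p (x ^ n) \<le> p x ^ n"
proof (induction n)
  case (Suc n)
  then show ?case
    using submult[of x "x ^ n"] mult_left_mono[of "p (x ^ n)" "p x ^ n" "p x"] by simp
qed (simp add: one_le)

text \<open>On a self-adjoint element each use of the C*-identity doubles the exponent, which is why
  powers of two are used in the growth arguments.\<close>

lemma self_adjoint_power:
  assumes "star_poly x = x"
  shows "p (x ^ 2 ^ k) = p x ^ 2 ^ k"
proof (induction k)
  case (Suc k)
  have "x ^ 2 ^ Suc k = star_poly (x ^ 2 ^ k) * x ^ 2 ^ k"
    by (simp add: assms mult_2 flip: power_add)
  then show ?case
    using cstar[of "x ^ 2 ^ k"] Suc by (simp add: mult.commute[of 2] power_mult)
qed simp

lemma mult_diff_le: "p (x * y - x' * y') \<le> p x * p (y - y') + p (x - x') * p y'"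
proof -
  have "x * y - x' * y' = x * (y - y') + (x - x') * y'"
    by (simp add: algebra_simps)
  then show ?thesis
    using triangle[of "x * (y - y')" "(x - x') * y'"] submult[of x "y - y'"] submult[of "x - x'" y']
    by simp
qed

end

section \<open>The Hilbert space\<close>

lemmas rep_ell2_simps [simp] =
  plus_ell2.rep_eq minus_ell2.rep_eq uminus_ell2.rep_eq zero_ell2.rep_eq scaleC_ell2.rep_eq
  ket.rep_eq tensor_vec.rep_eq right_shift.rep_eq bilateral_shift.rep_eq

lemma ell2_eqI: "(\<And>i. Rep_ell2 x i = Rep_ell2 y i) \<Longrightarrow> x = y"
  by (metis Rep_ell2_inject ext)

lemma sq_summable_Rep_ell2: "(\<lambda>i. (cmod (Rep_ell2 x i))\<^sup>2) summable_on A"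
  by (rule summable_on_subset_banach[of _ UNIV]) (use Rep_ell2[of x] in auto)

lemma cinner_add_left: "cinner_ell2 (x + y) z = cinner_ell2 x z + cinner_ell2 y z"
  by transfer (simp add: distrib_right infsum_add sq_summable_cnj_mult)

lemma cinner_add_right: "cinner_ell2 x (y + z) = cinner_ell2 x y + cinner_ell2 x z"
  by transfer (simp add: distrib_left infsum_add sq_summable_cnj_mult)

lemma cinner_scale_left: "cinner_ell2 (c *\<^sub>C x) y = cnj c * cinner_ell2 x y"
  by transfer (simp add: mult.assoc infsum_cmult_right')

lemma cinner_scale_right: "cinner_ell2 x (c *\<^sub>C y) = c * cinner_ell2 x y"
  by transfer (simp add: mult.left_commute infsum_cmult_right')

lemma cinner_commute: "cinner_ell2 x y = cnj (cinner_ell2 y x)"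
  by transfer (simp flip: infsum_cnj add: mult.commute)

lemma cinner_zero [simp]: "cinner_ell2 0 x = 0" "cinner_ell2 x 0 = 0"
  by (transfer, simp)+

lemma cinner_self: "cinner_ell2 x x = of_real ((norm x)\<^sup>2)"
proof -
  have "Im (cinner_ell2 x x) = 0"
    using arg_cong[OF cinner_commute[of x x], of Im] by simp
  moreover have "Re (cinner_ell2 x x) = (norm x)\<^sup>2"
    using power2_norm_eq_inner[of x] by (simp add: inner_ell2_def)
  ultimately show ?thesis by (simp add: complex_eq_iff)
qed

lemma norm_ell2_sq: "(norm x)\<^sup>2 = (\<Sum>\<^sub>\<infinity>i. (cmod (Rep_ell2 x i))\<^sup>2)"
proof -
  have "((\<lambda>i. complex_of_real ((cmod (Rep_ell2 x i))\<^sup>2)) has_sum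
      of_real (\<Sum>\<^sub>\<infinity>i. (cmod (Rep_ell2 x i))\<^sup>2)) UNIV"
    by (intro has_sum_of_real has_sum_infsum sq_summable_Rep_ell2)
  then have "cinner_ell2 x x = of_real (\<Sum>\<^sub>\<infinity>i. (cmod (Rep_ell2 x i))\<^sup>2)"
    unfolding cinner_ell2.rep_eq complex_norm_square by (simp add: infsumI mult.commute)
  then show ?thesis
    unfolding cinner_self of_real_eq_iff .
qed

lemma norm_scaleC_ell2 [simp]: "norm (c *\<^sub>C x) = cmod c * norm x" for x :: "'i ell2"
proof (rule power2_eq_imp_eq)
  show "(norm (c *\<^sub>C x))\<^sup>2 = (cmod c * norm x)\<^sup>2"
    by (simp add: norm_ell2_sq norm_mult power_mult_distrib infsum_cmult_right')
qed auto

lemma scaleC_ell2_algebra [simp]: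
  "1 *\<^sub>C x = x" "0 *\<^sub>C x = 0" "c *\<^sub>C 0 = 0" "c *\<^sub>C d *\<^sub>C x = (c * d) *\<^sub>C x"
  "(-1) *\<^sub>C x = - x"
  by (rule ell2_eqI, simp)+

lemma scaleC_add_right: "c *\<^sub>C (x + y) = c *\<^sub>C x + c *\<^sub>C y"
  and scaleC_add_left: "(c + d) *\<^sub>C x = c *\<^sub>C x + d *\<^sub>C x"
  by (rule ell2_eqI, simp add: algebra_simps)+

lemma norm_ell2_mono:
  assumes "\<And>i. cmod (Rep_ell2 x i) \<le> cmod (Rep_ell2 y i)"
  shows "norm x \<le> norm y"
proof (rule power2_le_imp_le)
  show "(norm x)\<^sup>2 \<le> (norm y)\<^sup>2"
    unfolding norm_ell2_sq
    by (intro infsum_mono sq_summable_Rep_ell2 power_mono assms) auto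
qed auto

lemma norm_ket [simp]: "norm (ket i) = 1"
proof -
  have "(norm (ket i))\<^sup>2 = (\<Sum>\<^sub>\<infinity>j\<in>{i}. 1)"
    unfolding norm_ell2_sq by (rule infsum_cong_neutral) auto
  then show ?thesis
    using power2_eq_imp_eq[of "norm (ket i)" 1] by simp
qed

lemma sum_Rep_ell2_sq_le: "finite F \<Longrightarrow> (\<Sum>i\<in>F. (cmod (Rep_ell2 x i))\<^sup>2) \<le> (norm x)\<^sup>2"
  unfolding norm_ell2_sq by (intro finite_sum_le_infsum sq_summable_Rep_ell2) auto

lemma cmod_Rep_ell2_le_norm: "cmod (Rep_ell2 x i) \<le> norm x"
  using sum_Rep_ell2_sq_le[of "{i}" x] by (auto intro: power2_le_imp_le)

lemma Rep_ell2_sum [simp]: "Rep_ell2 (\<Sum>a\<in>A. f a) i = (\<Sum>a\<in>A. Rep_ell2 (f a) i)"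
  by (induction A rule: infinite_finite_induct) auto

text \<open>The limit \<open>l\<close> is taken coordinatewise. The bounds on finite partial sums
  (\<open>fin\<close>) survive this limit and then give both square summability of the difference
  and convergence in norm.\<close>

instance ell2 :: (type) banach
proof
  fix X :: "nat \<Rightarrow> 'a ell2"
  assume X: "Cauchy X"
  have "Cauchy (\<lambda>n. Rep_ell2 (X n) i)" for i
  proof (rule metric_CauchyI)
    fix e :: real assume "0 < e"
    then obtain M where M: "\<And>m n. m \<ge> M \<Longrightarrow> n \<ge> M \<Longrightarrow> norm (X m - X n) < e"
      using metric_CauchyD[OF X] unfolding dist_norm by blast
    have "dist (Rep_ell2 (X m) i) (Rep_ell2 (X n) i) < e" if "m \<ge> M" "n \<ge> M" for m n
      using cmod_Rep_ell2_le_norm[of "X m - X n" i] M[OF that] by (simp add: dist_norm)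
    then show "\<exists>M. \<forall>m\<ge>M. \<forall>n\<ge>M. dist (Rep_ell2 (X m) i) (Rep_ell2 (X n) i) < e"
      by blast
  qed
  then have "\<exists>l. \<forall>i. (\<lambda>n. Rep_ell2 (X n) i) \<longlonglongrightarrow> l i"
    unfolding Cauchy_convergent_iff convergent_def by (rule choice[OF allI])
  then obtain l where l: "(\<lambda>n. Rep_ell2 (X n) i) \<longlonglongrightarrow> l i" for i by blast
  have fin: "(\<Sum>i\<in>F. (cmod (Rep_ell2 (X m) i - l i))\<^sup>2) \<le> e\<^sup>2"
    if "finite F" "\<forall>n\<ge>M. norm (X m - X n) < e" for F M m e
  proof (rule tendsto_upperbound)
    show "(\<lambda>n. \<Sum>i\<in>F. (cmod (Rep_ell2 (X m) i - Rep_ell2 (X n) i))\<^sup>2)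
        \<longlonglongrightarrow> (\<Sum>i\<in>F. (cmod (Rep_ell2 (X m) i - l i))\<^sup>2)"
      by (intro tendsto_intros l)
    show "\<forall>\<^sub>F n in sequentially. (\<Sum>i\<in>F. (cmod (Rep_ell2 (X m) i - Rep_ell2 (X n) i))\<^sup>2) \<le> e\<^sup>2"
      using eventually_ge_at_top[of M]
    proof eventually_elim
      case (elim n)
      have "(\<Sum>i\<in>F. (cmod (Rep_ell2 (X m - X n) i))\<^sup>2) \<le> (norm (X m - X n))\<^sup>2"
        by (rule sum_Rep_ell2_sq_le) fact
      also have "\<dots> \<le> e\<^sup>2"
        using that(2) elim by (intro power_mono) (auto intro: less_imp_le)
      finally show ?case by simp
    qed
  qed simp
  have summ: "(\<lambda>i. (cmod (Rep_ell2 (X m) i - l i))\<^sup>2) summable_on UNIV"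
    if "\<forall>n\<ge>M. norm (X m - X n) < e" for M m e
    by (rule nonneg_bdd_above_summable_on) (auto intro!: bdd_aboveI2 fin[OF _ that])
  obtain M1 where M1: "\<forall>m\<ge>M1. \<forall>n\<ge>M1. norm (X m - X n) < 1"
    using metric_CauchyD[OF X, of 1] by (auto simp: dist_norm)
  \<comment> \<open>The family \<open>l\<close> is written as \<open>X M1\<close> minus a
    square-summable difference, so that closure under sums and multiples applies.\<close>
  have "(\<lambda>i. (cmod (Rep_ell2 (X M1) i + - 1 * (Rep_ell2 (X M1) i - l i)))\<^sup>2) summable_on UNIV"
    by (intro sq_summable_add sq_summable_scale sq_summable_Rep_ell2 summ[of M1 _ 1])
       (use M1 in auto)
  then have "\<exists>L. Rep_ell2 L = l"
    by (intro exI[of _ "Abs_ell2 l"] Abs_ell2_inverse) simp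
  then obtain L where L: "Rep_ell2 L = l" by blast
  have "X \<longlonglongrightarrow> L"
  proof (rule metric_LIMSEQ_I)
    fix e :: real assume "0 < e"
    then obtain M where M: "\<forall>m\<ge>M. \<forall>n\<ge>M. norm (X m - X n) < e / 2"
      using metric_CauchyD[OF X, of "e / 2"] by (auto simp: dist_norm)
    have "norm (X m - L) \<le> e / 2" if "m \<ge> M" for m
    proof (rule power2_le_imp_le)
      show "(norm (X m - L))\<^sup>2 \<le> (e / 2)\<^sup>2"
        unfolding norm_ell2_sq
      proof (rule infsum_le_finite_sums[OF sq_summable_Rep_ell2])
        fix F :: "'a set" assume "finite F"
        then show "(\<Sum>i\<in>F. (cmod (Rep_ell2 (X m - L) i))\<^sup>2) \<le> (e / 2)\<^sup>2"
          using fin[of F M m "e / 2"] M that by (simp add: L)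
      qed
    qed (use \<open>0 < e\<close> in auto)
    moreover have "e / 2 < e" using \<open>0 < e\<close> by simp
    ultimately show "\<exists>M. \<forall>m\<ge>M. dist (X m) L < e"
      unfolding dist_norm by (meson le_less_trans)
  qed
  then show "convergent X" by (rule convergentI)
qed

text \<open>The squared norm of the error is the tail of the convergent sum of squared
  coefficients.\<close>

lemma ket_expansion:
  "((\<lambda>F. \<Sum>i\<in>F. Rep_ell2 x i *\<^sub>C ket i) \<longlongrightarrow> x) (finite_subsets_at_top UNIV)"
proof -
  have tail: "(norm (x - (\<Sum>i\<in>F. Rep_ell2 x i *\<^sub>C ket i)))\<^sup>2
      = (norm x)\<^sup>2 - (\<Sum>i\<in>F. (cmod (Rep_ell2 x i))\<^sup>2)" if "finite F" for F
  proof -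
    have "(norm (x - (\<Sum>i\<in>F. Rep_ell2 x i *\<^sub>C ket i)))\<^sup>2
        = (\<Sum>\<^sub>\<infinity>i\<in>UNIV - F. (cmod (Rep_ell2 x i))\<^sup>2)"
      unfolding norm_ell2_sq using that
      by (intro infsum_cong_neutral) (auto simp: if_distrib cong: if_cong)
    also have "\<dots> = (norm x)\<^sup>2 - (\<Sum>i\<in>F. (cmod (Rep_ell2 x i))\<^sup>2)"
      unfolding norm_ell2_sq using that
      by (subst infsum_Diff) (auto intro: sq_summable_Rep_ell2)
    finally show ?thesis .
  qed
  have "((\<lambda>i. (cmod (Rep_ell2 x i))\<^sup>2) has_sum (norm x)\<^sup>2) UNIV"
    unfolding norm_ell2_sq by (intro has_sum_infsum sq_summable_Rep_ell2)
  then have "((\<lambda>F. sqrt ((norm x)\<^sup>2 - (\<Sum>i\<in>F. (cmod (Rep_ell2 x i))\<^sup>2)))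
      \<longlongrightarrow> sqrt ((norm x)\<^sup>2 - (norm x)\<^sup>2)) (finite_subsets_at_top UNIV)"
    unfolding has_sum_def by (intro tendsto_intros)
  moreover have "\<forall>\<^sub>F F in finite_subsets_at_top UNIV.
      sqrt ((norm x)\<^sup>2 - (\<Sum>i\<in>F. (cmod (Rep_ell2 x i))\<^sup>2))
      = norm (x - (\<Sum>i\<in>F. Rep_ell2 x i *\<^sub>C ket i))"
    by (rule eventually_finite_subsets_at_top_weakI) (simp add: tail[symmetric])
  ultimately have "((\<lambda>F. norm (x - (\<Sum>i\<in>F. Rep_ell2 x i *\<^sub>C ket i))) \<longlongrightarrow> 0)
      (finite_subsets_at_top UNIV)"
    by (simp add: tendsto_cong)
  then show ?thesis
    by (subst tendsto_dist_iff) (simp add: dist_norm norm_minus_commute)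
qed

section \<open>Bounded operators\<close>

lemma bounded_opD:
  assumes "bounded_op T"
  shows "bounded_linear T" "T (c *\<^sub>C x) = c *\<^sub>C T x" "T (x + y) = T x + T y" "T (x - y) = T x - T y"
    "T 0 = 0"
  using assms linear_add[of T] linear_diff[of T] linear_0[of T] bounded_linear.linear[of T]
  by (auto simp: bounded_op_def)

lemma bounded_op_norm_le: "bounded_op T \<Longrightarrow> norm (T x) \<le> onorm T * norm x"
  by (rule onorm) (rule bounded_opD)

lemma bounded_opI:
  assumes "\<And>x y. T (x + y) = T x + T y" "\<And>c x. T (c *\<^sub>C x) = c *\<^sub>C T x"
    "\<And>x. norm (T x) \<le> K * norm x"
  shows "bounded_op T"
  unfolding bounded_op_def
  using assms by (auto intro!: bounded_linear_intro[of _ K] simp: scaleR_ell2_def mult.commute)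

lemma tendsto_scaleC: "(f \<longlongrightarrow> l) F \<Longrightarrow> ((\<lambda>x. c *\<^sub>C f x) \<longlongrightarrow> c *\<^sub>C l) F" for f :: "'b \<Rightarrow> 'i ell2"
  by (rule bounded_linear.tendsto[OF bounded_opD(1)])
     (auto intro!: bounded_opI[where K = "cmod c"] simp: scaleC_add_right mult.commute)

lemma bounded_op_id [simp]: "bounded_op id"
  by (rule bounded_opI[where K = 1]) auto

lemma bounded_op_comp: "bounded_op S \<Longrightarrow> bounded_op T \<Longrightarrow> bounded_op (S \<circ> T)"
  unfolding bounded_op_def by (auto simp: o_def intro: bounded_linear_compose)

lemma bounded_op_sum:
  assumes "\<And>a. a \<in> A \<Longrightarrow> bounded_op (T a)"
  shows "bounded_op (\<lambda>u. \<Sum>a\<in>A. c a *\<^sub>C T a u)"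
proof (rule bounded_opI)
  show "(\<Sum>a\<in>A. c a *\<^sub>C T a (x + y)) = (\<Sum>a\<in>A. c a *\<^sub>C T a x) + (\<Sum>a\<in>A. c a *\<^sub>C T a y)" for x y
    using assms by (simp add: bounded_opD scaleC_add_right sum.distrib)
  show "(\<Sum>a\<in>A. c a *\<^sub>C T a (d *\<^sub>C x)) = d *\<^sub>C (\<Sum>a\<in>A. c a *\<^sub>C T a x)" for d x
    using assms
    by (intro ell2_eqI) (simp add: bounded_opD sum_distrib_left mult_ac)
  show "norm (\<Sum>a\<in>A. c a *\<^sub>C T a x) \<le> (\<Sum>a\<in>A. cmod (c a) * onorm (T a)) * norm x" for x
    unfolding sum_distrib_right
    by (rule sum_norm_le) (simp add: assms bounded_op_norm_le mult.assoc mult_left_mono)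
qed

lemma bounded_op_eqI:
  assumes S: "bounded_op S" and T: "bounded_op T" and eq: "\<And>i. S (ket i) = T (ket i)"
  shows "S = T"
proof
  fix x
  have fin: "S (\<Sum>i\<in>F. Rep_ell2 x i *\<^sub>C ket i) = T (\<Sum>i\<in>F. Rep_ell2 x i *\<^sub>C ket i)" for F
    by (induction F rule: infinite_finite_induct) (auto simp: bounded_opD[OF S] bounded_opD[OF T] eq)
  have "((\<lambda>F. S (\<Sum>i\<in>F. Rep_ell2 x i *\<^sub>C ket i)) \<longlongrightarrow> S x) (finite_subsets_at_top UNIV)"
    "((\<lambda>F. T (\<Sum>i\<in>F. Rep_ell2 x i *\<^sub>C ket i)) \<longlongrightarrow> T x) (finite_subsets_at_top UNIV)"
    by (rule bounded_linear.tendsto[OF bounded_opD(1)[OF S] ket_expansion]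
        bounded_linear.tendsto[OF bounded_opD(1)[OF T] ket_expansion])+
  then show "S x = T x"
    unfolding fin by (rule tendsto_unique[rotated]) (rule finite_subsets_at_top_neq_bot)
qed

text \<open>The elementary tensors include every \<open>ket (i, j)\<close>, and a bounded operator
  is determined there; so the description in \<open>tensor_op\<close> has at most one
  solution.\<close>

lemma tensor_op_eqI:
  assumes R: "bounded_op R" "\<And>x y. R (x \<otimes>\<^sub>v y) = T x \<otimes>\<^sub>v S y"
  shows "T \<otimes>\<^sub>o S = R"
  unfolding tensor_op_def
proof (rule the_equality)
  fix R' assume "bounded_op R' \<and> (\<forall>x y. R' (x \<otimes>\<^sub>v y) = T x \<otimes>\<^sub>v S y)"
  then show "R' = R"
    using R by (intro bounded_op_eqI) (auto simp flip: tensor_vec_ket)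
qed (use R in auto)

text \<open>\<open>S\<close> is the adjoint of \<open>T\<close>. The relational form avoids
  constructing adjoints by Riesz representation: those that occur are all given explicitly.\<close>

definition adjoint_pair :: "('i ell2 \<Rightarrow> 'i ell2) \<Rightarrow> ('i ell2 \<Rightarrow> 'i ell2) \<Rightarrow> bool"
  where "adjoint_pair S T \<longleftrightarrow> (\<forall>u v. cinner_ell2 (S u) v = cinner_ell2 u (T v))"

lemma adjoint_pair_sym: "adjoint_pair S T \<Longrightarrow> adjoint_pair T S"
  unfolding adjoint_pair_def using cinner_commute by metis

lemma adjoint_pair_comp:
  "adjoint_pair S T \<Longrightarrow> adjoint_pair S' T' \<Longrightarrow> adjoint_pair (S' \<circ> S) (T \<circ> T')"
  by (auto simp: adjoint_pair_def)

lemma adjoint_pairI_inner: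
  assumes "bounded_op S" "\<And>u v. inner (S u) v = inner u (T v)"
  shows "adjoint_pair S T"
  unfolding adjoint_pair_def
proof (intro allI)
  fix u v
  \<comment> \<open>Multiplying the first argument by \<i> turns the real inner product into the
    imaginary part, so the real identity at \<open>u\<close> and at \<i> times \<open>u\<close>
    amounts to the complex one.\<close>
  have Im: "Im (cinner_ell2 x y) = inner (\<i> *\<^sub>C x) y" for x y :: "'a ell2"
    by (simp add: inner_ell2_def cinner_scale_left)
  show "cinner_ell2 (S u) v = cinner_ell2 u (T v)"
    using assms(2)[of u v] assms(2)[of "\<i> *\<^sub>C u" v]
    by (simp add: complex_eq_iff Im bounded_opD(2)[OF assms(1)]) (simp add: inner_ell2_def)
qed

lemma adjoint_pair_unique: 
  assumes "adjoint_pair S T" "adjoint_pair S' T"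
  shows "S = S'"
proof
  fix u
  have "cinner_ell2 (S u - S' u) v = 0" for v
    using assms cinner_add_left[of "S u - S' u" "S' u" v] by (simp add: adjoint_pair_def)
  from this[of "S u - S' u"] show "S u = S' u"
    by (simp add: cinner_self del: of_real_power)
qed

lemma norm_sq_le_adjoint:
  assumes "bounded_op T" "bounded_op S" "adjoint_pair S T"
  shows "(norm (T u))\<^sup>2 \<le> norm u * norm (S (T u))"
proof -
  have "(norm (T u))\<^sup>2 = Re (cinner_ell2 (T u) (T u))"
    by (simp add: cinner_self del: of_real_power)
  also have "\<dots> = inner u (S (T u))"
    using adjoint_pair_sym[OF assms(3)] by (simp add: adjoint_pair_def inner_ell2_def)
  also have "\<dots> \<le> norm u * norm (S (T u))"
    by (rule norm_cauchy_schwarz)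
  finally show ?thesis .
qed

lemma onorm_adjoint_le:
  assumes T: "bounded_op T" and S: "bounded_op S" and adj: "adjoint_pair S T"
  shows "(onorm T)\<^sup>2 \<le> onorm (S \<circ> T)"
proof -
  have 0: "0 \<le> onorm (S \<circ> T)"
    by (intro onorm_pos_le bounded_opD bounded_op_comp S T)
  have "onorm T \<le> sqrt (onorm (S \<circ> T))"
  proof (rule onorm_bound)
    fix u
    have "(norm (T u))\<^sup>2 \<le> norm u * norm ((S \<circ> T) u)"
      using norm_sq_le_adjoint[OF assms] by simp
    also have "\<dots> \<le> norm u * (onorm (S \<circ> T) * norm u)"
      by (intro mult_left_mono bounded_op_norm_le bounded_op_comp S T) auto
    also have "\<dots> = (sqrt (onorm (S \<circ> T)) * norm u)\<^sup>2"
      using 0 by (simp add: power_mult_distrib power2_eq_square[of "norm u"])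
    finally show "norm (T u) \<le> sqrt (onorm (S \<circ> T)) * norm u"
      using 0 by (auto intro: power2_le_imp_le)
  qed (use 0 in auto)
  from power_mono[OF this onorm_pos_le[OF bounded_opD(1)[OF T]], of 2] 0 show ?thesis
    by simp
qed

lemma onorm_cstar:
  assumes T: "bounded_op T" and S: "bounded_op S" and adj: "adjoint_pair S T"
  shows "onorm (S \<circ> T) = (onorm T)\<^sup>2"
proof -
  have sub: "onorm (S \<circ> T) \<le> onorm S * onorm T" "onorm (T \<circ> S) \<le> onorm T * onorm S"
    by (intro onorm_compose bounded_opD T S)+
  have nn: "0 \<le> onorm S" "0 \<le> onorm T"
    by (intro onorm_pos_le bounded_opD T S)+
  have 1: "(onorm T)\<^sup>2 \<le> onorm (S \<circ> T)" and 2: "(onorm S)\<^sup>2 \<le> onorm (T \<circ> S)"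
    by (intro onorm_adjoint_le T S adj adjoint_pair_sym)+
  \<comment> \<open>Cancelling \<open>onorm S\<close> bounds it by \<open>onorm T\<close>;
    submultiplicativity then closes the chain of inequalities.\<close>
  from 2 sub have "onorm S * onorm S \<le> onorm T * onorm S"
    by (simp add: power2_eq_square)
  then have "onorm S \<le> onorm T"
    using nn mult_right_le_imp_le[of "onorm S" "onorm S" "onorm T"] by (cases "onorm S = 0") auto
  then have "onorm S * onorm T \<le> (onorm T)\<^sup>2"
    using nn by (simp add: power2_eq_square mult_right_mono)
  with 1 sub show ?thesis by linarith
qed

section \<open>Weighted shifts\<close>

definition weighted_op :: "('i \<Rightarrow> complex) \<Rightarrow> ('i \<Rightarrow> 'i) \<Rightarrow> 'i ell2 \<Rightarrow> 'i ell2"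
  where "weighted_op \<phi> g x = Abs_ell2 (\<lambda>i. \<phi> i * Rep_ell2 x (g i))"

text \<open>Injectivity is asked only on the support of the weight: the source map of
  \<open>a\<close> sends both 0 and 1 to 0 by truncated subtraction.\<close>

definition weighted_shift :: "('i \<Rightarrow> complex) \<Rightarrow> ('i \<Rightarrow> 'i) \<Rightarrow> bool"
  where "weighted_shift \<phi> g \<longleftrightarrow> inj_on g {i. \<phi> i \<noteq> 0} \<and> (\<forall>i. cmod (\<phi> i) \<le> 1)"

lemma weighted_shift_summable:
  assumes "weighted_shift \<phi> g"
  shows "(\<lambda>i. (cmod (Rep_ell2 x (g i)))\<^sup>2) summable_on {i. \<phi> i \<noteq> 0}"
  using summable_on_reindex[of g "{i. \<phi> i \<noteq> 0}" "\<lambda>i. (cmod (Rep_ell2 x i))\<^sup>2"] assms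
  by (simp add: weighted_shift_def o_def sq_summable_Rep_ell2)

lemma weighted_op_summable:
  assumes "weighted_shift \<phi> g"
  shows "(\<lambda>i. (cmod (\<phi> i * Rep_ell2 x (g i)))\<^sup>2) summable_on {i. \<phi> i \<noteq> 0}"
proof (rule summable_on_comparison_test[OF weighted_shift_summable[OF assms, of x]])
  show "(cmod (\<phi> i * Rep_ell2 x (g i)))\<^sup>2 \<le> (cmod (Rep_ell2 x (g i)))\<^sup>2" for i
    using assms by (intro power_mono) (auto simp: weighted_shift_def norm_mult mult_left_le_one_le)
qed auto

lemma Rep_weighted_op:
  assumes "weighted_shift \<phi> g"
  shows "Rep_ell2 (weighted_op \<phi> g x) i = \<phi> i * Rep_ell2 x (g i)"
proof -
  have "(\<lambda>i. (cmod (\<phi> i * Rep_ell2 x (g i)))\<^sup>2) summable_on UNIV"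
    by (subst summable_on_cong_neutral[OF _ _ refl, where T = "{i. \<phi> i \<noteq> 0}"])
       (auto intro: weighted_op_summable[OF assms])
  then show ?thesis
    unfolding weighted_op_def by (subst Abs_ell2_inverse) auto
qed

lemma Rep_diag_op:
  assumes "\<And>i. cmod (f i) \<le> 1"
  shows "Rep_ell2 (diag_op f x) i = f i * Rep_ell2 x i"
  using Rep_weighted_op[of f id x i] assms
  by (simp add: weighted_op_def diag_op_def weighted_shift_def)

text \<open>Injectivity on the support turns the reindexed sum into a subsum of the squared norm of
  \<open>x\<close>, and weights of modulus at most one only shrink it. Weighted shifts are therefore
  contractions.\<close>

lemma bounded_op_weighted_op:
  assumes "weighted_shift \<phi> g"
  shows "bounded_op (weighted_op \<phi> g)"
proof (rule bounded_opI[where K = 1])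
  show "norm (weighted_op \<phi> g x) \<le> 1 * norm x" for x
  proof (rule power2_le_imp_le)
    let ?A = "{i. \<phi> i \<noteq> 0}"
    have "(norm (weighted_op \<phi> g x))\<^sup>2 = (\<Sum>\<^sub>\<infinity>i\<in>?A. (cmod (\<phi> i * Rep_ell2 x (g i)))\<^sup>2)"
      unfolding norm_ell2_sq Rep_weighted_op[OF assms] by (rule infsum_cong_neutral) auto
    also have "\<dots> \<le> (\<Sum>\<^sub>\<infinity>i\<in>?A. (cmod (Rep_ell2 x (g i)))\<^sup>2)"
      using assms
      by (intro infsum_mono weighted_op_summable weighted_shift_summable power_mono)
         (auto simp: weighted_shift_def norm_mult mult_left_le_one_le)
    also have "\<dots> = (\<Sum>\<^sub>\<infinity>i\<in>g ` ?A. (cmod (Rep_ell2 x i))\<^sup>2)"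
      using assms by (subst infsum_reindex) (auto simp: weighted_shift_def o_def)
    also have "\<dots> \<le> (norm x)\<^sup>2"
      unfolding norm_ell2_sq by (rule infsum_mono_neutral) (auto intro: sq_summable_Rep_ell2)
    finally show "(norm (weighted_op \<phi> g x))\<^sup>2 \<le> (1 * norm x)\<^sup>2" by simp
  qed auto
qed (auto intro!: ell2_eqI simp: Rep_weighted_op[OF assms] algebra_simps)

text \<open>The adjoint reverses the arrows and conjugates the weights: the two supports are in
  bijection, so the sums agree after reindexing.\<close>

lemma adjoint_pair_weighted_op:
  assumes "weighted_shift \<phi> g" "weighted_shift \<psi> g'"
    and "\<And>i. \<phi> i \<noteq> 0 \<Longrightarrow> g' (g i) = i \<and> \<psi> (g i) = cnj (\<phi> i)"
    and "\<And>i. \<psi> i \<noteq> 0 \<Longrightarrow> g (g' i) = i \<and> \<phi> (g' i) = cnj (\<psi> i)"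
  shows "adjoint_pair (weighted_op \<psi> g') (weighted_op \<phi> g)"
  unfolding adjoint_pair_def
proof (intro allI)
  fix u v
  let ?f = "\<lambda>j. cnj (\<psi> j * Rep_ell2 u (g' j)) * Rep_ell2 v j"
  have bij: "bij_betw g {i. \<phi> i \<noteq> 0} {j. \<psi> j \<noteq> 0}"
    by (rule bij_betw_byWitness[where f' = g']) (use assms(3,4) in auto)
  have "cinner_ell2 (weighted_op \<psi> g' u) v = (\<Sum>\<^sub>\<infinity>j\<in>{j. \<psi> j \<noteq> 0}. ?f j)"
    unfolding cinner_ell2.rep_eq Rep_weighted_op[OF assms(2)] by (rule infsum_cong_neutral) auto
  also have "\<dots> = (\<Sum>\<^sub>\<infinity>i\<in>{i. \<phi> i \<noteq> 0}. ?f (g i))"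
    by (rule infsum_reindex_bij_betw[OF bij, symmetric])
  also have "\<dots> = cinner_ell2 u (weighted_op \<phi> g v)"
    unfolding cinner_ell2.rep_eq Rep_weighted_op[OF assms(1)]
    by (rule infsum_cong_neutral) (use assms(3) in \<open>auto simp: mult_ac\<close>)
  finally show "cinner_ell2 (weighted_op \<psi> g' u) v = cinner_ell2 u (weighted_op \<phi> g v)" .
qed

section \<open>The representation of the free *-algebra\<close>

text \<open>A letter acts as the weighted shift \<open>T x i = coef i * x (source i)\<close>.  The truncated
  subtraction in the source of \<open>a\<close> at \<open>n = 0\<close> is harmless because the coefficient vanishes there.\<close>

fun coef :: "complex \<Rightarrow> uq2_gen \<times> bool \<Rightarrow> nat \<times> int \<times> int \<Rightarrow> complex" where
  "coef q (GenA, False) (n, k, l) = of_real (sqrt (1 - cmod q ^ (2 * n)))"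
| "coef q (GenA, True) (n, k, l) = of_real (sqrt (1 - cmod q ^ (2 * Suc n)))"
| "coef q (GenB, False) (n, k, l) = q ^ n"
| "coef q (GenB, True) (n, k, l) = cnj q ^ n"
| "coef q (GenD, False) (n, k, l) = cis (- 2 * Arg q * of_int k)"
| "coef q (GenD, True) (n, k, l) = cis (2 * Arg q * of_int k)"

fun source :: "uq2_gen \<times> bool \<Rightarrow> nat \<times> int \<times> int \<Rightarrow> nat \<times> int \<times> int" where
  "source (GenA, False) (n, k, l) = (n - 1, k, l)"
| "source (GenA, True) (n, k, l) = (Suc n, k, l)"
| "source (GenB, False) (n, k, l) = (n, k - 1, l)"
| "source (GenB, True) (n, k, l) = (n, k + 1, l)"
| "source (GenD, False) (n, k, l) = (n, k, l - 1)"
| "source (GenD, True) (n, k, l) = (n, k, l + 1)"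

definition letter_op :: "complex \<Rightarrow> uq2_gen \<times> bool \<Rightarrow> (nat \<times> int \<times> int) ell2 \<Rightarrow> (nat \<times> int \<times> int) ell2"
  where "letter_op q s = weighted_op (coef q s) (source s)"

primrec word_op :: "complex \<Rightarrow> (uq2_gen \<times> bool) list \<Rightarrow> (nat \<times> int \<times> int) ell2 \<Rightarrow> (nat \<times> int \<times> int) ell2" where
  "word_op q [] = id"
| "word_op q (s # l) = letter_op q s \<circ> word_op q l"

definition rho :: "complex \<Rightarrow> uq2_gen star_poly \<Rightarrow> (nat \<times> int \<times> int) ell2 \<Rightarrow> (nat \<times> int \<times> int) ell2"
  where "rho q x = (\<lambda>u. \<Sum>w\<in>Poly_Mapping.keys x. Poly_Mapping.lookup x w *\<^sub>C word_op q (letters w) u)"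

lemma letter_cases:
  fixes s :: "uq2_gen \<times> bool"
  obtains "s = (GenA, False)" | "s = (GenA, True)" | "s = (GenB, False)" | "s = (GenB, True)"
    | "s = (GenD, False)" | "s = (GenD, True)"
  by (cases s; cases "fst s"; cases "snd s") auto

locale uq2 =
  fixes q :: complex
  assumes q_pos: "0 < cmod q" and q_less_1: "cmod q < 1"
begin

lemma cmod_q_power_le: "cmod q ^ n \<le> 1"
  using q_pos q_less_1 by (simp add: power_le_one)

lemma weighted_shift_letter: "weighted_shift (coef q s) (source s)"
proof -
  have le: "\<bar>1 - cmod q ^ n\<bar> \<le> 1" "\<bar>1 - cmod q * cmod q ^ n\<bar> \<le> 1" for n
    using cmod_q_power_le[of n] cmod_q_power_le[of "Suc n"] by (auto simp: abs_le_iff)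
  have A: "m = n" if "coef q (GenA, False) (m, k, l) \<noteq> 0" "coef q (GenA, False) (n, k, l) \<noteq> 0" "m - 1 = n - 1"
    for m n k l
    using that by (cases m; cases n) auto
  have "cmod (coef q s i) \<le> 1" for i
    by (cases s rule: letter_cases; cases i)
       (auto simp: norm_power cmod_q_power_le le power_mult[symmetric] simp del: power_Suc)
  moreover have "inj_on (source s) {i. coef q s i \<noteq> 0}"
    by (cases s rule: letter_cases) (auto simp: inj_on_def simp del: coef.simps(1) intro: A)
  ultimately show ?thesis by (simp add: weighted_shift_def)
qed

lemma Rep_letter_op [simp]:
  "Rep_ell2 (letter_op q s u) i = coef q s i * Rep_ell2 u (source s i)"
  unfolding letter_op_def by (rule Rep_weighted_op) (rule weighted_shift_letter)

lemma bounded_op_letter_op [simp]: "bounded_op (letter_op q s)"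
  unfolding letter_op_def by (rule bounded_op_weighted_op) (rule weighted_shift_letter)

lemma adjoint_pair_letter_op: "adjoint_pair (letter_op q (g, \<not> s)) (letter_op q (g, s))"
proof -
  have *: "source (g, \<not> s) (source (g, s) i) = i \<and> coef q (g, \<not> s) (source (g, s) i) = cnj (coef q (g, s) i)"
    if "coef q (g, s) i \<noteq> 0" for g s and i
    using that by (cases g; cases s; cases i; cases "fst i") (auto simp: cis_cnj)
  show ?thesis
    unfolding letter_op_def
    by (intro adjoint_pair_weighted_op weighted_shift_letter) (use * *[of g "\<not> s"] in simp_all)
qed

lemma bounded_op_word_op [simp]: "bounded_op (word_op q l)"
  by (induction l) (simp_all only: word_op.simps bounded_op_id bounded_op_comp bounded_op_letter_op)

lemma word_op_append: "word_op q (l @ m) = word_op q l \<circ> word_op q m"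
  by (induction l) auto

lemma adjoint_pair_word_op: "adjoint_pair (word_op q (rev (map (\<lambda>(g, s). (g, \<not> s)) l))) (word_op q l)"
proof (induction l)
  case (Cons s l)
  then show ?case
    using adjoint_pair_comp[OF adjoint_pair_letter_op[of "fst s" "snd s"] Cons]
    by (simp only: word_op_append case_prod_unfold list.map rev.simps word_op.simps comp_id prod.collapse)
qed (simp add: adjoint_pair_def)

lemma bounded_op_rho [simp]: "bounded_op (rho q x)"
  unfolding rho_def by (rule bounded_op_sum) simp

lemma rho_superset:
  assumes "finite A" "Poly_Mapping.keys x \<subseteq> A"
  shows "rho q x u = (\<Sum>w\<in>A. Poly_Mapping.lookup x w *\<^sub>C word_op q (letters w) u)"
  unfolding rho_def by (rule sum.mono_neutral_left) (use assms in \<open>auto simp: in_keys_iff\<close>)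

lemma rho_add: "rho q (x + y) u = rho q x u + rho q y u"
proof -
  let ?A = "Poly_Mapping.keys x \<union> Poly_Mapping.keys y"
  have "rho q z u = (\<Sum>w\<in>?A. Poly_Mapping.lookup z w *\<^sub>C word_op q (letters w) u)"
    if "z \<in> {x, y, x + y}" for z
    using that Poly_Mapping.keys_add[of x y] by (intro rho_superset) auto
  then show ?thesis
    by (simp add: lookup_add scaleC_add_left sum.distrib)
qed

lemma rho_single [simp]: "rho q (Poly_Mapping.single w c) u = c *\<^sub>C word_op q (letters w) u"
  by (subst rho_superset[where A = "{w}"]) auto

lemma rho_zero [simp]: "rho q 0 u = 0"
  by (simp add: rho_def)

lemma rho_mult: "rho q (x * y) u = rho q x (rho q y u)"
proof (induction x rule: star_poly_induct)
  case (single w c)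
  show ?case
    by (induction y rule: star_poly_induct)
       (simp_all add: rho_add distrib_left bounded_opD mult_single scaleC_add_right
        plus_star_word_def word_op_append del: rho_single, simp_all add: bounded_opD word_op_append)
qed (simp_all add: rho_add distrib_right)

lemma rho_scale: "rho q (c *\<^sub>P x) u = c *\<^sub>C rho q x u"
  by (induction x rule: star_poly_induct) (simp_all add: rho_add scale_poly_add_right scaleC_add_right)

lemma rho_diff: "rho q (x - y) u = rho q x u - rho q y u"
  using rho_add[of "x - y" y u] by simp

lemma rho_word_poly [simp]: "rho q (word_poly l) = word_op q l"
  by (simp add: word_poly_def fun_eq_iff)

lemma rho_one [simp]: "rho q 1 = id"
  using rho_word_poly[of "[]"] by simp

lemma rho_sum: "rho q (\<Sum>a\<in>A. f a) u = (\<Sum>a\<in>A. rho q (f a) u)"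
  by (induction A rule: infinite_finite_induct) (simp_all add: rho_add)

lemma adjoint_pair_rho: "adjoint_pair (rho q (star_poly x)) (rho q x)"
proof (induction x rule: star_poly_induct)
  case (single w c)
  then show ?case
    using adjoint_pair_word_op[of "letters w"]
    by (simp add: adjoint_pair_def cinner_scale_left cinner_scale_right star_of_word_def)
qed (simp_all add: adjoint_pair_def rho_add cinner_add_left cinner_add_right)

section \<open>The defining relations in the concrete representation\<close>

lemma q_sq: "complex_of_real (cmod q ^ 2) = q * cnj q"
  using complex_norm_square[of q] by simp

lemma q_polar: "q = of_real (cmod q) * cis (Arg q)"
  using q_pos rcis_cmod_Arg[of q] by (simp add: rcis_def)

lemma q_phase: "q\<^sup>2 / of_real ((cmod q)\<^sup>2) = cis (2 * Arg q)"
proof -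
  have "q\<^sup>2 = of_real ((cmod q)\<^sup>2) * cis (2 * Arg q)"
    by (subst q_polar) (simp add: power_mult_distrib Complex.DeMoivre)
  then show ?thesis using q_pos by simp
qed

lemma rho_relations:
  assumes "r \<in> uq2_relations q"
  shows "rho q r u = 0"
proof -
  define c where "c n = complex_of_real (sqrt (1 - cmod q ^ (2 * n)))" for n
  have coef_A: "coef q (GenA, False) (n, k, l) = c n" "coef q (GenA, True) (n, k, l) = c (Suc n)"
    for n k l
    by (simp_all add: c_def)
  \<comment> \<open>The squared weight is expressed through \<open>q ^ n * cnj q ^ n\<close>, the
    form in which the coefficients of \<open>b\<close> and its adjoint multiply.\<close>
  have root: "c n * (c n * z) = (1 - q ^ n * cnj q ^ n) * z" for n z
  proof -
    have "c n * c n = of_real (1 - cmod q ^ (2 * n))"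
      unfolding c_def using cmod_q_power_le[of "2 * n"] by (simp flip: of_real_mult)
    also have "\<dots> = 1 - q ^ n * cnj q ^ n"
      by (simp only: power_mult of_real_power[of _ n] of_real_diff of_real_1 q_sq power_mult_distrib)
    finally show ?thesis by (simp add: mult.assoc[symmetric])
  qed
  have c0: "c 0 = 0" by (simp add: c_def)
  have cis: "cis x * (cis y * z) = cis (x + y) * z" for x y z
    by (simp add: cis_mult mult.assoc[symmetric])
  \<comment> \<open>All relations are compared coordinatewise. Splitting the first index into zero
    and successor resolves the truncated subtraction, and \<open>c0\<close> settles the case
    zero.\<close>
  have "\<forall>r\<in>uq2_relations q. Rep_ell2 (rho q r u) i = 0" for i
    unfolding uq2_relations_def Let_def gen_eq_word_poly star_poly_word_poly q_phase
    by (cases i; cases "fst i")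
       (simp_all add: rho_diff rho_mult rho_scale rho_add root coef_A c0 cis
          del: of_real_power coef.simps(1,2),
        simp_all add: q_sq algebra_simps del: of_real_power)
  with assms have "Rep_ell2 (rho q r u) i = 0" for i by blast
  then show ?thesis by (intro ell2_eqI) simp
qed

section \<open>The operator norm as a C*-seminorm killing the relations\<close>

definition opnorm :: "uq2_gen star_poly \<Rightarrow> real"
  where "opnorm x = onorm (rho q x)"

lemma norm_rho_le: "norm (rho q x u) \<le> opnorm x * norm u"
  unfolding opnorm_def by (rule bounded_op_norm_le) simp

lemma opnorm_leI: "0 \<le> K \<Longrightarrow> (\<And>u. norm (rho q x u) \<le> K * norm u) \<Longrightarrow> opnorm x \<le> K"
  unfolding opnorm_def by (rule onorm_bound)

lemma opnorm_nonneg: "0 \<le> opnorm x"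
  unfolding opnorm_def by (rule onorm_pos_le) (simp add: bounded_opD)

lemma cstar_seminorm_opnorm: "cstar_seminorm opnorm"
proof -
  have le: "opnorm (c *\<^sub>P x) \<le> cmod c * opnorm x" for c x
    by (rule opnorm_leI)
       (use norm_rho_le[of x] in \<open>simp_all add: opnorm_nonneg rho_scale mult.assoc mult_left_mono\<close>)
  \<comment> \<open>The reverse inequality is \<open>le\<close> for the scalar \<open>1 / c\<close>
    acting on \<open>c *\<^sub>P x\<close>.\<close>
  have "cmod c * opnorm x \<le> opnorm (c *\<^sub>P x)" for c x
  proof (cases "c = 0")
    case False
    then show ?thesis
      using le[of "1 / c" "c *\<^sub>P x"] by (simp add: norm_divide field_simps)
  qed (simp add: opnorm_nonneg)
  with le have "opnorm (c *\<^sub>P x) = cmod c * opnorm x" for c x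
    by (rule antisym)
  moreover have "opnorm (x + y) \<le> opnorm x + opnorm y" for x y
  proof -
    have "rho q (x + y) = (\<lambda>u. rho q x u + rho q y u)"
      by (simp add: fun_eq_iff rho_add)
    then show ?thesis
      unfolding opnorm_def by (simp add: onorm_triangle bounded_opD)
  qed
  moreover have comp: "rho q (x * y) = rho q x \<circ> rho q y" for x y
    by (simp add: fun_eq_iff rho_mult)
  have "opnorm (x * y) \<le> opnorm x * opnorm y" for x y
    unfolding opnorm_def comp by (intro onorm_compose bounded_opD) simp_all
  moreover have "opnorm (star_poly x * x) = (opnorm x)\<^sup>2" for x
    unfolding opnorm_def comp by (rule onorm_cstar) (simp_all add: adjoint_pair_rho)
  ultimately show ?thesis
    unfolding cstar_seminorm_def by (simp add: opnorm_nonneg)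
qed

lemma opnorm_relations: "r \<in> uq2_relations q \<Longrightarrow> opnorm r = 0"
  by (intro antisym opnorm_nonneg opnorm_leI) (simp_all add: rho_relations)

text \<open>The triple tensor product nests to the right: \<open>P\<close> is the inner product of
  \<open>S\<close> and \<open>R\<close> as an explicit operator, and uniqueness is applied to both
  layers.\<close>

lemma tensor_op_letter:
  assumes "\<And>x w. letter_op q s (x \<otimes>\<^sub>v w) = T x \<otimes>\<^sub>v P w"
    and "bounded_op P" "\<And>y z. P (y \<otimes>\<^sub>v z) = S y \<otimes>\<^sub>v R z"
  shows "T \<otimes>\<^sub>o S \<otimes>\<^sub>o R = rho q (word_poly [s])"
  using assms by (simp add: tensor_op_eqI[of P] tensor_op_eqI[of "letter_op q s"])

lemma rho_GenA:
  "(diag_op (\<lambda>n. of_real (sqrt (1 - cmod q ^ (2 * n)))) \<circ> right_shift) \<otimes>\<^sub>o id \<otimes>\<^sub>o id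
    = rho q (gen GenA)"
  unfolding gen_eq_word_poly
proof (rule tensor_op_letter)
  have "cmod (complex_of_real (sqrt (1 - cmod q ^ (2 * n)))) \<le> 1" for n
    using cmod_q_power_le[of "2 * n"] by simp
  note Rep_diag_op[of "\<lambda>n. of_real (sqrt (1 - cmod q ^ (2 * n)))", OF this, simp]
  show "letter_op q (GenA, False) (x \<otimes>\<^sub>v w)
      = (diag_op (\<lambda>n. of_real (sqrt (1 - cmod q ^ (2 * n)))) \<circ> right_shift) x \<otimes>\<^sub>v id w" for x w
    by (rule ell2_eqI) (auto split: nat.splits)
qed (rule bounded_op_id, simp)

lemma rho_GenB: "diag_op (\<lambda>n. q ^ n) \<otimes>\<^sub>o bilateral_shift \<otimes>\<^sub>o id = rho q (gen GenB)"
  unfolding gen_eq_word_poly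
proof (rule tensor_op_letter)
  let ?g = "\<lambda>(k, l). (k - 1, l) :: int \<times> int"
  have ws: "weighted_shift (\<lambda>_. 1) ?g"
    by (auto simp: weighted_shift_def inj_on_def)
  note Rep_weighted_op[OF ws, simp]
  have "cmod (q ^ n) \<le> 1" for n
    using cmod_q_power_le[of n] by (simp add: norm_power)
  note Rep_diag_op[of "\<lambda>n. q ^ n", OF this, simp]
  show "letter_op q (GenB, False) (x \<otimes>\<^sub>v w) = diag_op (\<lambda>n. q ^ n) x \<otimes>\<^sub>v weighted_op (\<lambda>_. 1) ?g w"
    for x w
    by (rule ell2_eqI) auto
  show "weighted_op (\<lambda>_. 1) ?g (y \<otimes>\<^sub>v z) = bilateral_shift y \<otimes>\<^sub>v id z" for y z
    by (rule ell2_eqI) auto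
  show "bounded_op (weighted_op (\<lambda>_. 1) ?g)"
    by (rule bounded_op_weighted_op[OF ws])
qed

lemma rho_GenD:
  assumes "\<theta> = Arg q / pi"
  shows "id \<otimes>\<^sub>o diag_op (\<lambda>k. exp (- 2 * of_real pi * \<i> * of_real \<theta> * of_int k)) \<otimes>\<^sub>o bilateral_shift
    = rho q (gen GenD)"
  unfolding gen_eq_word_poly
proof (rule tensor_op_letter)
  \<comment> \<open>Since \<theta> is the argument divided by pi, the factors pi cancel and the
    phase becomes the coefficient of the letter for \<open>D\<close>.\<close>
  have e: "exp (- 2 * of_real pi * \<i> * of_real \<theta> * of_int k) = cis (- 2 * Arg q * of_int k)" for k
    by (simp add: cis_conv_exp assms mult_ac)
  let ?f = "\<lambda>(k, l). cis (- 2 * Arg q * of_int k)" and ?g = "\<lambda>(k, l). (k, l - 1) :: int \<times> int"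
  have ws: "weighted_shift ?f ?g"
    by (auto simp: weighted_shift_def inj_on_def)
  note Rep_weighted_op[OF ws, simplified, simp]
  note Rep_diag_op[of "\<lambda>k. cis (- 2 * Arg q * of_int k)", simplified, simp]
  show "letter_op q (GenD, False) (x \<otimes>\<^sub>v w) = id x \<otimes>\<^sub>v weighted_op ?f ?g w" for x w
    by (rule ell2_eqI) auto
  show "weighted_op ?f ?g (y \<otimes>\<^sub>v z)
      = diag_op (\<lambda>k. exp (- 2 * of_real pi * \<i> * of_real \<theta> * of_int k)) y \<otimes>\<^sub>v bilateral_shift z" for y z
    unfolding e by (rule ell2_eqI) auto
  show "bounded_op (weighted_op ?f ?g)"
    by (rule bounded_op_weighted_op[OF ws])
qed

end

section \<open>Congruence modulo the relations\<close>

context uq2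
begin

definition rel_seminorm :: "(uq2_gen star_poly \<Rightarrow> real) \<Rightarrow> bool"
  where "rel_seminorm p \<longleftrightarrow> cstar_seminorm p \<and> (\<forall>r\<in>uq2_relations q. p r = 0)"

lemma rel_seminormD: "rel_seminorm p \<Longrightarrow> cstar_seminormed p"
  by (simp add: rel_seminorm_def cstar_seminormed_def)

lemma rel_seminorm_opnorm: "rel_seminorm opnorm"
  by (simp add: rel_seminorm_def cstar_seminorm_opnorm opnorm_relations)

text \<open>This is equality in the universal algebra, expressed before completing. As it covers
  every seminorm killing the relations, one computation serves both an abstract \<open>p\<close> and
  \<open>opnorm\<close>, hence also \<open>rho\<close>.\<close>

definition eqv :: "uq2_gen star_poly \<Rightarrow> uq2_gen star_poly \<Rightarrow> bool"  (infix \<open>\<doteq>\<close> 50)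
  where "x \<doteq> y \<longleftrightarrow> (\<forall>p. rel_seminorm p \<longrightarrow> p (x - y) = 0)"

lemma eqv_refl [simp, intro]: "x \<doteq> x"
  using cstar_seminormed.zero rel_seminormD by (auto simp: eqv_def)

lemma eqv_sym: "x \<doteq> y \<Longrightarrow> y \<doteq> x"
  unfolding eqv_def using cstar_seminormed.diff_commute rel_seminormD by metis

lemma eqv_add: "x \<doteq> x' \<Longrightarrow> y \<doteq> y' \<Longrightarrow> x + y \<doteq> x' + y'"
  unfolding eqv_def
proof (intro allI impI)
  fix p assume *: "\<forall>p. rel_seminorm p \<longrightarrow> p (x - x') = 0" "\<forall>p. rel_seminorm p \<longrightarrow> p (y - y') = 0"
    and p: "rel_seminorm p"
  interpret cstar_seminormed p by (rule rel_seminormD[OF p])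
  show "p (x + y - (x' + y')) = 0"
    using triangle[of "x - x'" "y - y'"] *[rule_format, OF p]
    by (intro antisym) (simp_all add: add_diff_add)
qed

lemma eqv_mult: "x \<doteq> x' \<Longrightarrow> y \<doteq> y' \<Longrightarrow> x * y \<doteq> x' * y'"
  unfolding eqv_def
proof (intro allI impI)
  fix p assume *: "\<forall>p. rel_seminorm p \<longrightarrow> p (x - x') = 0" "\<forall>p. rel_seminorm p \<longrightarrow> p (y - y') = 0"
    and p: "rel_seminorm p"
  interpret cstar_seminormed p by (rule rel_seminormD[OF p])
  show "p (x * y - x' * y') = 0"
    using mult_diff_le[of x y x' y'] *[rule_format, OF p]
    by (intro antisym) simp_all
qed

lemma eqv_trans [trans]: "x \<doteq> y \<Longrightarrow> y \<doteq> z \<Longrightarrow> x \<doteq> z"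
  \<comment> \<open>The second instance gives \<open>0 \<doteq> z - y\<close>; the first adds this
    to \<open>x \<doteq> y\<close>.\<close>
  using eqv_add[of x y "y - y" "z - y"] eqv_add[of y z "- y" "- y"] by simp

lemma eqv_scale: "x \<doteq> y \<Longrightarrow> c *\<^sub>P x \<doteq> c *\<^sub>P y"
  unfolding scale_poly_def by (rule eqv_mult) auto

lemma eqv_star: "x \<doteq> y \<Longrightarrow> star_poly x \<doteq> star_poly y"
  unfolding eqv_def using cstar_seminormed.star rel_seminormD by (metis star_poly_diff)

lemma eqv_power: "x \<doteq> y \<Longrightarrow> x ^ n \<doteq> y ^ n"
  by (induction n) (auto intro: eqv_mult)

lemma eqv_seminorm:
  assumes "x \<doteq> y" "rel_seminorm p"
  shows "p x = p y"
proof -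
  interpret cstar_seminormed p by (rule rel_seminormD[OF assms(2)])
  have "p (x - y) = 0" using assms by (simp add: eqv_def)
  then show ?thesis using reverse_triangle[of x y] by simp
qed

lemma eqv_rho:
  assumes "x \<doteq> y"
  shows "rho q x u = rho q y u"
proof -
  have "opnorm (x - y) = 0"
    using assms rel_seminorm_opnorm by (simp add: eqv_def)
  then show ?thesis
    using norm_rho_le[of "x - y" u] by (simp add: rho_diff)
qed

lemma eqv_relation: "x - y \<in> uq2_relations q \<Longrightarrow> x \<doteq> y"
  by (simp add: eqv_def rel_seminorm_def)

section \<open>The defining relations as congruences, and commutation up to scalars\<close>

abbreviation letter :: "uq2_gen \<Rightarrow> bool \<Rightarrow> uq2_gen star_poly"
  where "letter g s \<equiv> word_poly [(g, s)]"

abbreviation \<eta> :: "uq2_gen star_poly"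
  where "\<eta> \<equiv> letter GenB True * letter GenB False"

lemma star_letter [simp]: "star_poly (letter g s) = letter g (\<not> s)"
  by (simp add: star_poly_word_poly)

lemma relation_eqvs:
  shows ba: "letter GenB False * letter GenA False \<doteq> q *\<^sub>P (letter GenA False * letter GenB False)"
    and a'b: "letter GenA True * letter GenB False \<doteq> q *\<^sub>P (letter GenB False * letter GenA True)"
    and bb': "letter GenB False * letter GenB True \<doteq> \<eta>"
    and a'a: "letter GenA True * letter GenA False \<doteq> 1 - of_real ((cmod q)\<^sup>2) *\<^sub>P \<eta>"
    and aD: "letter GenA False * letter GenD False \<doteq> letter GenD False * letter GenA False"
    and bD: "letter GenB False * letter GenD False
      \<doteq> cis (2 * Arg q) *\<^sub>P (letter GenD False * letter GenB False)"
    and DD': "letter GenD False * letter GenD True \<doteq> 1"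
    and D'D: "letter GenD True * letter GenD False \<doteq> 1"
  by (rule eqv_relation;
      simp add: uq2_relations_def Let_def gen_eq_word_poly q_phase diff_diff_eq2 del: of_real_power)+

lemma aa': "letter GenA False * letter GenA True \<doteq> 1 - \<eta>"
proof -
  have "letter GenA False * letter GenA True + letter GenB False * letter GenB True \<doteq> 1"
    by (rule eqv_relation)
       (simp add: uq2_relations_def Let_def gen_eq_word_poly del: of_real_power)
  from eqv_add[OF this eqv_scale[OF bb', of "-1"]] show ?thesis
    by (simp add: scale_poly_minus_one)
qed

text \<open>The scalar stays existential; its being nonzero makes the notion symmetric and stable
  under adjoints.\<close>

definition qcomm :: "uq2_gen star_poly \<Rightarrow> uq2_gen star_poly \<Rightarrow> bool"
  where "qcomm x y \<longleftrightarrow> (\<exists>k. k \<noteq> 0 \<and> x * y \<doteq> k *\<^sub>P (y * x))"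

lemma qcommI: "x * y \<doteq> k *\<^sub>P (y * x) \<Longrightarrow> k \<noteq> 0 \<Longrightarrow> qcomm x y"
  by (auto simp: qcomm_def)

lemma qcomm_refl: "qcomm x x"
  by (rule qcommI[of _ _ 1]) auto

lemma qcomm_sym: "qcomm x y \<Longrightarrow> qcomm y x"
  unfolding qcomm_def
proof (elim exE conjE)
  fix k assume k: "k \<noteq> 0" "x * y \<doteq> k *\<^sub>P (y * x)"
  show "\<exists>k. k \<noteq> 0 \<and> y * x \<doteq> k *\<^sub>P (x * y)"
    using eqv_sym[OF eqv_scale[OF k(2), of "1 / k"]] k(1) by (intro exI[of _ "1 / k"]) simp
qed

lemma qcomm_star: "qcomm x y \<Longrightarrow> qcomm (star_poly x) (star_poly y)"
proof -
  assume "qcomm x y"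
  then obtain k where k: "k \<noteq> 0" "x * y \<doteq> k *\<^sub>P (y * x)" by (auto simp: qcomm_def)
  have "qcomm (star_poly y) (star_poly x)"
    by (rule qcommI[of _ _ "cnj k"]) (use eqv_star[OF k(2)] k(1) in simp_all)
  then show ?thesis by (rule qcomm_sym)
qed

lemma qcomm_mult_right:
  assumes "qcomm x y" "qcomm x z"
  shows "qcomm x (y * z)"
proof -
  obtain k l where k: "k \<noteq> 0" "x * y \<doteq> k *\<^sub>P (y * x)" and l: "l \<noteq> 0" "x * z \<doteq> l *\<^sub>P (z * x)"
    using assms by (auto simp: qcomm_def)
  have "x * (y * z) \<doteq> (k *\<^sub>P (y * x)) * z"
    unfolding mult.assoc[symmetric] by (intro eqv_mult k eqv_refl)
  also have "\<dots> = k *\<^sub>P (y * (x * z))" by (simp add: mult.assoc)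
  also have "\<dots> \<doteq> k *\<^sub>P (y * (l *\<^sub>P (z * x)))" by (intro eqv_scale eqv_mult l eqv_refl)
  also have "\<dots> = (k * l) *\<^sub>P (y * z * x)" by (simp add: mult.assoc)
  finally show ?thesis using k(1) l(1) by (intro qcommI[where k = "k * l"]) auto
qed

lemma qcomm_one: "qcomm x 1"
  by (rule qcommI[of _ _ 1]) auto

text \<open>Conjugation by a unitary: insert \<open>?D * ?D'\<close> on the right of
  \<open>?D' * x\<close>, move \<open>x\<close> past \<open>?D\<close>, and cancel
  \<open>?D' * ?D\<close>.\<close>

lemma qcomm_D_star:
  assumes "qcomm x (letter GenD False)"
  shows "qcomm x (letter GenD True)"
proof -
  let ?D = "letter GenD False" and ?D' = "letter GenD True"
  obtain k where k: "k \<noteq> 0" "x * ?D \<doteq> k *\<^sub>P (?D * x)"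
    using assms by (auto simp: qcomm_def)
  have "?D' * x = ?D' * x * 1" by simp
  also have "\<dots> \<doteq> ?D' * x * (?D * ?D')" by (intro eqv_mult eqv_refl eqv_sym[OF DD'])
  also have "\<dots> = ?D' * (x * ?D) * ?D'" by (simp add: mult.assoc)
  also have "\<dots> \<doteq> ?D' * (k *\<^sub>P (?D * x)) * ?D'" by (intro eqv_mult eqv_refl k)
  also have "\<dots> = k *\<^sub>P (?D' * ?D * (x * ?D'))" by (simp add: mult.assoc)
  also have "\<dots> \<doteq> k *\<^sub>P (1 * (x * ?D'))" by (intro eqv_scale eqv_mult eqv_refl D'D)
  finally show ?thesis using k(1) by (intro qcomm_sym[OF qcommI[where k = k]]) auto
qed

text \<open>The relations settle one choice of adjoints for each pair of generators, two for
  \<open>b\<close> with \<open>a\<close>; taking adjoints, symmetry and the unitarity of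
  \<open>D\<close> yield the others.\<close>

lemma qcomm_letters:
  assumes "g \<noteq> g'"
  shows "qcomm (letter g s) (letter g' s')"
proof -
  have q: "q \<noteq> 0" using q_pos by auto
  have star: "qcomm (letter g (\<not> s)) (letter g' (\<not> s'))" if "qcomm (letter g s) (letter g' s')" for g s g' s'
    using qcomm_star[OF that] by simp
  have BA: "qcomm (letter GenB False) (letter GenA s)" for s
    using qcommI[OF ba q] qcomm_sym[OF qcommI[OF a'b q]] by (cases s) auto
  have BA': "qcomm (letter GenB s) (letter GenA s')" for s s'
    using BA star[OF BA[of "\<not> s'"]] by (cases s) auto
  have D: "qcomm (letter g s) (letter GenD s')" if "qcomm (letter g False) (letter GenD False)" for g s s'
    using that qcomm_D_star[OF that] star[OF that] star[OF qcomm_D_star[OF that]]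
    by (cases s; cases s') simp_all
  have AD: "qcomm (letter GenA s) (letter GenD s')" for s s'
    by (rule D, rule qcommI[of _ _ 1]) (use aD in simp_all)
  have BD: "qcomm (letter GenB s) (letter GenD s')" for s s'
    by (rule D, rule qcommI[OF bD]) simp
  show ?thesis
    using assms by (cases g; cases g') (auto intro: BA' AD BD qcomm_sym[OF BA'] qcomm_sym[OF AD] qcomm_sym[OF BD])
qed

lemma qcomm_word:
  assumes "\<And>s. s \<in> set l \<Longrightarrow> qcomm x (word_poly [s])"
  shows "qcomm x (word_poly l)"
  using assms
proof (induction l)
  case (Cons s l)
  then show ?case by (subst word_poly_Cons) (intro qcomm_mult_right, auto)
qed (simp add: qcomm_one)

text \<open>Normality of \<open>b\<close> also covers the letters of \<open>b\<close> inside the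
  word, so the word is arbitrary. This is special to \<open>b\<close> and \<open>D\<close>:
  \<open>a\<close> does not commute with its adjoint up to a scalar.\<close>

lemma qcomm_B: "qcomm (letter GenB s) (word_poly l)"
proof (rule qcomm_word)
  fix t assume "t \<in> set l"
  have "qcomm (letter GenB False) (letter GenB True)"
    by (rule qcommI[of _ _ 1]) (use bb' in simp_all)
  then have "qcomm (letter GenB s) (letter GenB s')" for s'
    by (cases s; cases s') (auto intro: qcomm_refl qcomm_sym)
  then show "qcomm (letter GenB s) (word_poly [t])"
    using qcomm_letters[of GenB "fst t" s "snd t"] by (cases "fst t = GenB"; cases t) auto
qed

lemma qcomm_eta: "qcomm \<eta> (word_poly l)"
  by (intro qcomm_sym[OF qcomm_mult_right] qcomm_sym[OF qcomm_B])

section \<open>Polynomials in \<open>b\<^sup>* b\<close>\<close>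

definition ev :: "complex poly \<Rightarrow> uq2_gen star_poly"
  where "ev f = (\<Sum>i\<le>degree f. coeff f i *\<^sub>P \<eta> ^ i)"

lemma ev_superset: "degree f \<le> n \<Longrightarrow> ev f = (\<Sum>i\<le>n. coeff f i *\<^sub>P \<eta> ^ i)"
  unfolding ev_def by (rule sum.mono_neutral_left) (auto simp: coeff_eq_0)

lemma ev_0 [simp]: "ev 0 = 0"
  by (simp add: ev_def)

lemma ev_pCons [simp]: "ev (pCons c f) = c *\<^sub>P 1 + \<eta> * ev f"
proof -
  have "ev (pCons c f) = (\<Sum>i\<le>Suc (degree f). coeff (pCons c f) i *\<^sub>P \<eta> ^ i)"
    by (rule ev_superset) (rule degree_pCons_le)
  also have "\<dots> = c *\<^sub>P 1 + \<eta> * ev f"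
    unfolding sum.atMost_Suc_shift by (simp add: ev_def sum_distrib_left)
  finally show ?thesis .
qed

lemma ev_add [simp]: "ev (f + g) = ev f + ev g"
proof -
  let ?n = "max (degree f) (degree g)"
  have "ev h = (\<Sum>i\<le>?n. coeff h i *\<^sub>P \<eta> ^ i)" if "h \<in> {f, g, f + g}" for h
    using that degree_add_le_max[of f g] by (intro ev_superset) auto
  then show ?thesis by (simp add: scale_poly_add_left sum.distrib)
qed

lemma ev_smult [simp]: "ev (Polynomial.smult c f) = c *\<^sub>P ev f"
  by (induction f) (simp_all add: scale_poly_add_right)

lemma ev_mult [simp]: "ev (f * g) = ev f * ev g"
  by (induction f) (simp_all add: mult_pCons_left distrib_right mult.assoc)

lemma ev_1 [simp]: "ev 1 = 1"
  using ev_pCons[of 1 0] by (simp only: ev_0 pCons_one) simp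

lemma ev_power [simp]: "ev (f ^ n) = ev f ^ n"
  by (induction n) simp_all

text \<open>Composition with \<open>[:0, k:]\<close> substitutes k t for t: moving \<open>x\<close>
  to the left rescales each occurrence of \<eta> by \<open>k\<close>.\<close>

lemma ev_comm:
  assumes "\<eta> * x \<doteq> k *\<^sub>P (x * \<eta>)"
  shows "ev f * x \<doteq> x * ev (pcompose f [:0, k:])"
proof (induction f)
  case (pCons c f)
  have "ev (pCons c f) * x = c *\<^sub>P x + \<eta> * (ev f * x)"
    by (simp add: distrib_right mult.assoc)
  also have "\<dots> \<doteq> c *\<^sub>P x + \<eta> * (x * ev (pcompose f [:0, k:]))"
    by (intro eqv_add eqv_mult eqv_refl pCons)
  also have "\<dots> = c *\<^sub>P x + (\<eta> * x) * ev (pcompose f [:0, k:])"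
    by (simp add: mult.assoc)
  also have "\<dots> \<doteq> c *\<^sub>P x + (k *\<^sub>P (x * \<eta>)) * ev (pcompose f [:0, k:])"
    by (intro eqv_add eqv_mult eqv_refl assms)
  also have "\<dots> = x * ev (pcompose (pCons c f) [:0, k:])"
    by (simp add: pcompose_pCons distrib_left mult.assoc)
  finally show ?case .
qed simp

lemma ev_word_comm: "\<exists>f'. ev f * word_poly l \<doteq> word_poly l * ev f'"
  using qcomm_eta[of l] ev_comm unfolding qcomm_def by blast

lemma eta_a: "\<eta> * letter GenA False \<doteq> of_real ((cmod q)\<^sup>2) *\<^sub>P (letter GenA False * \<eta>)"
proof -
  let ?a = "letter GenA False" and ?b = "letter GenB False" and ?b' = "letter GenB True"
  have "\<eta> * ?a = ?b' * (?b * ?a)" by (simp add: mult.assoc)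
  also have "\<dots> \<doteq> ?b' * (q *\<^sub>P (?a * ?b))" by (intro eqv_mult eqv_refl ba)
  also have "\<dots> = q *\<^sub>P ((?b' * ?a) * ?b)" by (simp add: mult.assoc)
  also have "\<dots> \<doteq> q *\<^sub>P ((cnj q *\<^sub>P (?a * ?b')) * ?b)"
    \<comment> \<open>The adjoint of \<open>a'b\<close> moves \<open>?b'\<close> past
      \<open>?a\<close> at the cost of \<open>cnj q\<close>; together with the earlier
      \<open>q\<close> this makes the squared modulus.\<close>
    using eqv_star[OF a'b] by (intro eqv_scale eqv_mult eqv_refl) simp
  also have "\<dots> = of_real ((cmod q)\<^sup>2) *\<^sub>P (?a * \<eta>)"
    by (simp add: mult.assoc q_sq del: of_real_power)
  finally show ?thesis .
qed

text \<open>This allows a cancelling pair to be removed from a word. The polynomials that occur are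
  1 - t, 1 - r t, t and 1, where r is the squared modulus of \<open>q\<close>.\<close>

lemma letter_pair: "\<exists>f. letter g s * letter g (\<not> s) \<doteq> ev f"
proof -
  have ev: "1 - c *\<^sub>P \<eta> = ev [:1, -c:]" for c
    by (simp add: scale_poly_minus_left)
  have "letter GenA False * letter GenA True \<doteq> ev [:1, -1:]"
    "letter GenA True * letter GenA False \<doteq> ev [:1, - of_real ((cmod q)\<^sup>2):]"
    using aa' a'a unfolding ev[symmetric] by simp_all
  moreover have "\<eta> = ev [:0, 1:]" by simp
  then have "letter GenB False * letter GenB True \<doteq> ev [:0, 1:]"
    "letter GenB True * letter GenB False \<doteq> ev [:0, 1:]"
    using bb' by simp_all
  moreover have "letter GenD False * letter GenD True \<doteq> ev 1"
    "letter GenD True * letter GenD False \<doteq> ev 1"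
    using DD' D'D by simp_all
  ultimately have "\<exists>f. letter g True * letter g False \<doteq> ev f" "\<exists>f. letter g False * letter g True \<doteq> ev f"
    by (cases g; blast)+
  then show ?thesis by (cases s) (simp_all only: not_True_eq_False not_False_eq_True simp_thms)
qed

section \<open>The grading, and words of degree zero\<close>

definition deg :: "uq2_gen \<Rightarrow> (uq2_gen \<times> bool) list \<Rightarrow> int"
  where "deg g l = (\<Sum>s\<leftarrow>l. if fst s = g then if snd s then -1 else 1 else 0)"

lemma deg_simps [simp]:
  "deg g [] = 0" "deg g (s # l) = (if fst s = g then if snd s then -1 else 1 else 0) + deg g l"
  "deg g (l @ m) = deg g l + deg g m"
  by (simp_all add: deg_def)

lemma deg_star: "deg g (rev (map (\<lambda>(g, s). (g, \<not> s)) l)) = - deg g l"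
  by (induction l) (auto simp: case_prod_unfold)

text \<open>If the tail has constant sign and the new head is a \<open>g\<close>-letter of the other
  sign, the head pairs with the first \<open>g\<close>-letter of the tail, and no
  \<open>g\<close>-letter lies in between.\<close>

lemma adjacent_or_constant_sign:
  "(\<exists>u s m v. l = u @ (g, s) # m @ (g, \<not> s) # v \<and> (\<forall>t\<in>set m. fst t \<noteq> g))
    \<or> (\<exists>s. \<forall>t\<in>set l. fst t = g \<longrightarrow> snd t = s)"
proof (induction l)
  case (Cons t l)
  show ?case
    using Cons
  proof (elim disjE exE conjE)
    fix u s m v assume "l = u @ (g, s) # m @ (g, \<not> s) # v" "\<forall>t\<in>set m. fst t \<noteq> g"
    then show ?thesis by (intro disjI1 exI[of _ "t # u"] exI[of _ s] exI[of _ m] exI[of _ v]) auto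
  next
    fix s assume s: "\<forall>t\<in>set l. fst t = g \<longrightarrow> snd t = s"
    show ?thesis
    proof (cases "fst t = g \<and> snd t \<noteq> s \<and> (\<exists>t\<in>set l. fst t = g)")
      case True
      then have "\<exists>t\<in>set l. fst t = g" by blast
      from split_list_first_prop[OF this] obtain m t' v
        where l: "l = m @ t' # v" "fst t' = g" "\<forall>t\<in>set m. fst t \<noteq> g" by blast
      have "snd t' = s" using s l by simp
      then have "t' = (g, \<not> snd t)" using l(2) True by (simp add: prod_eq_iff)
      moreover have "t = (g, snd t)" using True by (simp add: prod_eq_iff)
      ultimately have "t # l = [] @ (g, snd t) # m @ (g, \<not> snd t) # v" using l by simp
      then show ?thesis using l(3) by blast
    next
      case False
      then show ?thesis using s by (intro disjI2) auto
    qed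
  qed
qed auto

lemma adjacent_pair:
  assumes "deg g l = 0" "t \<in> set l" "fst t = g"
  obtains u s m v where "l = u @ (g, s) # m @ (g, \<not> s) # v" "\<forall>t\<in>set m. fst t \<noteq> g"
proof -
  have "\<not> (\<forall>t\<in>set l. fst t = g \<longrightarrow> snd t = s)" for s
  proof
    assume *: "\<forall>t\<in>set l. fst t = g \<longrightarrow> snd t = s"
    \<comment> \<open>With a constant sign the degree is plus or minus the number of
      \<open>g\<close>-letters, hence nonzero as \<open>t\<close> occurs. The claim ranges over
      \<open>l'\<close> with letters from \<open>l\<close> so that the sign hypothesis persists in
      the induction.\<close>
    have "deg g l' = (if s then -1 else 1) * int (length (filter (\<lambda>t. fst t = g) l'))"
      if "set l' \<subseteq> set l" for l'
      using that * by (induction l') auto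
    from this[of l] assms show False
      by (auto simp: filter_empty_conv split: if_splits)
  qed
  then show ?thesis
    using adjacent_or_constant_sign[of l g] that by blast
qed

text \<open>In a word of degree zero some letter meets its adjoint once the letters in between, which all
  \<open>q\<close>-commute with it, are moved away; the product of the two is a polynomial in \<open>\<eta>\<close>.\<close>

lemma degree_zero_word:
  assumes "\<And>g. deg g l = 0"
  shows "\<exists>f. word_poly l \<doteq> ev f"
  using assms
proof (induction "length l" arbitrary: l rule: less_induct)
  case less
  show ?case
  proof (cases l)
    case Nil
    then show ?thesis by (intro exI[of _ 1]) simp
  next
    case (Cons t l')
    have "t \<in> set l" using Cons by simp
    from adjacent_pair[OF less.prems this refl] obtain u s m v
      where l: "l = u @ (fst t, s) # m @ (fst t, \<not> s) # v" and m: "\<forall>t'\<in>set m. fst t' \<noteq> fst t" .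
    let ?x = "letter (fst t) s" and ?y = "letter (fst t) (\<not> s)"
    have "qcomm ?x (word_poly m)"
    proof (rule qcomm_word)
      fix t' assume "t' \<in> set m"
      then have "fst t \<noteq> fst t'" using m by force
      from qcomm_letters[OF this, of s "snd t'"] show "qcomm ?x (word_poly [t'])"
        by (simp only: prod.collapse)
    qed
    then obtain k where k: "?x * word_poly m \<doteq> k *\<^sub>P (word_poly m * ?x)"
      by (auto simp: qcomm_def)
    obtain f where f: "?x * ?y \<doteq> ev f" using letter_pair by blast
    obtain f' where f': "ev f * word_poly v \<doteq> word_poly v * ev f'" using ev_word_comm by blast
    have "\<exists>f. word_poly (u @ m @ v) \<doteq> ev f"
    proof (rule less.hyps)
      show "deg g (u @ m @ v) = 0" for g
        using less.prems[of g] unfolding l by (cases s) (simp_all split: if_splits)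
    qed (simp add: l)
    then obtain f'' where f'': "word_poly (u @ m @ v) \<doteq> ev f''" by blast
    have "word_poly l = word_poly u * (?x * word_poly m) * (?y * word_poly v)"
      unfolding l by (simp only: word_poly_append word_poly_Cons[of _ "_ @ _"] word_poly_Cons[of _ v] mult.assoc)
    also have "\<dots> \<doteq> word_poly u * (k *\<^sub>P (word_poly m * ?x)) * (?y * word_poly v)"
      by (intro eqv_mult eqv_refl k)
    also have "\<dots> = k *\<^sub>P (word_poly u * word_poly m * ((?x * ?y) * word_poly v))"
      by (simp add: mult.assoc)
    also have "\<dots> \<doteq> k *\<^sub>P (word_poly u * word_poly m * (ev f * word_poly v))"
      by (intro eqv_scale eqv_mult eqv_refl f)
    also have "\<dots> \<doteq> k *\<^sub>P (word_poly u * word_poly m * (word_poly v * ev f'))"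
      by (intro eqv_scale eqv_mult eqv_refl f')
    also have "\<dots> = k *\<^sub>P (word_poly (u @ m @ v) * ev f')"
      by (simp add: word_poly_append mult.assoc)
    also have "\<dots> \<doteq> k *\<^sub>P (ev f'' * ev f')"
      by (intro eqv_scale eqv_mult eqv_refl f'')
    also have "\<dots> = ev (Polynomial.smult k (f'' * f'))" by simp
    finally show ?thesis by blast
  qed
qed

end

section \<open>Growth of powers\<close>

text \<open>Otherwise the powers of x / T > 1 outgrow every cubic. The cube accounts for the three
  degrees of the grading; with \<open>A = 0\<close> the lemma removes a constant factor.\<close>

lemma le_if_powers_le:
  fixes x T :: real
  assumes x: "0 \<le> x" and T: "0 \<le> T"
    and le: "\<And>k. x ^ 2 ^ k \<le> C * (A * 2 ^ k + 1) ^ 3 * T ^ 2 ^ k"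
  shows "x \<le> T"
proof (rule ccontr)
  assume "\<not> x \<le> T"
  then have "T < x" by simp
  \<comment> \<open>At \<open>k = 0\<close> the bound excludes \<open>T = 0\<close>, so that
    division by \<open>T\<close> is meaningful.\<close>
  with le[of 0] T have "0 < T" by (cases "T = 0") auto
  define y where "y = x / T"
  have y: "1 < y" using \<open>T < x\<close> \<open>0 < T\<close> by (simp add: y_def)
  have yle: "y ^ 2 ^ k \<le> C * (A * 2 ^ k + 1) ^ 3" for k
    using le[of k] \<open>0 < T\<close> by (simp add: y_def power_divide divide_le_eq)
  have "(\<lambda>n. C * (A * real n + 1) ^ 3 / y ^ n) \<longlonglongrightarrow> 0"
  proof -
    have "(\<lambda>n. real n ^ 3 / y ^ n) \<longlonglongrightarrow> 0" "(\<lambda>n. real n ^ 2 / y ^ n) \<longlonglongrightarrow> 0"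
      "(\<lambda>n. real n / y ^ n) \<longlonglongrightarrow> 0" "(\<lambda>n. 1 / y ^ n) \<longlonglongrightarrow> 0"
      using y by real_asymp+
    then have "(\<lambda>n. C * A ^ 3 * (real n ^ 3 / y ^ n) + 3 * C * A\<^sup>2 * (real n ^ 2 / y ^ n)
        + 3 * C * A * (real n / y ^ n) + C * (1 / y ^ n)) \<longlonglongrightarrow> 0"
      by (intro tendsto_add_zero tendsto_mult_right_zero)
    then show ?thesis
      by (rule Lim_transform_eventually)
         (auto intro!: always_eventually simp: power3_eq_cube power2_eq_square algebra_simps
           simp flip: add_divide_distrib)
  qed
  moreover have "filterlim (\<lambda>k. 2 ^ k :: nat) sequentially sequentially"
    by (rule filterlim_subseq) (auto simp: strict_mono_def)
  ultimately have "(\<lambda>k. C * (A * real (2 ^ k) + 1) ^ 3 / y ^ 2 ^ k) \<longlonglongrightarrow> 0"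
    by (rule filterlim_compose)
  then have "\<forall>\<^sub>F k in sequentially. C * (A * real (2 ^ k) + 1) ^ 3 / y ^ 2 ^ k < 1"
    by (rule order_tendstoD) simp
  then obtain k where "C * (A * 2 ^ k + 1) ^ 3 / y ^ 2 ^ k < 1"
    using eventually_happens'[of sequentially] by fastforce
  then show False
    using yle[of k] y by (simp add: divide_less_eq)
qed

section \<open>Polynomials in \<eta> are bounded by their values at the powers of r\<close>

context uq2
begin

abbreviation (input) R :: complex
  where "R \<equiv> of_real ((cmod q)\<^sup>2)"

lemma R_nonzero: "R \<noteq> 0"
  using q_pos by simp

lemma R_power_tendsto: "(\<lambda>n. R ^ n) \<longlonglongrightarrow> 0"
  by (rule LIMSEQ_power_zero) (use q_pos q_less_1 in \<open>simp add: norm_power power_less_one_iff\<close>)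

abbreviation \<alpha> :: "uq2_gen star_poly" where "\<alpha> \<equiv> letter GenA False"
abbreviation \<alpha>' :: "uq2_gen star_poly" where "\<alpha>' \<equiv> letter GenA True"

lemma eta_a_power: "\<eta> * \<alpha> ^ m \<doteq> R ^ m *\<^sub>P (\<alpha> ^ m * \<eta>)"
proof (induction m)
  case (Suc m)
  have "\<eta> * \<alpha> ^ Suc m = \<eta> * \<alpha> * \<alpha> ^ m" by (simp add: mult.assoc)
  also have "\<dots> \<doteq> (R *\<^sub>P (\<alpha> * \<eta>)) * \<alpha> ^ m" by (intro eqv_mult eqv_refl eta_a)
  also have "\<dots> = R *\<^sub>P (\<alpha> * (\<eta> * \<alpha> ^ m))" by (simp add: mult.assoc)
  also have "\<dots> \<doteq> R *\<^sub>P (\<alpha> * (R ^ m *\<^sub>P (\<alpha> ^ m * \<eta>)))" by (intro eqv_scale eqv_mult eqv_refl Suc)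
  also have "\<dots> = R ^ Suc m *\<^sub>P (\<alpha> ^ Suc m * \<eta>)" by (simp add: mult.assoc)
  finally show ?case .
qed simp

lemma ev_a_power: "ev f * \<alpha> ^ m \<doteq> \<alpha> ^ m * ev (pcompose f [:0, R ^ m:])"
  by (rule ev_comm) (rule eta_a_power)

text \<open>The roots are the points \<open>R ^ j\<close> with \<open>j < m\<close>, so passing from
  \<open>om i\<close> to \<open>om (Suc i)\<close> absorbs one linear factor vanishing at
  \<open>R ^ i\<close>.\<close>

definition om :: "nat \<Rightarrow> complex poly"
  where "om m = (\<Prod>j<m. [:1, - 1 / R ^ j:])"

lemma ev_om: "ev (om m) \<doteq> \<alpha> ^ m * \<alpha>' ^ m"
proof (induction m)
  case (Suc m)
  have ev1: "ev [:1, -1:] = 1 - \<eta>" by (simp add: scale_poly_minus_left)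
  have "ev (om (Suc m)) = ev [:1, - 1 / R ^ m:] * ev (om m)"
    by (simp only: om_def prod.lessThan_Suc mult.commute[of _ "[:1, - 1 / R ^ m:]"] ev_mult)
  also have "\<dots> \<doteq> ev [:1, - 1 / R ^ m:] * (\<alpha> ^ m * \<alpha>' ^ m)"
    by (intro eqv_mult eqv_refl Suc)
  also have "\<dots> = (ev [:1, - 1 / R ^ m:] * \<alpha> ^ m) * \<alpha>' ^ m" by (simp only: mult.assoc)
  \<comment> \<open>Moving the new factor past \<open>\<alpha> ^ m\<close> rescales it to 1 -
    \<eta>, which is \<open>\<alpha> * \<alpha>'\<close>.\<close>
  also have "\<dots> \<doteq> (\<alpha> ^ m * ev (pcompose [:1, - 1 / R ^ m:] [:0, R ^ m:])) * \<alpha>' ^ m"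
    by (intro eqv_mult eqv_refl ev_a_power)
  also have "pcompose [:1, - 1 / R ^ m:] [:0, R ^ m:] = [:1, -1:]"
    using R_nonzero by (simp add: pcompose_pCons)
  also have "\<alpha> ^ m * ev [:1, -1:] * \<alpha>' ^ m \<doteq> \<alpha> ^ m * (\<alpha> * \<alpha>') * \<alpha>' ^ m"
    unfolding ev1 by (intro eqv_mult eqv_refl eqv_sym[OF aa'])
  also have "\<dots> = \<alpha> ^ Suc m * \<alpha>' ^ Suc m"
    unfolding power_Suc2[of \<alpha>] power_Suc[of \<alpha>'] by (simp only: mult.assoc)
  finally show ?case .
qed (simp add: om_def)

text \<open>Horner's scheme with a scaling factor of at most 1 at each stage. Uniformity in
  \<epsilon> matters because \<epsilon> will be \<open>R ^ m\<close> with \<open>m\<close> still to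
  be chosen.\<close>

lemma ev_scaled_bounded:
  assumes "rel_seminorm p"
  shows "\<exists>B. \<forall>\<epsilon>. 0 \<le> \<epsilon> \<and> \<epsilon> \<le> 1 \<longrightarrow> p (ev (pcompose f [:0, of_real \<epsilon>:])) \<le> B"
proof -
  interpret cstar_seminormed p by (rule rel_seminormD[OF assms])
  show ?thesis
  proof (induction f)
    case 0
    show ?case by (intro exI[of _ 0]) simp
  next
    case (pCons c f)
    then obtain B where B: "\<And>\<epsilon>. 0 \<le> \<epsilon> \<Longrightarrow> \<epsilon> \<le> 1 \<Longrightarrow> p (ev (pcompose f [:0, of_real \<epsilon>:])) \<le> B"
      by auto
    have "p (ev (pcompose (pCons c f) [:0, of_real \<epsilon>:])) \<le> cmod c * p 1 + p \<eta> * B"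
      if \<epsilon>: "0 \<le> \<epsilon>" "\<epsilon> \<le> 1" for \<epsilon>
    proof -
      let ?z = "ev (pcompose f [:0, of_real \<epsilon>:])"
      have "ev (pcompose (pCons c f) [:0, of_real \<epsilon>:]) = c *\<^sub>P 1 + of_real \<epsilon> *\<^sub>P (\<eta> * ?z)"
        by (simp add: pcompose_pCons)
      also have "p \<dots> \<le> cmod c * p 1 + \<epsilon> * p (\<eta> * ?z)"
        using triangle[of "c *\<^sub>P 1" "of_real \<epsilon> *\<^sub>P (\<eta> * ?z)"] \<epsilon> by simp
      also have "\<epsilon> * p (\<eta> * ?z) \<le> 1 * p (\<eta> * ?z)"
        using \<epsilon> by (intro mult_right_mono) auto
      also have "p (\<eta> * ?z) \<le> p \<eta> * p ?z" by (rule submult)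
      also have "\<dots> \<le> p \<eta> * B" using B[OF \<epsilon>] by (intro mult_left_mono) auto
      finally show ?thesis by simp
    qed
    then show ?case by blast
  qed
qed

text \<open>Writing f(t) = c + t g(t), the rescaled second summand is r^m times a bounded quantity,
  so for large \<open>m\<close> only the constant term, which is f(0), survives.\<close>

lemma ev_scaled_small:
  assumes "rel_seminorm p" "cmod (poly f 0) < T"
  shows "\<exists>m. p (ev (pcompose f [:0, R ^ m:])) \<le> T"
proof -
  interpret cstar_seminormed p by (rule rel_seminormD[OF assms(1)])
  obtain c g where f: "f = pCons c g" by (cases f) auto
  obtain B where B: "\<And>\<epsilon>. 0 \<le> \<epsilon> \<Longrightarrow> \<epsilon> \<le> 1 \<Longrightarrow> p (ev (pcompose g [:0, of_real \<epsilon>:])) \<le> B"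
    using ev_scaled_bounded[OF assms(1), of g] by auto
  let ?\<epsilon> = "\<lambda>m. ((cmod q)\<^sup>2) ^ m"
  have \<epsilon>: "0 \<le> ?\<epsilon> m" "?\<epsilon> m \<le> 1" for m
    using q_pos q_less_1 by (simp_all add: power_le_one)
  have "(\<lambda>m. cmod c + ?\<epsilon> m * (p \<eta> * B)) \<longlonglongrightarrow> cmod c + 0 * (p \<eta> * B)"
    by (intro tendsto_intros LIMSEQ_power_zero)
       (use q_pos q_less_1 in \<open>simp add: power_less_one_iff\<close>)
  moreover have "cmod c + 0 * (p \<eta> * B) < T"
    using assms(2) by (simp add: f)
  ultimately have "\<forall>\<^sub>F m in sequentially. cmod c + ?\<epsilon> m * (p \<eta> * B) < T"
    by (rule order_tendstoD)
  then obtain m where m: "cmod c + ?\<epsilon> m * (p \<eta> * B) < T"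
    using eventually_happens'[of sequentially] by fastforce
  let ?z = "ev (pcompose g [:0, of_real (?\<epsilon> m):])"
  have "ev (pcompose f [:0, R ^ m:]) = c *\<^sub>P 1 + of_real (?\<epsilon> m) *\<^sub>P (\<eta> * ?z)"
    by (simp add: pcompose_pCons f)
  also have "p \<dots> \<le> cmod c * p 1 + ?\<epsilon> m * p (\<eta> * ?z)"
    using triangle[of "c *\<^sub>P 1" "of_real (?\<epsilon> m) *\<^sub>P (\<eta> * ?z)"] by (simp add: norm_power)
  also have "\<dots> \<le> cmod c * 1 + ?\<epsilon> m * (p \<eta> * B)"
    using B[OF \<epsilon>, of m] submult[of \<eta> ?z] \<epsilon>[of m]
    by (intro add_mono mult_left_mono one_le) (auto intro: order_trans[OF _ mult_left_mono])
  finally show ?thesis using m by (intro exI[of _ m]) simp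
qed

lemma eqv_commute_power:
  assumes "x * y \<doteq> y * z"
  shows "x ^ n * y \<doteq> y * z ^ n"
proof (induction n)
  case (Suc n)
  have "x ^ Suc n * y = x * (x ^ n * y)" by (simp add: mult.assoc)
  also have "\<dots> \<doteq> x * (y * z ^ n)" by (intro eqv_mult eqv_refl Suc)
  also have "\<dots> = (x * y) * z ^ n" by (simp add: mult.assoc)
  also have "\<dots> \<doteq> (y * z) * z ^ n" by (intro eqv_mult eqv_refl assms)
  also have "\<dots> = y * z ^ Suc n" by (simp add: mult.assoc)
  finally show ?case .
qed simp

text \<open>The remainder theorem, with the linear factor normalised as in \<open>om\<close>; the
  normalisation accounts for the scalar \<open>- (R ^ i)\<close>.\<close>

lemma root_factor: "\<exists>g. f = [:poly f (R ^ i):] + [:1, - 1 / R ^ i:] * g"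
proof -
  have "poly (f - [:poly f (R ^ i):]) (R ^ i) = 0" by simp
  then obtain k where k: "f - [:poly f (R ^ i):] = [:- (R ^ i), 1:] * k"
    unfolding poly_eq_0_iff_dvd by (auto elim: dvdE)
  have "[:1, - 1 / R ^ i:] * Polynomial.smult (- (R ^ i)) k = [:- (R ^ i), 1:] * k"
    using R_nonzero by (simp add: algebra_simps flip: smult_add_right)
  then show ?thesis using k by (intro exI[of _ "Polynomial.smult (- (R ^ i)) k"]) (simp add: algebra_simps)
qed

text \<open>A descending induction on \<open>i\<close> bounds \<open>p (ev (f ^ N * om i))\<close>
  by a constant times \<open>T ^ N\<close>. At \<open>i = m\<close> the rescaled polynomial has
  seminorm at most \<open>T\<close>; each step down reintroduces one value of \<open>f\<close>, of
  modulus at most \<open>S < T\<close>; and \<open>om 0\<close> is 1.\<close>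

lemma ev_power_growth:
  assumes p: "rel_seminorm p" and f: "\<And>n. cmod (poly f (R ^ n)) \<le> S" and T: "S < T"
  shows "\<exists>C. \<forall>N. p (ev f ^ N) \<le> C * T ^ N"
proof -
  interpret cstar_seminormed p by (rule rel_seminormD[OF p])
  have S: "0 \<le> S" using f[of 0] norm_ge_zero order_trans by blast
  have "(\<lambda>n. cmod (poly f (R ^ n))) \<longlonglongrightarrow> cmod (poly f 0)"
    by (intro tendsto_intros R_power_tendsto)
  \<comment> \<open>The point 0 is the limit of the powers of r, so it obeys the same bound; this is
    what makes the starting index \<open>m\<close> available.\<close>
  then have "cmod (poly f 0) \<le> S"
    using f by (intro LIMSEQ_le_const2) auto
  then obtain m where m: "p (ev (pcompose f [:0, R ^ m:])) \<le> T"
    using ev_scaled_small[OF p, of f T] T by auto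
  have "\<exists>C. \<forall>N. p (ev (f ^ N * om i)) \<le> C * T ^ N" if "i \<le> m" for i
    using that
  proof (induction rule: inc_induct)
    case base
    let ?g = "ev (pcompose f [:0, R ^ m:])"
    have "p (ev (f ^ N * om m)) \<le> p (\<alpha> ^ m) * p (\<alpha>' ^ m) * T ^ N" for N
    proof -
      have "ev (f ^ N * om m) \<doteq> ev f ^ N * (\<alpha> ^ m * \<alpha>' ^ m)"
        unfolding ev_mult ev_power by (intro eqv_mult eqv_refl ev_om)
      also have "\<dots> = (ev f ^ N * \<alpha> ^ m) * \<alpha>' ^ m" by (simp add: mult.assoc)
      also have "\<dots> \<doteq> (\<alpha> ^ m * ?g ^ N) * \<alpha>' ^ m"
        by (intro eqv_mult eqv_refl eqv_commute_power ev_a_power)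
      finally have "p (ev (f ^ N * om m)) = p ((\<alpha> ^ m * ?g ^ N) * \<alpha>' ^ m)"
        by (rule eqv_seminorm[OF _ p])
      also have "\<dots> \<le> p (\<alpha> ^ m * ?g ^ N) * p (\<alpha>' ^ m)" by (rule submult)
      also have "\<dots> \<le> (p (\<alpha> ^ m) * p (?g ^ N)) * p (\<alpha>' ^ m)"
        by (intro mult_right_mono submult nonneg)
      also have "\<dots> \<le> (p (\<alpha> ^ m) * T ^ N) * p (\<alpha>' ^ m)"
        using m power_le[of ?g N] power_mono[OF m, of N]
        by (intro mult_right_mono mult_left_mono nonneg) auto
      finally show ?thesis by (simp add: mult_ac)
    qed
    then show ?case by blast
  next
    case (step i)
    then obtain C where C: "\<And>N. p (ev (f ^ N * om (Suc i))) \<le> C * T ^ N" by blast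
    obtain g where g: "f = [:poly f (R ^ i):] + [:1, - 1 / R ^ i:] * g"
      using root_factor by blast
    define u where "u N = p (ev (f ^ N * om i))" for N
    define K where "K = p (ev g) * C"
    \<comment> \<open>The factor \<open>w\<close> is moved next to \<open>G\<close>: for
      \<open>G = om i\<close> and the linear factor vanishing at \<open>R ^ i\<close> this produces
      \<open>om (Suc i)\<close>.\<close>
    have split: "([:c:] + w * g) * (F * G) = Polynomial.smult c (F * G) + g * (F * (G * w))"
      for c and w g F G :: "complex poly"
    proof -
      have "w * g * (F * G) = g * (F * (G * w))" by (simp add: mult_ac)
      then show ?thesis by (simp only: distrib_right) simp
    qed
    have rec: "u (Suc N) \<le> S * u N + K * T ^ N" for N
    proof -
      have "f ^ Suc N * om i = f * (f ^ N * om i)" by (simp add: mult.assoc)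
      also have "\<dots> = ([:poly f (R ^ i):] + [:1, - 1 / R ^ i:] * g) * (f ^ N * om i)"
        by (rule arg_cong[OF g])
      also have "\<dots> = Polynomial.smult (poly f (R ^ i)) (f ^ N * om i) + g * (f ^ N * om (Suc i))"
        unfolding om_def prod.lessThan_Suc by (rule split)
      finally have "u (Suc N) = p (poly f (R ^ i) *\<^sub>P ev (f ^ N * om i) + ev g * ev (f ^ N * om (Suc i)))"
        unfolding u_def by (simp only: ev_add ev_smult ev_mult)
      also have "\<dots> \<le> cmod (poly f (R ^ i)) * u N + p (ev g * ev (f ^ N * om (Suc i)))"
        using triangle[of "poly f (R ^ i) *\<^sub>P ev (f ^ N * om i)"] by (simp only: scale u_def)
      also have "p (ev g * ev (f ^ N * om (Suc i))) \<le> p (ev g) * p (ev (f ^ N * om (Suc i)))"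
        by (rule submult)
      also have "\<dots> \<le> p (ev g) * (C * T ^ N)" by (intro mult_left_mono C nonneg)
      also have "cmod (poly f (R ^ i)) * u N \<le> S * u N"
        unfolding u_def by (intro mult_right_mono f nonneg)
      finally show ?thesis by (simp add: K_def mult.assoc)
    qed
    \<comment> \<open>\<open>C'\<close> is chosen to solve the recursion: it dominates
      \<open>u 0\<close>, and K \<le> C' (T - S) says that S C' + K \<le> C' T.\<close>
    define C' where "C' = max (u 0) (K / (T - S))"
    have "K \<le> C' * (T - S)"
      using T by (simp add: C'_def pos_divide_le_eq[symmetric])
    have "u N \<le> C' * T ^ N" for N
    proof (induction N)
      case (Suc N)
      have "u (Suc N) \<le> S * (C' * T ^ N) + K * T ^ N"
        using rec[of N] Suc S mult_left_mono by fastforce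
      also have "\<dots> \<le> S * (C' * T ^ N) + C' * (T - S) * T ^ N"
        using \<open>K \<le> C' * (T - S)\<close> S T by (intro add_left_mono mult_right_mono) auto
      also have "\<dots> = C' * T ^ Suc N" by (simp add: algebra_simps)
      finally show ?case .
    qed (simp add: C'_def)
    then show ?case unfolding u_def by blast
  qed
  from this[of 0] show ?thesis by (simp add: om_def)
qed

lemma seminorm_le_of_ev:
  assumes p: "rel_seminorm p" and z: "star_poly z = z" "z \<doteq> ev f"
    and f: "\<And>n. cmod (poly f (R ^ n)) \<le> S"
  shows "p z \<le> S"
proof (rule dense_ge)
  interpret cstar_seminormed p by (rule rel_seminormD[OF p])
  fix T assume T: "S < T"
  have S: "0 \<le> S" using f[of 0] norm_ge_zero order_trans by blast
  obtain C where C: "\<And>N. p (ev f ^ N) \<le> C * T ^ N"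
    using ev_power_growth[OF p f T] by blast
  \<comment> \<open>For self-adjoint \<open>z\<close> the growth of powers determines
    \<open>p z\<close>. Here it is purely geometric, hence the vanishing coefficient of
    \<open>2 ^ k\<close> in the cubic.\<close>
  have "p z ^ 2 ^ k \<le> C * (0 * 2 ^ k + 1) ^ 3 * T ^ 2 ^ k" for k
    using self_adjoint_power[OF z(1), of k] eqv_seminorm[OF eqv_power[OF z(2), of "2 ^ k"] p] C[of "2 ^ k"]
    by simp
  then show "p z \<le> T"
    by (rule le_if_powers_le[rotated 2]) (use S T in auto)
qed

end

section \<open>The universal norm\<close>

definition word_length_le :: "nat \<Rightarrow> 'g star_poly \<Rightarrow> bool"
  where "word_length_le L x \<longleftrightarrow> (\<forall>w\<in>Poly_Mapping.keys x. length (letters w) \<le> L)"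

lemma word_length_le_mult:
  assumes "word_length_le L x" "word_length_le M y"
  shows "word_length_le (L + M) (x * y)"
  unfolding word_length_le_def
proof
  fix w assume "w \<in> Poly_Mapping.keys (x * y)"
  then obtain u v where "w = u + v" "u \<in> Poly_Mapping.keys x" "v \<in> Poly_Mapping.keys y"
    using keys_mult[of x y] by blast
  then show "length (letters w) \<le> L + M"
    using assms by (auto simp: word_length_le_def plus_star_word_def intro: add_mono)
qed

lemma word_length_le_power: "word_length_le L x \<Longrightarrow> word_length_le (n * L) (x ^ n)"
  by (induction n) (auto simp: word_length_le_mult, simp add: word_length_le_def zero_star_word_def)

lemma word_length_le_star: "word_length_le L x \<Longrightarrow> word_length_le L (star_poly x)"
  unfolding word_length_le_def
proof
  fix w assume *: "\<forall>w\<in>Poly_Mapping.keys x. length (letters w) \<le> L" "w \<in> Poly_Mapping.keys (star_poly x)"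
  then have "star_of_word w \<in> Poly_Mapping.keys x"
    by (simp add: in_keys_iff)
  with * have "length (letters (star_of_word w)) \<le> L" by blast
  then show "length (letters w) \<le> L" by (simp add: star_of_word_def)
qed

lemma word_length_le_exists: "\<exists>L. word_length_le L x"
  unfolding word_length_le_def
  by (intro exI[of _ "Max ((\<lambda>w. length (letters w)) ` Poly_Mapping.keys x)"]) auto

context uq2
begin

section \<open>Homogeneous components\<close>

definition is_ev :: "uq2_gen star_poly \<Rightarrow> bool"
  where "is_ev x \<longleftrightarrow> (\<exists>f. x \<doteq> ev f)"

lemma is_ev_sum: "(\<And>i. i \<in> A \<Longrightarrow> is_ev (f i)) \<Longrightarrow> is_ev (\<Sum>i\<in>A. f i)"
proof (induction A rule: infinite_finite_induct)
  case (insert i A)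
  then have "is_ev (f i)" "is_ev (sum f A)" by blast+
  then obtain g h where "f i \<doteq> ev g" "sum f A \<doteq> ev h" unfolding is_ev_def by blast
  from eqv_add[OF this] insert(1,2) show ?case
    by (auto simp: is_ev_def simp flip: ev_add)
qed (auto simp: is_ev_def intro!: exI[of _ 0])

lemma is_ev_scale: "is_ev x \<Longrightarrow> is_ev (c *\<^sub>P x)"
  unfolding is_ev_def by (metis eqv_scale ev_smult)

definition wdeg :: "uq2_gen star_word \<Rightarrow> uq2_gen \<Rightarrow> int"
  where "wdeg w = (\<lambda>g. deg g (letters w))"

definition hom_part :: "(uq2_gen \<Rightarrow> int) \<Rightarrow> uq2_gen star_poly \<Rightarrow> uq2_gen star_poly"
  where "hom_part d x = (\<Sum>w | w \<in> Poly_Mapping.keys x \<and> wdeg w = d.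
    Poly_Mapping.single w (Poly_Mapping.lookup x w))"

lemma sum_hom_part: "x = (\<Sum>d\<in>wdeg ` Poly_Mapping.keys x. hom_part d x)"
proof -
  have "x = (\<Sum>w\<in>Poly_Mapping.keys x. Poly_Mapping.single w (Poly_Mapping.lookup x w))"
    by (rule star_poly_expand)
  also have "\<dots> = (\<Sum>d\<in>wdeg ` Poly_Mapping.keys x. hom_part d x)"
    unfolding hom_part_def by (rule sum.image_gen) simp
  finally show ?thesis .
qed

text \<open>The adjoint of a word of degree \<open>d\<close> followed by a word of degree
  \<open>d\<close> has degree zero in every generator, so every product of monomials reduces to a
  polynomial in \<eta>.\<close>

lemma star_hom_part_mult: "is_ev (star_poly (hom_part d x) * hom_part d x)"
  unfolding hom_part_def star_poly_sum sum_product
proof (intro is_ev_sum, goal_cases)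
  case (1 v w)
  then have d: "wdeg v = d" "wdeg w = d" by auto
  have "deg g (letters (star_of_word v + w)) = 0" for g
    using fun_cong[OF d(1), of g] fun_cong[OF d(2), of g]
    by (simp add: wdeg_def plus_star_word_def star_of_word_def deg_star)
  then have "is_ev (word_poly (letters (star_of_word v + w)))"
    unfolding is_ev_def by (rule degree_zero_word)
  then show ?case
    using is_ev_scale[of "word_poly (letters (star_of_word v + w))"]
    by (simp add: mult_single word_poly_def)
qed

text \<open>The points \<open>R ^ n\<close> of the abstract bound are eigenvalues of \<eta> in the
  representation; this is where the two meet.\<close>

lemma rho_ev_ket: "rho q (ev f) (ket (n, 0, 0)) = poly f (R ^ n) *\<^sub>C ket (n, 0, 0)"
proof (induction f)
  case (pCons c f)
  have "rho q \<eta> (ket (n, 0, 0)) = R ^ n *\<^sub>C ket (n, 0, 0)"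
    by (rule ell2_eqI)
       (auto simp: rho_mult q_sq power_mult_distrib simp del: of_real_power split: prod.splits)
  with pCons show ?case
    by (simp add: rho_add rho_mult rho_scale bounded_opD scaleC_add_left mult.commute)
qed simp

text \<open>Starting from \<open>ket (n, 0, 0)\<close>, a word reaches at most one basis vector,
  whose position records the degree. Words of different degrees thus have orthogonal images.\<close>

lemma word_op_support:
  "Rep_ell2 (word_op q l (ket (n, 0, 0))) (m, k, j) \<noteq> 0 \<Longrightarrow>
    int m = int n + deg GenA l \<and> k = deg GenB l \<and> j = deg GenD l"
proof (induction l arbitrary: m k j)
  case (Cons s l)
  have "coef q s (m, k, j) \<noteq> 0" and 1: "Rep_ell2 (word_op q l (ket (n, 0, 0))) (source s (m, k, j)) \<noteq> 0"
    using Cons.prems by auto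
  then show ?case
    using Cons.IH by (cases s rule: letter_cases; cases m) (simp_all, force+)
qed (auto split: if_splits)

lemma norm_rho_hom_part_le: "norm (rho q (hom_part d x) (ket (n, 0, 0))) \<le> norm (rho q x (ket (n, 0, 0)))"
proof (rule norm_ell2_mono)
  fix i :: "nat \<times> int \<times> int"
  let ?t = "\<lambda>w. Poly_Mapping.lookup x w * Rep_ell2 (word_op q (letters w) (ket (n, 0, 0))) i"
  have x: "Rep_ell2 (rho q x (ket (n, 0, 0))) i = (\<Sum>w\<in>Poly_Mapping.keys x. ?t w)"
    by (simp add: rho_def)
  have c: "Rep_ell2 (rho q (hom_part d x) (ket (n, 0, 0))) i
      = (\<Sum>w | w \<in> Poly_Mapping.keys x \<and> wdeg w = d. ?t w)"
    by (simp add: hom_part_def rho_sum)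
  \<comment> \<open>At most one degree contributes to the coordinate \<open>i\<close>, so that
    coordinate of the component is either the one of the whole element or zero.\<close>
  have same: "wdeg v = wdeg w" if "?t v \<noteq> 0" "?t w \<noteq> 0" for v w
  proof
    fix g
    show "wdeg v g = wdeg w g"
      using word_op_support[of "letters v" n "fst i" "fst (snd i)" "snd (snd i)"]
        word_op_support[of "letters w" n "fst i" "fst (snd i)" "snd (snd i)"] that
      by (cases g) (simp_all add: wdeg_def)
  qed
  show "cmod (Rep_ell2 (rho q (hom_part d x) (ket (n, 0, 0))) i) \<le> cmod (Rep_ell2 (rho q x (ket (n, 0, 0))) i)"
  proof (cases "\<exists>w. wdeg w = d \<and> ?t w \<noteq> 0")
    case True
    then have "?t w = 0" if "wdeg w \<noteq> d" for w using same that by blast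
    then have "(\<Sum>w | w \<in> Poly_Mapping.keys x \<and> wdeg w = d. ?t w) = (\<Sum>w\<in>Poly_Mapping.keys x. ?t w)"
      by (intro sum.mono_neutral_left) auto
    then show ?thesis unfolding x c by simp
  next
    case False
    then have "(\<Sum>w | w \<in> Poly_Mapping.keys x \<and> wdeg w = d. ?t w) = 0"
      by (intro sum.neutral) auto
    then show ?thesis unfolding c by simp
  qed
qed

lemma seminorm_hom_part_le:
  assumes "rel_seminorm p"
  shows "p (hom_part d x) \<le> opnorm x"
proof -
  interpret cstar_seminormed p by (rule rel_seminormD[OF assms])
  let ?c = "hom_part d x" and ?e = "\<lambda>n. ket (n, 0, 0) :: (nat \<times> int \<times> int) ell2"
  obtain f where f: "star_poly ?c * ?c \<doteq> ev f"
    using star_hom_part_mult unfolding is_ev_def by blast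
  have "cmod (poly f (R ^ n)) \<le> (opnorm x)\<^sup>2" for n
  proof -
    \<comment> \<open>The value is the expectation of the positive element
      \<open>star_poly ?c * ?c\<close> in the vector \<open>?e n\<close>, that is, the squared norm
      of the image of this vector under the component.\<close>
    have "poly f (R ^ n) = cinner_ell2 (?e n) (rho q (ev f) (?e n))"
      by (simp add: rho_ev_ket cinner_scale_right cinner_self)
    also have "\<dots> = cinner_ell2 (?e n) (rho q (star_poly ?c) (rho q ?c (?e n)))"
      by (simp add: eqv_rho[OF f, symmetric] rho_mult)
    also have "\<dots> = cinner_ell2 (rho q ?c (?e n)) (rho q ?c (?e n))"
      using adjoint_pair_sym[OF adjoint_pair_rho[of ?c]] by (simp add: adjoint_pair_def)
    finally have "cmod (poly f (R ^ n)) = (norm (rho q ?c (?e n)))\<^sup>2"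
      by (simp add: cinner_self norm_power)
    also have "\<dots> \<le> (opnorm x)\<^sup>2"
      using norm_rho_hom_part_le[of d x n] norm_rho_le[of x "?e n"] by (intro power_mono) auto
    finally show ?thesis .
  qed
  then have "p (star_poly ?c * ?c) \<le> (opnorm x)\<^sup>2"
    by (intro seminorm_le_of_ev[OF assms _ f]) simp_all
  then show ?thesis
    unfolding cstar using opnorm_nonneg power2_le_imp_le by blast
qed

section \<open>Comparison of all seminorms with the operator norm\<close>

lemma card_degrees_le:
  assumes "word_length_le L x"
  shows "card (wdeg ` Poly_Mapping.keys x) \<le> (2 * L + 1) ^ 3"
proof -
  let ?I = "{- int L..int L}"
  have deg: "\<bar>deg g l\<bar> \<le> int (length l)" for g l
    by (induction l) auto
  let ?f = "\<lambda>d :: uq2_gen \<Rightarrow> int. (d GenA, d GenB, d GenD)"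
  have "inj_on ?f A" for A
  proof (rule inj_onI)
    fix d d' assume "?f d = ?f d'"
    then have "d g = d' g" for g by (cases g) auto
    then show "d = d'" by (rule ext)
  qed
  moreover have "?f ` wdeg ` Poly_Mapping.keys x \<subseteq> ?I \<times> ?I \<times> ?I"
  proof -
    have abs: "\<bar>wdeg w g\<bar> \<le> int L" if "w \<in> Poly_Mapping.keys x" for w g
      using that assms deg[of g "letters w"] unfolding wdeg_def word_length_le_def
      by (meson of_nat_mono order_trans)
    then have "wdeg w g \<in> ?I" if "w \<in> Poly_Mapping.keys x" for w g
      using abs[OF that, of g] by auto
    then show ?thesis by auto
  qed
  ultimately have "card (wdeg ` Poly_Mapping.keys x) \<le> card (?I \<times> ?I \<times> ?I)"
    by (rule card_inj_on_le) simp
  also have "\<dots> = (2 * L + 1) ^ 3"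
  proof -
    have "nat (int L - - int L + 1) = 2 * L + 1" by simp
    then show ?thesis
      by (simp only: card_cartesian_product card_atLeastAtMost_int power3_eq_cube mult.assoc)
  qed
  finally show ?thesis .
qed

lemma seminorm_le_opnorm_card:
  assumes "rel_seminorm p" "word_length_le L x"
  shows "p x \<le> (2 * real L + 1) ^ 3 * opnorm x"
proof -
  interpret cstar_seminormed p by (rule rel_seminormD[OF assms(1)])
  have "p x \<le> (\<Sum>d\<in>wdeg ` Poly_Mapping.keys x. p (hom_part d x))"
    using sum_le[of "\<lambda>d. hom_part d x" "wdeg ` Poly_Mapping.keys x"] unfolding sum_hom_part[symmetric] .
  also have "\<dots> \<le> real (card (wdeg ` Poly_Mapping.keys x)) * opnorm x"
    by (rule sum_bounded_above) (rule seminorm_hom_part_le[OF assms(1)])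
  also have "real (card (wdeg ` Poly_Mapping.keys x)) \<le> real ((2 * L + 1) ^ 3)"
    using card_degrees_le[OF assms(2)] by (rule of_nat_mono)
  finally show ?thesis
    using opnorm_nonneg[of x] by (simp add: mult_right_mono add.commute)
qed

text \<open>The loss in \<open>seminorm_le_opnorm_card\<close> is polynomial in the word length. It
  disappears on powers of \<open>?y\<close>, where both seminorms are multiplicative along exponents
  \<open>2 ^ k\<close>.\<close>

lemma rel_seminorm_le_opnorm:
  assumes "rel_seminorm p"
  shows "p x \<le> opnorm x"
proof -
  interpret cstar_seminormed p by (rule rel_seminormD[OF assms])
  interpret op: cstar_seminormed opnorm by (rule rel_seminormD[OF rel_seminorm_opnorm])
  obtain L where L: "word_length_le L x" using word_length_le_exists by blast
  let ?y = "star_poly x * x"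
  have "p ?y ^ 2 ^ k \<le> 1 * (4 * real L * 2 ^ k + 1) ^ 3 * opnorm ?y ^ 2 ^ k" for k
  proof -
    \<comment> \<open>Each factor contributes at most \<open>2 * L\<close> letters, so twice the
      length bound plus one is the base of the cube above.\<close>
    have "word_length_le (2 ^ k * (L + L)) (?y ^ 2 ^ k)"
      by (intro word_length_le_power word_length_le_mult word_length_le_star L)
    from seminorm_le_opnorm_card[OF assms this] show ?thesis
      by (simp add: self_adjoint_power op.self_adjoint_power algebra_simps)
  qed
  then have "p ?y \<le> opnorm ?y"
    by (rule le_if_powers_le[rotated 2]) simp_all
  then show ?thesis
    unfolding cstar op.cstar using opnorm_nonneg power2_le_imp_le by blast
qed

text \<open>\<open>opnorm\<close> is itself one of the competing seminorms and dominates the others,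
  so the supremum is a maximum.\<close>

lemma univ_norm_eq_opnorm: "univ_norm (uq2_relations q) = opnorm"
proof
  fix x
  let ?P = "{p. cstar_seminorm p \<and> (\<forall>r\<in>uq2_relations q. p r = 0)}"
  have in_P: "p \<in> ?P \<longleftrightarrow> rel_seminorm p" for p by (simp add: rel_seminorm_def)
  show "univ_norm (uq2_relations q) x = opnorm x"
    unfolding univ_norm_def
    by (intro cSup_eq_maximum)
       (use in_P rel_seminorm_opnorm rel_seminorm_le_opnorm in blast)+
qed

end

section \<open>The completed algebra\<close>

lemma UN_constant_eq': "S \<noteq> {} \<Longrightarrow> (\<And>x. x \<in> S \<Longrightarrow> f x = c) \<Longrightarrow> (\<Union>x\<in>S. f x) = c"
  by auto

lemma geometric_sum_inverse:
  fixes V :: "'g star_poly"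
  shows "(1 - V) * (\<Sum>k<n. V ^ k) = 1 - V ^ n" "(\<Sum>k<n. V ^ k) * (1 - V) = 1 - V ^ n"
  by (induction n) (simp_all add: distrib_left distrib_right power_commutes
      left_diff_distrib[of 1 V "V ^ _"] right_diff_distrib[of "V ^ _" 1 V])

text \<open>Once the universal norm is identified with a known C*-seminorm, the completion can be
  studied for arbitrary relations without returning to the supremum.\<close>

locale universal_cstar = cstar_seminormed p for p :: "'g star_poly \<Rightarrow> real" +
  fixes R :: "'g star_poly set"
  assumes univ_norm_eq: "univ_norm R = p"
begin

abbreviation "cauchy \<equiv> cauchy_wrt p"
abbreviation "cl \<equiv> cauchy_class p"
abbreviation "\<A> \<equiv> universal_cstar_algebra R"

lemma cauchyI: "(\<And>e. 0 < e \<Longrightarrow> \<exists>M. \<forall>m\<ge>M. \<forall>n\<ge>M. p (X m - X n) < e) \<Longrightarrow> cauchy X"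
  by (simp add: cauchy_wrt_def)

lemma cauchyD:
  assumes "cauchy X" "0 < e"
  obtains M where "\<And>m n. m \<ge> M \<Longrightarrow> n \<ge> M \<Longrightarrow> p (X m - X n) < e"
  using assms unfolding cauchy_wrt_def by blast

lemma cauchy_le:
  assumes "cauchy X" "\<And>m n. p (Y m - Y n) \<le> K * p (X m - X n)" "0 \<le> K"
  shows "cauchy Y"
proof (rule cauchyI)
  fix e :: real assume "0 < e"
  \<comment> \<open>Using \<open>K + 1\<close> keeps the denominator positive when
    \<open>K = 0\<close>.\<close>
  then have "0 < e / (K + 1)" using assms(3) by simp
  then obtain M where M: "\<And>m n. m \<ge> M \<Longrightarrow> n \<ge> M \<Longrightarrow> p (X m - X n) < e / (K + 1)"
    by (rule cauchyD[OF assms(1)]) blast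
  have "p (Y m - Y n) < e" if "m \<ge> M" "n \<ge> M" for m n
  proof -
    have "p (Y m - Y n) \<le> (K + 1) * p (X m - X n)"
      using assms(2)[of m n] nonneg[of "X m - X n"] unfolding distrib_right by linarith
    also have "\<dots> < e"
      using M[OF that] assms(3) by (simp add: pos_less_divide_eq mult.commute)
    finally show ?thesis .
  qed
  then show "\<exists>M. \<forall>m\<ge>M. \<forall>n\<ge>M. p (Y m - Y n) < e" by blast
qed

lemma cauchy_const [simp]: "cauchy (\<lambda>_. x)"
  by (simp add: cauchy_wrt_def)

lemma cauchy_scale: "cauchy X \<Longrightarrow> cauchy (\<lambda>n. c *\<^sub>P X n)"
  by (erule cauchy_le[where K = "cmod c"]) (simp_all only: scale order_refl norm_ge_zero flip: scale_poly_diff_right)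

lemma cauchy_star: "cauchy X \<Longrightarrow> cauchy (\<lambda>n. star_poly (X n))"
  by (erule cauchy_le[where K = 1]) (simp_all del: star_poly_diff flip: star_poly_diff)

lemma cauchy_add:
  assumes "cauchy X" "cauchy Y"
  shows "cauchy (\<lambda>n. X n + Y n)"
proof (rule cauchyI)
  fix e :: real assume "0 < e"
  then have e: "0 < e / 2" by simp
  obtain M where M: "\<And>m n. m \<ge> M \<Longrightarrow> n \<ge> M \<Longrightarrow> p (X m - X n) < e / 2"
    by (rule cauchyD[OF assms(1) e]) blast
  obtain N where N: "\<And>m n. m \<ge> N \<Longrightarrow> n \<ge> N \<Longrightarrow> p (Y m - Y n) < e / 2"
    by (rule cauchyD[OF assms(2) e]) blast
  have "p (X m + Y m - (X n + Y n)) < e" if "m \<ge> max M N" "n \<ge> max M N" for m n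
    using triangle[of "X m - X n" "Y m - Y n"] M[of m n] N[of m n] that by (simp add: add_diff_add)
  then show "\<exists>M. \<forall>m\<ge>M. \<forall>n\<ge>M. p (X m + Y m - (X n + Y n)) < e" by blast
qed

lemma cauchy_bounded:
  assumes "cauchy X"
  obtains B where "0 \<le> B" "\<And>n. p (X n) \<le> B"
proof -
  obtain M where M: "\<And>m n. m \<ge> M \<Longrightarrow> n \<ge> M \<Longrightarrow> p (X m - X n) < 1"
    by (rule cauchyD[OF assms zero_less_one]) blast
  have "p (X n) \<le> 1 + (\<Sum>k\<le>M. p (X k))" for n
  proof (cases "n \<le> M")
    case True
    then show ?thesis using member_le_sum[of n "{..M}" "\<lambda>k. p (X k)"] by simp
  next
    case False
    then have "p (X n) \<le> 1 + p (X M)" using M[of n M] reverse_triangle[of "X n" "X M"] by simp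
    then show ?thesis using member_le_sum[of M "{..M}" "\<lambda>k. p (X k)"] by simp
  qed
  note bound = this
  have "0 \<le> 1 + (\<Sum>k\<le>M. p (X k))"
    using bound[of 0] nonneg[of "X 0"] by linarith
  then show ?thesis by (rule that[OF _ bound])
qed

lemma cauchy_mult:
  assumes "cauchy X" "cauchy Y"
  shows "cauchy (\<lambda>n. X n * Y n)"
proof (rule cauchyI)
  fix e :: real assume e: "0 < e"
  obtain A where A: "0 \<le> A" "\<And>n. p (X n) \<le> A" using cauchy_bounded[OF assms(1)] by blast
  obtain B where B: "0 \<le> B" "\<And>n. p (Y n) \<le> B" using cauchy_bounded[OF assms(2)] by blast
  define d where "d = e / (A + B + 1)"
  have d: "0 < d" using e A B by (simp add: d_def)
  obtain M where M: "\<And>m n. m \<ge> M \<Longrightarrow> n \<ge> M \<Longrightarrow> p (X m - X n) < d"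
    by (rule cauchyD[OF assms(1) d]) blast
  obtain N where N: "\<And>m n. m \<ge> N \<Longrightarrow> n \<ge> N \<Longrightarrow> p (Y m - Y n) < d"
    by (rule cauchyD[OF assms(2) d]) blast
  have "p (X m * Y m - X n * Y n) < e" if "m \<ge> max M N" "n \<ge> max M N" for m n
  proof -
    have "p (X m * Y m - X n * Y n) \<le> p (X m) * p (Y m - Y n) + p (X m - X n) * p (Y n)"
      by (rule mult_diff_le)
    also have "\<dots> \<le> A * d + d * B"
      using M[of m n] N[of m n] that A B d by (intro add_mono mult_mono) auto
    also have "\<dots> < (A + B + 1) * d" using d by (simp add: algebra_simps)
    also have "\<dots> = e" using A B by (simp add: d_def)
    finally show ?thesis .
  qed
  then show "\<exists>M. \<forall>m\<ge>M. \<forall>n\<ge>M. p (X m * Y m - X n * Y n) < e" by blast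
qed

lemma in_cl_iff: "Y \<in> cl X \<longleftrightarrow> cauchy Y \<and> (\<lambda>n. p (X n - Y n)) \<longlonglongrightarrow> 0"
  by (simp add: cauchy_class_def)

lemma self_in_cl: "cauchy X \<Longrightarrow> X \<in> cl X"
  by (simp add: in_cl_iff)

lemma null_le:
  "(\<lambda>n. f n) \<longlonglongrightarrow> 0 \<Longrightarrow> (\<And>n. p (X n) \<le> f n) \<Longrightarrow> (\<lambda>n. p (X n)) \<longlonglongrightarrow> 0"
  by (rule tendsto_sandwich[of "\<lambda>_. 0" _ _ f]) auto

lemma cl_eqI:
  assumes "(\<lambda>n. p (X n - Y n)) \<longlonglongrightarrow> 0"
  shows "cl X = cl Y"
proof -
  have sub: "cl X \<subseteq> cl Y" if "(\<lambda>n. p (X n - Y n)) \<longlonglongrightarrow> 0" for X Y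
  proof
    fix Z assume Z: "Z \<in> cl X"
    have "(\<lambda>n. p (Y n - Z n)) \<longlonglongrightarrow> 0"
    proof (rule null_le)
      show "(\<lambda>n. p (X n - Y n) + p (X n - Z n)) \<longlonglongrightarrow> 0"
        using Z that by (intro tendsto_add_zero) (auto simp: in_cl_iff)
      show "p (Y n - Z n) \<le> p (X n - Y n) + p (X n - Z n)" for n
        using triangle3[of "Y n" "Z n" "X n"] by (simp add: diff_commute[of "Y n"])
    qed
    with Z show "Z \<in> cl Y" by (simp add: in_cl_iff)
  qed
  show ?thesis
    using assms sub[of X Y] sub[of Y X] diff_commute by (simp add: subset_antisym)
qed

lemma carrier_eq: "carrier \<A> = {cl X | X. cauchy X}"
  and one_eq: "\<one>\<^bsub>\<A>\<^esub> = cl (\<lambda>_. 1)"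
  by (simp_all add: universal_cstar_algebra_def Let_def univ_norm_eq)

lemma operations_eq:
  shows add_eq: "S \<oplus>\<^bsub>\<A>\<^esub> T = (\<Union>X\<in>S. \<Union>Y\<in>T. cl (\<lambda>n. X n + Y n))"
    and mult_eq: "S \<otimes>\<^bsub>\<A>\<^esub> T = (\<Union>X\<in>S. \<Union>Y\<in>T. cl (\<lambda>n. X n * Y n))"
    and smult_eq: "c \<odot>\<^bsub>\<A>\<^esub> S = (\<Union>X\<in>S. cl (\<lambda>n. c *\<^sub>P X n))"
    and star_eq: "star \<A> S = (\<Union>X\<in>S. cl (\<lambda>n. star_poly (X n)))"
  by (simp_all add: universal_cstar_algebra_def Let_def univ_norm_eq)

lemma cl_in_carrier: "cauchy X \<Longrightarrow> cl X \<in> carrier \<A>"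
  by (auto simp: carrier_eq)

text \<open>The union over all pairs of representatives is a single class because every pair yields
  the same one. The other operations follow this pattern.\<close>

lemma cl_add:
  assumes "cauchy X" "cauchy Y"
  shows "cl X \<oplus>\<^bsub>\<A>\<^esub> cl Y = cl (\<lambda>n. X n + Y n)"
proof -
  have "cl (\<lambda>n. X' n + Y' n) = cl (\<lambda>n. X n + Y n)" if "X' \<in> cl X" "Y' \<in> cl Y" for X' Y'
  proof (rule cl_eqI, rule null_le)
    show "(\<lambda>n. p (X n - X' n) + p (Y n - Y' n)) \<longlonglongrightarrow> 0"
      using that by (intro tendsto_add_zero) (auto simp: in_cl_iff)
    show "p (X' n + Y' n - (X n + Y n)) \<le> p (X n - X' n) + p (Y n - Y' n)" for n
      using triangle[of "X' n - X n" "Y' n - Y n"]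
      by (simp add: add_diff_add diff_commute[of "X n"] diff_commute[of "Y n"])
  qed
  then show ?thesis
    using self_in_cl[OF assms(1)] self_in_cl[OF assms(2)] unfolding add_eq
    by (intro UN_constant_eq') blast+
qed

lemma cl_mult:
  assumes "cauchy X" "cauchy Y"
  shows "cl X \<otimes>\<^bsub>\<A>\<^esub> cl Y = cl (\<lambda>n. X n * Y n)"
proof -
  have "cl (\<lambda>n. X' n * Y' n) = cl (\<lambda>n. X n * Y n)" if "X' \<in> cl X" "Y' \<in> cl Y" for X' Y'
  proof -
    have "cauchy X'" using that by (simp add: in_cl_iff)
    then obtain A where A: "0 \<le> A" "\<And>n. p (X' n) \<le> A" using cauchy_bounded by blast
    obtain B where B: "0 \<le> B" "\<And>n. p (Y n) \<le> B" using cauchy_bounded[OF assms(2)] by blast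
    have lim: "(\<lambda>n. A * p (Y n - Y' n) + p (X n - X' n) * B) \<longlonglongrightarrow> 0"
      using that by (intro tendsto_add_zero tendsto_mult_right_zero tendsto_mult_left_zero)
        (auto simp: in_cl_iff)
    have le: "p (X' n * Y' n - X n * Y n) \<le> A * p (Y n - Y' n) + p (X n - X' n) * B" for n
    proof -
      have "p (X' n * Y' n - X n * Y n) \<le> p (X' n) * p (Y' n - Y n) + p (X' n - X n) * p (Y n)"
        by (rule mult_diff_le)
      also have "\<dots> \<le> A * p (Y' n - Y n) + p (X' n - X n) * B"
        using A B by (intro add_mono mult_mono) auto
      finally show ?thesis by (simp add: diff_commute[of "X n"] diff_commute[of "Y n"])
    qed
    show ?thesis by (rule cl_eqI[OF null_le[OF lim le]])
  qed
  then show ?thesis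
    using self_in_cl[OF assms(1)] self_in_cl[OF assms(2)] unfolding mult_eq
    by (intro UN_constant_eq') blast+
qed

lemma cl_scale:
  assumes "cauchy X"
  shows "c \<odot>\<^bsub>\<A>\<^esub> cl X = cl (\<lambda>n. c *\<^sub>P X n)"
proof -
  have "cl (\<lambda>n. c *\<^sub>P X' n) = cl (\<lambda>n. c *\<^sub>P X n)" if "X' \<in> cl X" for X'
  proof (rule cl_eqI, rule null_le)
    show "(\<lambda>n. cmod c * p (X n - X' n)) \<longlonglongrightarrow> 0"
      using that by (intro tendsto_mult_right_zero) (auto simp: in_cl_iff)
  qed (simp add: diff_commute[of "X _"] flip: scale_poly_diff_right)
  then show ?thesis
    using self_in_cl[OF assms] unfolding smult_eq
    by (intro UN_constant_eq') blast+
qed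

lemma cl_star:
  assumes "cauchy X"
  shows "star \<A> (cl X) = cl (\<lambda>n. star_poly (X n))"
proof -
  have "cl (\<lambda>n. star_poly (X' n)) = cl (\<lambda>n. star_poly (X n))" if "X' \<in> cl X" for X'
  proof (rule cl_eqI, rule null_le)
    show "(\<lambda>n. p (X n - X' n)) \<longlonglongrightarrow> 0"
      using that by (auto simp: in_cl_iff)
  qed (simp add: diff_commute[of "X _"] flip: star_poly_diff)
  then show ?thesis
    using self_in_cl[OF assms] unfolding star_eq
    by (intro UN_constant_eq') blast+
qed

lemma representation_cl:
  assumes "representation \<A> \<pi>" "cauchy X" "cauchy Y"
  shows "bounded_op (\<pi> (cl X))" "\<pi> (cl (\<lambda>_. 1)) = id"
    "\<pi> (cl (\<lambda>n. X n + Y n)) = (\<lambda>u. \<pi> (cl X) u + \<pi> (cl Y) u)"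
    "\<pi> (cl (\<lambda>n. X n * Y n)) = \<pi> (cl X) \<circ> \<pi> (cl Y)"
    "\<pi> (cl (\<lambda>n. c *\<^sub>P X n)) = (\<lambda>u. c *\<^sub>C \<pi> (cl X) u)"
    "adjoint_pair (\<pi> (cl (\<lambda>n. star_poly (X n)))) (\<pi> (cl X))"
  using assms(1) cl_in_carrier[OF assms(2)] cl_in_carrier[OF assms(3)]
  unfolding representation_def adjoint_pair_def cl_add[OF assms(2,3), symmetric]
    cl_mult[OF assms(2,3), symmetric] cl_scale[OF assms(2), symmetric]
    cl_star[OF assms(2), symmetric] one_eq[symmetric]
  by blast+

text \<open>The Neumann series of a Cauchy sequence of strict contractions is controlled by the resolvent
  identity, which for truncated series holds up to terms of size \<open>\<rho> ^ n\<close>.\<close>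

lemma cauchy_neumann:
  assumes V: "cauchy V" and \<rho>: "\<And>n. p (V n) \<le> \<rho>" "\<rho> < 1"
  defines "C \<equiv> \<lambda>n. \<Sum>k<n. V n ^ k"
  shows "cauchy C" "(\<lambda>n. p (C n * (1 - V n) - 1)) \<longlonglongrightarrow> 0"
proof -
  have \<rho>0: "0 \<le> \<rho>" using \<rho>(1)[of 0] nonneg order_trans by blast
  have pow: "p (V n ^ k) \<le> \<rho> ^ k" for n k
    using power_le[of "V n" k] power_mono[OF \<rho>(1), of n k] by simp
  define K where "K = 1 / (1 - \<rho>)"
  have K0: "0 < K" using \<rho>(2) by (simp add: K_def)
  have CK: "p (C n) \<le> K" for n
  proof -
    have "p (C n) \<le> (\<Sum>k<n. \<rho> ^ k)"
      unfolding C_def by (rule order_trans[OF sum_le]) (intro sum_mono pow)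
    also have "\<dots> = (1 - \<rho> ^ n) / (1 - \<rho>)" using \<rho>(2) by (simp add: sum_gp_strict)
    also have "\<dots> \<le> K" unfolding K_def using \<rho>(2) \<rho>0 by (intro divide_right_mono) auto
    finally show ?thesis .
  qed
  have lim: "(\<lambda>n. \<rho> ^ n) \<longlonglongrightarrow> 0" using \<rho>0 \<rho>(2) by (intro LIMSEQ_power_zero) simp
  show "(\<lambda>n. p (C n * (1 - V n) - 1)) \<longlonglongrightarrow> 0"
    by (rule null_le[OF lim]) (simp add: C_def geometric_sum_inverse pow)
  show "cauchy C"
  proof (rule cauchyI)
    fix e :: real assume e: "0 < e"
    \<comment> \<open>The three error terms sum to K (K + 2) d, which is below 3 K (K + 1) d =
      e.\<close>
    define d where "d = e / (3 * K * (K + 1))"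
    have d: "0 < d" using e K0 by (simp add: d_def)
    obtain M where M: "\<And>m n. m \<ge> M \<Longrightarrow> n \<ge> M \<Longrightarrow> p (V m - V n) < d"
      by (rule cauchyD[OF V d]) blast
    obtain N where N: "\<And>n. n \<ge> N \<Longrightarrow> \<rho> ^ n < d"
      using order_tendstoD(2)[OF lim d] unfolding eventually_sequentially by blast
    have "p (C n - C m) < e" if "n \<ge> max M N" "m \<ge> max M N" for n m
    proof -
      have diff: "C n * (V n - V m) * C m = C n * (1 - V m) * C m - C n * (1 - V n) * C m"
        by (simp add: algebra_simps)
      have "C n * (1 - V m) * C m = C n - C n * V m ^ m"
        by (simp only: mult.assoc C_def geometric_sum_inverse) (simp only: right_diff_distrib mult_1_right)
      moreover have "C n * (1 - V n) * C m = C m - V n ^ n * C m"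
        by (simp only: C_def geometric_sum_inverse) (simp only: left_diff_distrib mult_1_left)
      ultimately have "C n - C m = C n * V m ^ m - V n ^ n * C m + C n * (V n - V m) * C m"
        using diff by simp
      then have "p (C n - C m) \<le> p (C n * V m ^ m) + p (V n ^ n * C m) + p (C n * (V n - V m) * C m)"
        using triangle[of "C n * V m ^ m - V n ^ n * C m" "C n * (V n - V m) * C m"]
          triangle_diff[of "C n * V m ^ m" "V n ^ n * C m"] by simp
      also have "p (C n * V m ^ m) \<le> K * d"
        using CK[of n] pow[of m m] N[of m] that K0 d
        by (intro order_trans[OF submult] mult_mono) auto
      also have "p (V n ^ n * C m) \<le> d * K"
        using CK[of m] pow[of n n] N[of n] that K0 d
        by (intro order_trans[OF submult] mult_mono) auto
      also have "p (C n * (V n - V m) * C m) \<le> (K * d) * K"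
        using CK[of n] CK[of m] M[of n m] that K0 d
        by (intro order_trans[OF submult] mult_mono) (auto intro!: mult_nonneg_nonneg)
      finally have "p (C n - C m) \<le> K * d + d * K + K * d * K" by simp
      also have "\<dots> < 3 * K * (K + 1) * d" using K0 d by (simp add: algebra_simps add_pos_pos)
      also have "\<dots> = e" using K0 by (simp add: d_def)
      finally show ?thesis .
    qed
    then show "\<exists>M. \<forall>m\<ge>M. \<forall>n\<ge>M. p (C m - C n) < e" by blast
  qed
qed

end

text \<open>Expanding the squared norm of \<open>u\<close> minus its image under the normalised
  \<open>S\<close> after \<open>T\<close> shows that a lower bound would push the norm of
  \<open>T\<close> strictly below itself.\<close>

lemma not_bounded_below_at_norm:
  assumes T: "bounded_op T" and S: "bounded_op S" and adj: "adjoint_pair S T"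
    and pos: "0 < onorm T" and K: "1 \<le> K"
    and below: "\<And>u. norm u \<le> K * norm (u - of_real (1 / (onorm T)\<^sup>2) *\<^sub>C S (T u))"
  shows False
proof -
  define l where "l = (onorm T)\<^sup>2"
  have l: "0 < l" using pos by (simp add: l_def)
  \<comment> \<open>Solving norm(u)^2 \<le> K^2 (2 norm(u)^2 - 2 norm(T u)^2 / l) for norm(T u)^2
    gives exactly this factor, which is smaller than \<open>l\<close>.\<close>
  define c where "c = l * (1 - 1 / (2 * K\<^sup>2))"
  have "1 / (2 * K\<^sup>2) \<le> 1" using K by (simp add: divide_le_eq) (use one_le_power[OF K, of 2] in linarith)
  then have c0: "0 \<le> c" using l by (simp add: c_def)
  have "c < l" using l K by (simp add: c_def mult_less_cancel_left2)
  have "onorm T \<le> sqrt c"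
  proof (rule onorm_bound)
    fix u
    let ?v = "of_real (1 / l) *\<^sub>C S (T u)"
    have "norm (S (T u)) \<le> l * norm u"
      using bounded_op_norm_le[OF bounded_op_comp[OF S T], of u] onorm_cstar[OF T S adj] by (simp add: l_def)
    then have v: "norm ?v \<le> norm u"
      using l by (simp add: norm_divide divide_le_eq mult.commute)
    have "inner u ?v = (norm (T u))\<^sup>2 / l"
    proof -
      have "cinner_ell2 u (S (T u)) = of_real ((norm (T u))\<^sup>2)"
        by (simp add: adjoint_pair_sym[OF adj, unfolded adjoint_pair_def, rule_format, symmetric]
            cinner_self)
      then show ?thesis by (simp add: inner_ell2_def cinner_scale_right)
    qed
    moreover have "(norm (u - w))\<^sup>2 = (norm u)\<^sup>2 - 2 * inner u w + (norm w)\<^sup>2" for w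
      by (simp add: power2_norm_eq_inner inner_diff_left inner_diff_right inner_commute)
    ultimately have "(norm (u - ?v))\<^sup>2 = (norm u)\<^sup>2 - 2 * ((norm (T u))\<^sup>2 / l) + (norm ?v)\<^sup>2"
      by (simp only:)
    also have "(norm ?v)\<^sup>2 \<le> (norm u)\<^sup>2" by (intro power_mono v) simp
    finally have 1: "(norm (u - ?v))\<^sup>2 \<le> 2 * (norm u)\<^sup>2 - 2 * ((norm (T u))\<^sup>2 / l)" by simp
    have "(norm u)\<^sup>2 \<le> (K * norm (u - ?v))\<^sup>2"
      using below[of u] by (intro power_mono) (simp_all add: l_def)
    also have "\<dots> \<le> K\<^sup>2 * (2 * (norm u)\<^sup>2 - 2 * ((norm (T u))\<^sup>2 / l))"
      unfolding power_mult_distrib by (intro mult_left_mono 1) simp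
    finally have "(norm (T u))\<^sup>2 \<le> c * (norm u)\<^sup>2"
      using l K by (simp add: c_def field_simps)
    also have "\<dots> = (sqrt c * norm u)\<^sup>2" using c0 by (simp add: power_mult_distrib)
    finally show "norm (T u) \<le> sqrt c * norm u" using c0 by (auto intro: power2_le_imp_le)
  qed (use c0 in simp)
  from power_mono[OF this, of 2] pos c0 have "l \<le> c" by (simp add: l_def)
  with \<open>c < l\<close> show False by simp
qed

context universal_cstar
begin

text \<open>If \<open>\<pi>\<close> increased the norm of \<open>x\<close>, then \<open>1 - \<pi>(x)\<^sup>* \<pi>(x) / \<parallel>\<pi>(x)\<parallel>\<^sup>2\<close> would have a bounded inverse
  coming from a Neumann series in the algebra, although it is not bounded below.\<close>

lemma representation_contractive:
  assumes \<pi>: "representation \<A> \<pi>" and X: "cauchy X" and \<delta>: "\<And>n. p (X n) \<le> \<delta>"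
  shows "onorm (\<pi> (cl X)) \<le> \<delta>"
proof (rule ccontr)
  assume not: "\<not> ?thesis"
  have \<delta>0: "0 \<le> \<delta>" using \<delta>[of 0] nonneg order_trans by blast
  let ?T = "\<pi> (cl X)" and ?S = "\<pi> (cl (\<lambda>n. star_poly (X n)))"
  define l where "l = (onorm ?T)\<^sup>2"
  have T: "bounded_op ?T" and S: "bounded_op ?S" and adj: "adjoint_pair ?S ?T"
    using representation_cl[OF \<pi> X X] representation_cl[OF \<pi> cauchy_star[OF X] X] by auto
  have pos: "0 < onorm ?T" using not \<delta>0 by simp
  have l: "0 < l" "\<delta>\<^sup>2 < l" using not \<delta>0 pos by (auto simp: l_def intro: power_strict_mono)
  define V where "V n = of_real (1 / l) *\<^sub>P (star_poly (X n) * X n)" for n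
  have V: "cauchy V" unfolding V_def by (intro cauchy_scale cauchy_mult cauchy_star X)
  have V\<rho>: "p (V n) \<le> \<delta>\<^sup>2 / l" for n
    using l power_mono[OF \<delta>[of n] nonneg, of 2]
    by (simp add: V_def cstar norm_divide divide_right_mono)
  have \<rho>1: "\<delta>\<^sup>2 / l < 1" using l by simp
  define C where "C n = (\<Sum>k<n. V n ^ k)" for n
  have C: "cauchy C" and inv: "(\<lambda>n. p (C n * (1 - V n) - 1)) \<longlonglongrightarrow> 0"
    using cauchy_neumann[OF V V\<rho> \<rho>1] by (simp_all add: C_def[abs_def])
  define W where "W n = 1 + (-1) *\<^sub>P V n" for n
  have W: "cauchy W" unfolding W_def by (intro cauchy_add cauchy_scale cauchy_const V)
  have \<pi>V: "\<pi> (cl V) u = of_real (1 / l) *\<^sub>C ?S (?T u)" for u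
    unfolding V_def using cauchy_star[OF X] X
    by (simp add: representation_cl[OF \<pi>] cauchy_mult)
  have \<pi>W: "\<pi> (cl W) u = u - of_real (1 / l) *\<^sub>C ?S (?T u)" for u
    unfolding W_def representation_cl(3)[OF \<pi> cauchy_const cauchy_scale[OF V]]
      representation_cl(5)[OF \<pi> V V] representation_cl(2)[OF \<pi> V V] \<pi>V
    by (rule ell2_eqI) simp
  have "cl (\<lambda>n. C n * W n) = cl (\<lambda>_. 1)"
    by (rule cl_eqI) (use inv in \<open>simp add: W_def scale_poly_minus_one\<close>)
  then have CW: "\<pi> (cl C) (\<pi> (cl W) u) = u" for u
    using representation_cl(4)[OF \<pi> C W] representation_cl(2)[OF \<pi> C C] by (simp add: fun_eq_iff)
  have bC: "bounded_op (\<pi> (cl C))" by (rule representation_cl(1)[OF \<pi> C C])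
  show False
  proof (rule not_bounded_below_at_norm[OF T S adj pos])
    show "1 \<le> onorm (\<pi> (cl C)) + 1" using onorm_pos_le[OF bounded_opD(1)[OF bC]] by simp
    show "norm u \<le> (onorm (\<pi> (cl C)) + 1) * norm (u - of_real (1 / (onorm ?T)\<^sup>2) *\<^sub>C ?S (?T u))" for u
    proof -
      have "norm u \<le> onorm (\<pi> (cl C)) * norm (\<pi> (cl W) u)"
        using bounded_op_norm_le[OF bC, of "\<pi> (cl W) u"] by (simp only: CW)
      also have "\<dots> \<le> (onorm (\<pi> (cl C)) + 1) * norm (\<pi> (cl W) u)"
        by (simp add: mult_right_mono)
      finally show ?thesis by (simp only: \<pi>W l_def)
    qed
  qed
qed

text \<open>The difference \<open>Z\<close> of two sequences with equal images is killed by
  \<open>\<pi>\<close>, so \<open>\<pi>\<close> sees the constant \<open>Z n\<close> as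
  \<open>Z n\<close> minus the tail of \<open>Z\<close>. That difference is uniformly small, so
  contractivity bounds the image and the isometry hypothesis bounds \<open>p (Z n)\<close>.\<close>

lemma faithful_if_isometric:
  assumes \<pi>: "representation \<A> \<pi>" and iso: "\<And>x. p x \<le> onorm (\<pi> (cl (\<lambda>_. x)))"
  shows "faithful \<A> \<pi>"
  unfolding faithful_def
proof (rule inj_onI)
  fix S S' assume "S \<in> carrier \<A>" "S' \<in> carrier \<A>" and eq: "\<pi> S = \<pi> S'"
  then obtain X Y where X: "S = cl X" "cauchy X" and Y: "S' = cl Y" "cauchy Y"
    by (auto simp: carrier_eq)
  define Z where "Z n = X n + (-1) *\<^sub>P Y n" for n
  have Z: "cauchy Z" unfolding Z_def by (intro cauchy_add cauchy_scale X Y)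
  have \<pi>Z: "\<pi> (cl Z) u = 0" for u
    unfolding Z_def representation_cl(3)[OF \<pi> X(2) cauchy_scale[OF Y(2)]]
      representation_cl(5)[OF \<pi> Y(2) Y(2)]
    using eq X Y by simp
  have "(\<lambda>n. p (Z n)) \<longlonglongrightarrow> 0"
  proof (rule LIMSEQ_I)
    fix e :: real assume "0 < e"
    then have "0 < e / 2" by simp
    then obtain M where M: "\<And>m n. m \<ge> M \<Longrightarrow> n \<ge> M \<Longrightarrow> p (Z m - Z n) < e / 2"
      by (rule cauchyD[OF Z]) blast
    have "p (Z n) \<le> e / 2" if "n \<ge> M" for n
    proof -
      \<comment> \<open>Shifting by \<open>M\<close> keeps the class but makes every term close to
        \<open>Z n\<close>, since \<open>representation_contractive\<close> asks for a bound on all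
        terms.\<close>
      define Z' where "Z' k = Z (k + M)" for k
      have Z': "cauchy Z'"
      proof (rule cauchyI)
        fix e :: real assume "0 < e"
        then obtain N where N: "\<And>m n. m \<ge> N \<Longrightarrow> n \<ge> N \<Longrightarrow> p (Z m - Z n) < e"
          by (rule cauchyD[OF Z]) blast
        then show "\<exists>N. \<forall>m\<ge>N. \<forall>n\<ge>N. p (Z' m - Z' n) < e"
          by (intro exI[of _ N] allI impI) (simp add: Z'_def)
      qed
      have "cl Z = cl Z'"
      proof (rule cl_eqI, rule LIMSEQ_I)
        fix e :: real assume "0 < e"
        then obtain N where "\<And>m n. m \<ge> N \<Longrightarrow> n \<ge> N \<Longrightarrow> p (Z m - Z n) < e"
          by (rule cauchyD[OF Z]) blast
        then show "\<exists>N. \<forall>n\<ge>N. norm (p (Z n - Z' n) - 0) < e"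
          by (intro exI[of _ N] allI impI) (simp add: Z'_def)
      qed
      define W where "W k = Z n + (-1) *\<^sub>P Z' k" for k
      have W: "cauchy W" unfolding W_def by (intro cauchy_add cauchy_scale cauchy_const Z')
      have "\<pi> (cl W) = \<pi> (cl (\<lambda>_. Z n))"
        unfolding W_def representation_cl(3)[OF \<pi> cauchy_const cauchy_scale[OF Z']]
          representation_cl(5)[OF \<pi> Z' Z'] \<open>cl Z = cl Z'\<close>[symmetric] \<pi>Z
        by simp
      moreover have "p (W k) \<le> e / 2" for k
        using M[OF that, of "k + M"] by (simp add: W_def Z'_def scale_poly_minus_one)
      ultimately show ?thesis
        using iso[of "Z n"] representation_contractive[OF \<pi> W] order_trans by metis
    qed
    then show "\<exists>N. \<forall>n\<ge>N. norm (p (Z n) - 0) < e"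
      using \<open>0 < e\<close> by (intro exI[of _ M]) force
  qed
  then show "S = S'"
    unfolding X Y by (intro cl_eqI) (simp add: Z_def scale_poly_minus_one)
qed

end

section \<open>Extension to the completion\<close>

context uq2
begin

sublocale universal_cstar opnorm "uq2_relations q"
  by unfold_locales (simp_all add: cstar_seminorm_opnorm univ_norm_eq_opnorm)

text \<open>A class is a set of sequences, so one is chosen; \<open>rho_tendsto\<close> shows that
  the limit is the same for all of them.\<close>

definition rho_ext :: "uq2_gen universal \<Rightarrow> (nat \<times> int \<times> int) ell2 \<Rightarrow> (nat \<times> int \<times> int) ell2"
  where "rho_ext S u = lim (\<lambda>n. rho q ((SOME X. X \<in> S) n) u)"

lemma rho_convergent:
  assumes "cauchy X"
  shows "convergent (\<lambda>n. rho q (X n) u)"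
proof (rule Cauchy_convergent, rule metric_CauchyI)
  fix e :: real assume "0 < e"
  then have "0 < e / (norm u + 1)" by (simp add: add_nonneg_pos)
  then obtain M where M: "\<And>m n. m \<ge> M \<Longrightarrow> n \<ge> M \<Longrightarrow> opnorm (X m - X n) < e / (norm u + 1)"
    by (rule cauchyD[OF assms]) blast
  have "dist (rho q (X m) u) (rho q (X n) u) < e" if "m \<ge> M" "n \<ge> M" for m n
  proof -
    have "dist (rho q (X m) u) (rho q (X n) u) \<le> opnorm (X m - X n) * (norm u + 1)"
      using norm_rho_le[of "X m - X n" u] opnorm_nonneg[of "X m - X n"]
      unfolding dist_norm rho_diff distrib_left by linarith
    also have "\<dots> < e"
      using M[OF that] by (simp add: pos_less_divide_eq add_nonneg_pos)
    finally show ?thesis .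
  qed
  then show "\<exists>M. \<forall>m\<ge>M. \<forall>n\<ge>M. dist (rho q (X m) u) (rho q (X n) u) < e" by blast
qed

lemma rho_tendsto:
  assumes X: "cauchy X"
  shows "(\<lambda>n. rho q (X n) u) \<longlonglongrightarrow> rho_ext (cl X) u"
proof -
  define Y where "Y = (SOME Y. Y \<in> cl X)"
  have "Y \<in> cl X" unfolding Y_def by (rule someI[of "\<lambda>Y. Y \<in> cl X", OF self_in_cl[OF X]])
  then have Y: "cauchy Y" and XY: "(\<lambda>n. opnorm (X n - Y n)) \<longlonglongrightarrow> 0" by (auto simp: in_cl_iff)
  have "(\<lambda>n. rho q (Y n) u) \<longlonglongrightarrow> rho_ext (cl X) u"
    using rho_convergent[OF Y, of u] unfolding convergent_LIMSEQ_iff rho_ext_def Y_def .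
  moreover have "(\<lambda>n. rho q (X n) u - rho q (Y n) u) \<longlonglongrightarrow> 0"
  proof (rule Lim_null_comparison)
    show "\<forall>\<^sub>F n in sequentially. norm (rho q (X n) u - rho q (Y n) u) \<le> opnorm (X n - Y n) * norm u"
      using norm_rho_le[of "X _ - Y _" u] by (simp add: rho_diff)
    show "(\<lambda>n. opnorm (X n - Y n) * norm u) \<longlonglongrightarrow> 0"
      using XY by (rule tendsto_mult_left_zero)
  qed
  ultimately show ?thesis using tendsto_add by fastforce
qed

lemma rho_ext_eqI: "cauchy X \<Longrightarrow> (\<lambda>n. rho q (X n) u) \<longlonglongrightarrow> v \<Longrightarrow> rho_ext (cl X) u = v"
  using rho_tendsto LIMSEQ_unique by blast

lemma rho_ext_const: "rho_ext (cl (\<lambda>_. x)) = rho q x"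
  by (rule ext) (rule rho_ext_eqI, simp_all)

lemma rho_ext_bound:
  assumes "cauchy X" "\<And>n. opnorm (X n) \<le> B"
  shows "norm (rho_ext (cl X) u) \<le> B * norm u"
proof (rule LIMSEQ_le_const2)
  show "(\<lambda>n. norm (rho q (X n) u)) \<longlonglongrightarrow> norm (rho_ext (cl X) u)"
    by (intro tendsto_norm rho_tendsto assms)
  show "\<exists>N. \<forall>n\<ge>N. norm (rho q (X n) u) \<le> B * norm u"
    using norm_rho_le order_trans mult_right_mono[OF assms(2) norm_ge_zero] by blast
qed

lemma bounded_op_rho_ext:
  assumes X: "cauchy X"
  shows "bounded_op (rho_ext (cl X))"
proof -
  obtain B where B: "0 \<le> B" "\<And>n. opnorm (X n) \<le> B" using cauchy_bounded[OF X] by blast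
  show ?thesis
  proof (rule bounded_opI)
    show "rho_ext (cl X) (u + v) = rho_ext (cl X) u + rho_ext (cl X) v" for u v
      using tendsto_add[OF rho_tendsto[OF X] rho_tendsto[OF X]]
      by (intro rho_ext_eqI X) (simp add: bounded_opD)
    show "rho_ext (cl X) (c *\<^sub>C u) = c *\<^sub>C rho_ext (cl X) u" for c u
      using tendsto_scaleC[OF rho_tendsto[OF X]]
      by (intro rho_ext_eqI X) (simp add: bounded_opD)
    show "norm (rho_ext (cl X) u) \<le> B * norm u" for u
      by (rule rho_ext_bound[OF X B(2)])
  qed
qed

lemma rho_ext_mult:
  assumes X: "cauchy X" and Y: "cauchy Y"
  shows "rho_ext (cl (\<lambda>n. X n * Y n)) u = rho_ext (cl X) (rho_ext (cl Y) u)"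
proof (rule rho_ext_eqI[OF cauchy_mult[OF X Y]])
  let ?v = "rho_ext (cl Y) u"
  obtain B where B: "0 \<le> B" "\<And>n. opnorm (X n) \<le> B" using cauchy_bounded[OF X] by blast
  \<comment> \<open>Replacing \<open>rho q (Y n) u\<close> by its limit costs little because the
    operators \<open>rho q (X n)\<close> are uniformly bounded.\<close>
  have "(\<lambda>n. rho q (X n) (rho q (Y n) u - ?v)) \<longlonglongrightarrow> 0"
  proof (rule Lim_null_comparison)
    show "\<forall>\<^sub>F n in sequentially. norm (rho q (X n) (rho q (Y n) u - ?v)) \<le> B * norm (rho q (Y n) u - ?v)"
      using norm_rho_le order_trans mult_right_mono[OF B(2) norm_ge_zero]
      by (intro always_eventually) blast
    have "(\<lambda>n. rho q (Y n) u - ?v) \<longlonglongrightarrow> 0"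
      using rho_tendsto[OF Y, of u] by (simp add: LIM_zero_iff)
    then show "(\<lambda>n. B * norm (rho q (Y n) u - ?v)) \<longlonglongrightarrow> 0"
      by (intro tendsto_mult_right_zero tendsto_norm_zero)
  qed
  from tendsto_add[OF this rho_tendsto[OF X, of ?v]]
  show "(\<lambda>n. rho q (X n * Y n) u) \<longlonglongrightarrow> rho_ext (cl X) ?v"
    by (simp add: rho_mult bounded_opD)
qed

lemma adjoint_pair_rho_ext:
  assumes X: "cauchy X"
  shows "adjoint_pair (rho_ext (cl (\<lambda>n. star_poly (X n)))) (rho_ext (cl X))"
proof (rule adjoint_pairI_inner)
  show "bounded_op (rho_ext (cl (\<lambda>n. star_poly (X n))))"
    by (intro bounded_op_rho_ext cauchy_star X)
  fix u v
  have "inner (rho q (star_poly (X n)) u) v = inner u (rho q (X n) v)" for n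
    using adjoint_pair_rho by (simp add: adjoint_pair_def inner_ell2_def)
  then have "(\<lambda>n. inner u (rho q (X n) v)) \<longlonglongrightarrow> inner (rho_ext (cl (\<lambda>n. star_poly (X n))) u) v"
    using tendsto_inner[OF rho_tendsto[OF cauchy_star[OF X], of u] tendsto_const[of v]] by simp
  moreover have "(\<lambda>n. inner u (rho q (X n) v)) \<longlonglongrightarrow> inner u (rho_ext (cl X) v)"
    by (intro tendsto_inner tendsto_const rho_tendsto X)
  ultimately show "inner (rho_ext (cl (\<lambda>n. star_poly (X n))) u) v = inner u (rho_ext (cl X) v)"
    by (rule LIMSEQ_unique)
qed

lemma representation_rho_ext: "representation \<A> rho_ext"
  unfolding representation_def
proof (intro conjI ballI allI)
  fix S T assume S: "S \<in> carrier \<A>"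
  then obtain X where X: "S = cl X" "cauchy X" by (auto simp: carrier_eq)
  show "bounded_op (rho_ext S)" unfolding X by (rule bounded_op_rho_ext[OF X(2)])
  show "rho_ext (c \<odot>\<^bsub>\<A>\<^esub> S) = (\<lambda>u. c *\<^sub>C rho_ext S u)" for c
    unfolding X cl_scale[OF X(2)] using tendsto_scaleC[OF rho_tendsto[OF X(2)]]
    by (intro ext rho_ext_eqI cauchy_scale X) (simp add: rho_scale)
  show "cinner_ell2 (rho_ext (star \<A> S) u) v = cinner_ell2 u (rho_ext S v)" for u v
    unfolding X cl_star[OF X(2)] using adjoint_pair_rho_ext[OF X(2)] by (simp add: adjoint_pair_def)
  assume "T \<in> carrier \<A>"
  then obtain Y where Y: "T = cl Y" "cauchy Y" by (auto simp: carrier_eq)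
  show "rho_ext (S \<oplus>\<^bsub>\<A>\<^esub> T) = (\<lambda>u. rho_ext S u + rho_ext T u)"
    unfolding X Y cl_add[OF X(2) Y(2)]
    using tendsto_add[OF rho_tendsto[OF X(2)] rho_tendsto[OF Y(2)]]
    by (intro ext rho_ext_eqI cauchy_add X Y) (simp add: rho_add)
  show "rho_ext (S \<otimes>\<^bsub>\<A>\<^esub> T) = rho_ext S \<circ> rho_ext T"
    unfolding X Y cl_mult[OF X(2) Y(2)] by (rule ext) (simp add: rho_ext_mult X Y)
next
  show "rho_ext \<one>\<^bsub>\<A>\<^esub> = id"
    unfolding one_eq rho_ext_const by (rule rho_one)
qed

section \<open>Representations with the prescribed values on generators\<close>

lemma univ_gen_eq: "univ_gen (uq2_relations q) g = cl (\<lambda>_. gen g)"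
  by (simp add: univ_gen_def univ_norm_eq)

lemma uq2_rep_iff:
  assumes "\<theta> = Arg q / pi"
  shows "uq2_rep q \<theta> \<pi> \<longleftrightarrow> representation \<A> \<pi> \<and> (\<forall>g. \<pi> (cl (\<lambda>_. gen g)) = rho q (gen g))"
proof -
  have "(\<forall>g. P g) \<longleftrightarrow> P GenA \<and> P GenB \<and> P GenD" for P
    by (metis uq2_gen.exhaust)
  then show ?thesis
    unfolding uq2_rep_def C_Uq2_def uq2_a_def uq2_b_def uq2_D_def univ_gen_eq
      rho_GenA rho_GenB rho_GenD[OF assms]
    by simp
qed

text \<open>Agreement on generators passes to their adjoints by uniqueness of adjoints, then to
  words by multiplicativity and to polynomials by linearity.\<close>

lemma representation_eq_rho:
  assumes \<pi>: "representation \<A> \<pi>" and gens: "\<And>g. \<pi> (cl (\<lambda>_. gen g)) = rho q (gen g)"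
  shows "\<pi> (cl (\<lambda>_. x)) = rho q x"
proof -
  note rep = representation_cl[OF \<pi> cauchy_const cauchy_const]
  have letter: "\<pi> (cl (\<lambda>_. letter g s)) = rho q (letter g s)" for g s
  proof (cases s)
    case True
    show ?thesis
      using rep(6)[of "gen g"] adjoint_pair_rho[of "gen g"]
      unfolding gens star_poly_gen by (simp add: True adjoint_pair_unique)
  qed (use gens[of g] in \<open>simp add: gen_eq_word_poly\<close>)
  have word: "\<pi> (cl (\<lambda>_. word_poly l)) = rho q (word_poly l)" for l
  proof (induction l)
    case (Cons s l)
    have "\<pi> (cl (\<lambda>_. word_poly (s # l))) = \<pi> (cl (\<lambda>_. word_poly [s])) \<circ> \<pi> (cl (\<lambda>_. word_poly l))"
      by (subst word_poly_Cons) (rule rep(4))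
    also have "\<dots> = rho q (word_poly (s # l))"
      using letter[of "fst s" "snd s"] by (simp add: Cons fun_eq_iff)
    finally show ?case .
  qed (simp add: rep(2))
  show ?thesis
  proof (induction x rule: star_poly_induct)
    case zero
    show ?case using rep(5)[of 0 0] by (simp add: fun_eq_iff)
  next
    case (single w c)
    show ?case
      unfolding single_eq_word_poly rep(5) word by (simp add: fun_eq_iff rho_scale)
  next
    case (add x y)
    then show ?case by (simp add: rep(3) fun_eq_iff rho_add)
  qed
qed

end

theorem proposition2p1:
  fixes q :: complex and \<theta> :: real
  assumes "0 < cmod q" and "cmod q < 1" and "\<theta> = Arg q / pi"
  shows "(\<exists>\<pi>. uq2_rep q \<theta> \<pi>) \<and> (\<forall>\<pi>. uq2_rep q \<theta> \<pi> \<longrightarrow> faithful (C_Uq2 q) \<pi>)"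
proof -
  interpret uq2 q by unfold_locales fact+
  have "uq2_rep q \<theta> rho_ext"
    by (simp add: uq2_rep_iff[OF assms(3)] representation_rho_ext rho_ext_const)
  \<comment> \<open>On constant sequences \<open>\<pi>\<close> agrees with \<open>rho q\<close>, so
    its operator norm there is \<open>opnorm\<close>, the universal norm; this is the isometry
    required.\<close>
  moreover have "faithful (C_Uq2 q) \<pi>" if "uq2_rep q \<theta> \<pi>" for \<pi>
    using that unfolding uq2_rep_iff[OF assms(3)] C_Uq2_def
    by (intro faithful_if_isometric) (simp_all add: representation_eq_rho opnorm_def)
  ultimately show ?thesis by blast
qed

end
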